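(* Let $\mathcal S$ be the universal cover of $Sp(2n,\mathbb R)$ with the bi-invariant partial order induced by the normal cone of elements generated by non-negative quadratic Hamiltonians (see context), and let $(Z,d)$ be the metric space associated to this partially ordered group. Then $(Z,d)$ is isometric to $\mathbb R$ with its standard metric. More precisely, the map $X\mapsto \log\tilde\mu(X)$ on the set $\mathcal S^+$ of dominants descends to an isometry $Z\to\mathbb R$, where $\tilde\mu$ is the homogenized Maslov quasimorphism.
   Context: Partially ordered groups: let $\mathcal D$ be a group and $\mathcal C\subset\mathcal D$ a normal cone, i.e. $f,g\in\mathcal C\Rightarrow fg\in\mathcal C$; $f\in\mathcal C,h\in\mathcal D\Rightarrow hfh^{-1}\in\mathcal C$; $1\in\mathcal C$. Write $f\ge g$ iff $fg^{-1}\in\mathcal C$; when this relation is antisymmetric it is a bi-invariant partial order. A dominant is $f\in\mathcal C\setminus\{1\}$ such that for every $g\in\mathcal D$ there is $n\in\mathbb N$ with $f^n\ge g$. For a dominant $f$ and $g\in\mathcal D$, $\gamma_n(f,g)=\inf\{p\in\mathbb Z: f^p\ge g^n\}$ and the relative growth is $\gamma(f,g)=\lim_{n\to\infty}\gamma_n(f,g)/n$. On the set $\mathcal C^+$ of dominants put $K(f,g)=\max\{\log\gamma(f,g),\log\gamma(g,f)\}$, a pseudo-distance; $Z=\mathcal C^+/\!\sim$ where $f\sim g$ iff $K(f,g)=0$, and $d$ is the metric induced by $K$. Symplectic setting: $J=\begin{pmatrix}0&-I\\ I&0\end{pmatrix}$ on $\mathbb R^{2n}$. $\mathcal S$ is the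 universal cover of $Sp(2n,\mathbb R)$ based at the identity: its elements are homotopy classes (rel endpoints) of paths $X:[0,1]\to Sp(2n,\mathbb R)$ with $X(0)=I$. Such a path satisfies $\dot X(t)X(t)^{-1}=JH(t)$ for a symmetric matrix $H(t)$ (the Hamiltonian of the path). The cone consists of elements representable by a path with $H(t)$ positive semidefinite for all $t$; the set $\mathcal S^+$ of dominants consists of the elements representable by a path with $H(t)$ positive definite for all $t$. (It is known, by Olshanskii, that this cone gives a genuine partial order.) Maslov quasimorphism: identify $U(n)$ with $Sp(2n,\mathbb R)\cap O(2n)$ via $A+iB\mapsto\begin{pmatrix}A&-B\\ B&A\end{pmatrix}$. For $X\in\mathcal S$ represented by $\Psi(t)$, take the polar decomposition $\Psi(t)=U(t)P(t)$ with $U(t)$ unitary and $P(t)$ symmetric positive definite, choose continuous $\theta(t)$ with $\det_{\mathbb C}U(t)=e^{i\theta(t)}$, and set $\mu(X)=\theta(1)-\theta(0)$. $\mu$ is a quasimorphism, i.e. $|\mu(fg)-\mu(f)-\mu(g)|\le C$ for some constant $C$ and all $f,g$; its homogenization is $\tilde\mu(X)=\lim_{k\to\infty}\mu(X^k)/k$. *)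

theory Defs
  imports "HOL-Analysis.Analysis"
begin

type_synonym 'n smat = "real ^ ('n + 'n) ^ ('n + 'n)"

definition Jmat :: "'n::finite smat" where
  "Jmat = (\<chi> i j. case (i, j) of
      (Inl a, Inr b) \<Rightarrow> (if a = b then -1 else 0)
    | (Inr a, Inl b) \<Rightarrow> (if a = b then 1 else 0)
    | _ \<Rightarrow> 0)"

definition Sp :: "'n::finite smat set" where
  "Sp = {M. transpose M ** Jmat ** M = Jmat}"

text \<open>Paths representing elements of the universal cover of Sp(2n,R).\<close>
definition spath :: "(real \<Rightarrow> 'n::finite smat) \<Rightarrow> bool" where
  "spath p \<longleftrightarrow> path p \<and> path_image p \<subseteq> Sp \<and> pathstart p = mat 1"

text \<open>Equality in the universal cover: homotopy rel endpoints inside Sp.\<close>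
definition same_elem :: "(real \<Rightarrow> 'n::finite smat) \<Rightarrow> (real \<Rightarrow> 'n smat) \<Rightarrow> bool" where
  "same_elem p q \<longleftrightarrow> homotopic_paths Sp p q"

definition psd :: "'n::finite smat \<Rightarrow> bool" where
  "psd H \<longleftrightarrow> (\<forall>v. v \<bullet> (H *v v) \<ge> 0)"

text \<open>Element represented by a C^1 path whose Hamiltonian H(t) (with X' X^{-1} = J H)
  is symmetric positive semidefinite for all t.\<close>
definition in_cone :: "(real \<Rightarrow> 'n::finite smat) \<Rightarrow> bool" where
  "in_cone p \<longleftrightarrow> spath p \<and> (\<exists>q q'. spath q \<and> same_elem p q \<and>
      (\<forall>t\<in>{0..1}. (q has_vector_derivative q' t) (at t within {0..1})) \<and>
      continuous_on {0..1} q' \<and>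
      (\<forall>t\<in>{0..1}. \<exists>H. transpose H = H \<and> psd H \<and> q' t ** matrix_inv (q t) = Jmat ** H))"

definition pmult :: "(real \<Rightarrow> 'n::finite smat) \<Rightarrow> (real \<Rightarrow> 'n smat) \<Rightarrow> real \<Rightarrow> 'n smat" where
  "pmult p q = (\<lambda>t. p t ** q t)"

definition pinv :: "(real \<Rightarrow> 'n::finite smat) \<Rightarrow> real \<Rightarrow> 'n smat" where
  "pinv p = (\<lambda>t. matrix_inv (p t))"

definition pone :: "real \<Rightarrow> 'n::finite smat" where
  "pone = (\<lambda>t. mat 1)"

fun mpow :: "(real \<Rightarrow> 'n::finite smat) \<Rightarrow> nat \<Rightarrow> real \<Rightarrow> 'n smat" where
  "mpow p 0 = pone"
| "mpow p (Suc k) = pmult p (mpow p k)"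

definition zpow :: "(real \<Rightarrow> 'n::finite smat) \<Rightarrow> int \<Rightarrow> real \<Rightarrow> 'n smat" where
  "zpow p k = (if k \<ge> 0 then mpow p (nat k) else mpow (pinv p) (nat (- k)))"

definition sge :: "(real \<Rightarrow> 'n::finite smat) \<Rightarrow> (real \<Rightarrow> 'n smat) \<Rightarrow> bool" where
  "sge f g \<longleftrightarrow> in_cone (pmult f (pinv g))"

definition dominant :: "(real \<Rightarrow> 'n::finite smat) \<Rightarrow> bool" where
  "dominant f \<longleftrightarrow> in_cone f \<and> \<not> same_elem f pone \<and>
     (\<forall>g. spath g \<longrightarrow> (\<exists>n::nat. sge (mpow f n) g))"

definition gamma_n :: "(real \<Rightarrow> 'n::finite smat) \<Rightarrow> (real \<Rightarrow> 'n smat) \<Rightarrow> nat \<Rightarrow> real" where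
  "gamma_n f g n = Inf {real_of_int p | p. sge (zpow f p) (mpow g n)}"

definition rel_growth :: "(real \<Rightarrow> 'n::finite smat) \<Rightarrow> (real \<Rightarrow> 'n smat) \<Rightarrow> real" where
  "rel_growth f g = lim (\<lambda>n. gamma_n f g n / real n)"

definition Kdist :: "(real \<Rightarrow> 'n::finite smat) \<Rightarrow> (real \<Rightarrow> 'n smat) \<Rightarrow> real" where
  "Kdist f g = max (ln (rel_growth f g)) (ln (rel_growth g f))"

definition Zrel :: "((real \<Rightarrow> 'n::finite smat) \<times> (real \<Rightarrow> 'n smat)) set" where
  "Zrel = {(f, g). dominant f \<and> dominant g \<and> Kdist f g = 0}"

definition Zspace :: "(real \<Rightarrow> 'n::finite smat) set set" where
  "Zspace = {f. dominant f} // Zrel"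

definition Zdist :: "(real \<Rightarrow> 'n::finite smat) set \<Rightarrow> (real \<Rightarrow> 'n smat) set \<Rightarrow> real" where
  "Zdist A B = Kdist (SOME f. f \<in> A) (SOME g. g \<in> B)"

definition orthogonal_smat :: "'n::finite smat \<Rightarrow> bool" where
  "orthogonal_smat U \<longleftrightarrow> transpose U ** U = mat 1"

definition pd :: "'n::finite smat \<Rightarrow> bool" where
  "pd P \<longleftrightarrow> (\<forall>v. v \<noteq> 0 \<longrightarrow> v \<bullet> (P *v v) > 0)"

definition polar_U :: "'n::finite smat \<Rightarrow> 'n smat" where
  "polar_U M = (THE U. orthogonal_smat U \<and> transpose (transpose U ** M) = transpose U ** M
                      \<and> pd (transpose U ** M))"

text \<open>Complex determinant of U = [[A,-B],[B,A]] viewed as A + iB in U(n).\<close>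
definition cdet :: "'n::finite smat \<Rightarrow> complex" where
  "cdet U = det (\<chi> (i::'n) (j::'n). complex_of_real (U $ Inl i $ Inl j) + \<i> * complex_of_real (U $ Inr i $ Inl j))"

definition maslov :: "(real \<Rightarrow> 'n::finite smat) \<Rightarrow> real" where
  "maslov p = (THE m. \<exists>\<theta>. continuous_on {0..1} \<theta> \<and>
      (\<forall>t\<in>{0..1}. cdet (polar_U (p t)) = exp (\<i> * complex_of_real (\<theta> t))) \<and>
      m = \<theta> 1 - \<theta> 0)"

definition maslov_hom :: "(real \<Rightarrow> 'n::finite smat) \<Rightarrow> real" where
  "maslov_hom p = lim (\<lambda>k. maslov (mpow p k) / real k)"

end

theory Submission
  imports Defs "HOL-Computational_Algebra.Fundamental_Theorem_Algebra"
begin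

text \<open>The order is determined by the Maslov quasimorphism \<open>\<mu>\<close> up to a bounded error: elements of the cone
  have \<open>\<mu> \<ge> 0\<close>, and every element with \<open>\<mu>\<close> above a constant depending only on \<open>n\<close> lies in the cone. Hence
  \<open>f\<^sup>p \<ge> g\<^sup>k\<close> holds exactly when \<open>p \<mu>'(f) \<ge> k \<mu>'(g)\<close> up to a bounded error, where \<open>\<mu>'\<close> is the
  homogenization, so the relative growth of \<open>f\<close> and \<open>g\<close> is \<open>\<mu>'(g) / \<mu>'(f)\<close>.

  For the second claim, let \<open>p\<close> be a path with large \<open>\<mu>\<close>. After division by a positive path of
  bounded \<open>\<mu>\<close> its end point is unitary, and polar decomposition retracts it to a path of unitary
  matrices. Simple connectivity of the odd-dimensional spheres then splits off one complex rotation for each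
  coordinate. All of these rotations but the last one are chosen positive and bounded, so the last one is
  positive when \<open>\<mu>(p)\<close> is large.\<close>


subsection \<open>Real matrices and the spectral theorem\<close>

text \<open>None of the constants has to be sharp: dividing by the exponent removes every error that
  depends on \<open>n\<close> alone. They all derive from one defect, \<open>n * pi\<close>. It
  arises because the product of two symplectic matrices, with its antilinear contribution scaled by
  a complex parameter, has a determinant that is a polynomial of degree at most \<open>n\<close> in
  this parameter without zeros in the closed unit disc; its argument therefore varies by at most
  \<open>n * pi / 2\<close> along a radius, once at each end of the paths.

  The obstacle in the second claim is that the cone asks for differentiable paths with semidefinite
  Hamiltonian, while homotopies yield merely continuous ones. Positivity is therefore never
  extracted from a given path. The homotopy class is rewritten as a product of explicit paths,
  namely rotations about complex lines and one conjugate of a scalar rotation, whose Hamiltonians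
  are visible. The last coordinate is exceptional because its unit sphere is a circle: the winding
  there is the one invariant left after all deformations, and the index of the path controls its
  sign.\<close>

declare transpose_matrix_vector [simp del]

lemma transpose_nth [simp]: "transpose A $ i $ j = A $ j $ i"
  by (simp add: transpose_def)

lemma matrix_eqI:
  fixes A B :: "real^'n^'m"
  assumes "\<And>x. A *v x = B *v x"
  shows "A = B"
  using assms by (simp add: matrix_eq)

lemma matrix_mult_vector: "(A ** B) *v x = A *v (B *v (x::real^'n))"
  by (simp add: matrix_vector_mul_assoc)

lemma matrix_uminus_vector: "(- A) *v x = - (A *v (x::real^'n))"
  by (simp add: matrix_vector_mult_def vec_eq_iff sum_negf)

lemma matrix_vector_uminus: "A *v (- x) = - (A *v (x::real^'n))"
  by (simp add: matrix_vector_mult_def vec_eq_iff sum_negf)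

lemma scaleR_matrix_vector: "(c *\<^sub>R A) *v x = c *\<^sub>R (A *v (x::real^'n))"
  by (simp add: scaleR_matrix_vector_assoc)

lemma matrix_mult_sum_vector: "(A + B) *v x = A *v x + B *v (x::real^'n)"
  by (simp add: matrix_vector_mult_add_rdistrib)

lemma matrix_mult_diff_vector: "(A - B) *v x = A *v x - B *v (x::real^'n)"
  by (simp add: matrix_vector_mult_diff_rdistrib)

lemma matrix_vector_scaleR: "A *v (c *\<^sub>R x) = c *\<^sub>R (A *v (x::real^'n))"
  by (simp add: matrix_vector_mult_scaleR)

lemmas mvec = matrix_mult_vector matrix_uminus_vector matrix_vector_uminus scaleR_matrix_vector
  matrix_mult_sum_vector matrix_mult_diff_vector matrix_vector_scaleR matrix_vector_right_distrib
  matrix_vector_mult_diff_distrib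

lemma transpose_add: "transpose (A + B) = transpose A + transpose (B::real^'n^'m)"
  and transpose_diff: "transpose (A - B) = transpose A - transpose (B::real^'n^'m)"
  and transpose_uminus: "transpose (- B) = - transpose (B::real^'n^'m)"
  by (simp_all add: vec_eq_iff)

lemmas transpose_simps = transpose_add transpose_diff transpose_uminus transpose_scalar matrix_transpose_mul

lemma inner_transpose: "x \<bullet> (A *v y) = (transpose A *v x) \<bullet> (y::real^'n)"
  by (simp add: dot_lmul_matrix transpose_matrix_vector)

lemma inner_transpose2: "(A *v x) \<bullet> y = x \<bullet> (transpose A *v (y::real^'n))"
  by (metis inner_transpose transpose_transpose)

lemma bounded_bilinear_matrix_mult:
  "bounded_bilinear (\<lambda>(A::real^'n^'m) (B::real^'k^'n). A ** B)"
proof (rule bilinear_conv_bounded_bilinear[THEN iffD1])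
  have "bilinear (\<lambda>(A::real^'n^'m) (B::real^'k^'n). A ** B)"
    unfolding bilinear_def
    by (auto intro!: linearI matrix_eqI simp: mvec)
  then show "bilinear (\<lambda>(A::real^'n^'m) (B::real^'k^'n). A ** B)" .
qed

lemma bounded_bilinear_matrix_vector:
  "bounded_bilinear (\<lambda>(A::real^'n^'m) (x::real^'n). A *v x)"
proof (rule bilinear_conv_bounded_bilinear[THEN iffD1])
  show "bilinear (\<lambda>(A::real^'n^'m) (x::real^'n). A *v x)"
    unfolding bilinear_def by (auto intro!: linearI simp: mvec)
qed

lemmas continuous_on_matrix_mult [continuous_intros] =
  bounded_bilinear.continuous_on[OF bounded_bilinear_matrix_mult]
lemmas continuous_on_matrix_vector [continuous_intros] =
  bounded_bilinear.continuous_on[OF bounded_bilinear_matrix_vector]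
lemmas has_vector_derivative_matrix_mult =
  bounded_bilinear.has_vector_derivative[OF bounded_bilinear_matrix_mult]

lemmas matrix_mult_distribs =
  bounded_bilinear.add_left[OF bounded_bilinear_matrix_mult]
  bounded_bilinear.add_right[OF bounded_bilinear_matrix_mult]
  bounded_bilinear.diff_left[OF bounded_bilinear_matrix_mult]
  bounded_bilinear.diff_right[OF bounded_bilinear_matrix_mult]
  bounded_bilinear.minus_left[OF bounded_bilinear_matrix_mult]
  bounded_bilinear.minus_right[OF bounded_bilinear_matrix_mult]
  bounded_bilinear.scaleR_left[OF bounded_bilinear_matrix_mult]
  bounded_bilinear.scaleR_right[OF bounded_bilinear_matrix_mult]

lemma linear_transpose: "linear (transpose :: real^'n^'m \<Rightarrow> real^'m^'n)"
  by (rule linearI) (simp_all add: transpose_simps)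

lemma bounded_linear_transpose: "bounded_linear (transpose :: real^'n^'m \<Rightarrow> real^'m^'n)"
  using linear_transpose linear_linear by blast

lemmas continuous_on_transpose [continuous_intros] =
  bounded_linear.continuous_on[OF bounded_linear_transpose]

lemma continuous_on_det [continuous_intros]:
  fixes A :: "'a::topological_space \<Rightarrow> ('b::{comm_ring_1, real_normed_field})^'n^'n"
  assumes "continuous_on S A"
  shows "continuous_on S (\<lambda>x. det (A x))"
  unfolding det_def using assms by (intro continuous_intros)

lemma matrix_inv_unique:
  fixes A B :: "real^'n^'n"
  assumes "A ** B = mat 1"
  shows "matrix_inv A = B"
proof -
  have BA: "B ** A = mat 1" using assms by (simp add: matrix_left_right_inverse)
  have "A ** matrix_inv A = mat 1 \<and> matrix_inv A ** A = mat 1"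
    unfolding matrix_inv_def by (rule someI[of _ B]) (simp add: assms BA)
  then show ?thesis by (metis BA matrix_mul_assoc matrix_mul_lid matrix_mul_rid)
qed

lemma
  fixes A :: "real^'n^'n"
  assumes "invertible A"
  shows matrix_inv_right: "A ** matrix_inv A = mat 1" and matrix_inv_left: "matrix_inv A ** A = mat 1"
  using assms matrix_inv_unique unfolding invertible_def by metis+

lemma invertibleI_inj:
  fixes A :: "real^'n^'n"
  assumes "\<And>x. A *v x = 0 \<Longrightarrow> x = 0"
  shows "invertible A"
  using assms matrix_left_invertible_ker[of A] by (metis invertible_left_inverse)

text \<open>Cramer's rule for the right-hand side \<open>axis l 1\<close>. With entries presented as
  quotients of determinants, continuity of inversion is immediate.\<close>

lemma matrix_inv_entry:
  fixes A :: "real^'n^'n"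
  assumes "invertible A"
  shows "matrix_inv A $ k $ l = det (\<chi> i j. if j = k then axis l 1 $ i else A $ i $ j) / det A"
proof -
  have "A *v (matrix_inv A *v axis l 1) = axis l 1"
    using matrix_inv_right[OF assms] by (metis matrix_vector_mul_assoc matrix_vector_mul_lid)
  moreover have "det A \<noteq> 0" using assms by (simp add: invertible_det_nz)
  ultimately have "matrix_inv A *v axis l 1 = (\<chi> k. det (\<chi> i j. if j = k then axis l 1 $ i else A $ i $ j) / det A)"
    by (simp add: cramer)
  moreover have "(matrix_inv A *v axis l 1) $ k = matrix_inv A $ k $ l"
    by (simp add: matrix_vector_mult_basis column_def)
  ultimately show ?thesis by simp
qed

lemma continuous_on_matrix_inv:
  fixes A :: "'a::topological_space \<Rightarrow> real^'n^'n"
  assumes "continuous_on S A" and inv: "\<And>x. x \<in> S \<Longrightarrow> invertible (A x)"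
  shows "continuous_on S (\<lambda>x. matrix_inv (A x))"
proof -
  have *: "continuous_on S (\<lambda>x. \<chi> i j. if j = k then axis l 1 $ i else A x $ i $ j)" for k l :: 'n
  proof (intro continuous_on_vec_lambda)
    fix i j :: 'n
    show "continuous_on S (\<lambda>x. if j = k then axis l 1 $ i else A x $ i $ j)"
      using assms(1) by (cases "j = k") (auto intro!: continuous_intros)
  qed
  have "continuous_on S (\<lambda>x. \<chi> k l. det (\<chi> i j. if j = k then axis l 1 $ i else A x $ i $ j) / det (A x))"
    using assms by (intro continuous_on_vec_lambda continuous_on_divide continuous_on_det *)
      (auto simp: invertible_det_nz)
  then show ?thesis
    by (rule continuous_on_eq) (simp add: vec_eq_iff matrix_inv_entry inv)
qed

section \<open>The spectral theorem and positive square roots\<close>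

definition diagm :: "('k \<Rightarrow> real) \<Rightarrow> real^'k^'k" where
  "diagm d = (\<chi> i j. if i = j then d i else 0)"

lemma diagm_mult: "diagm c ** diagm d = diagm (\<lambda>i. c i * d i)"
proof -
  have "(\<Sum>k\<in>UNIV. (if i = k then c i else 0) * (if k = j then d k else 0)) = (if i = j then c i * d i else 0)" for i j
    by (subst sum.cong[OF refl, of _ _ "\<lambda>k. if k = i then (if i = j then c i * d i else 0) else 0"]) auto
  then show ?thesis by (simp add: diagm_def matrix_matrix_mult_def vec_eq_iff)
qed

lemma transpose_diagm [simp]: "transpose (diagm d) = diagm d"
  by (auto simp: diagm_def vec_eq_iff)

lemma diagm_vector: "(diagm d *v x) $ i = d i * x $ i"
proof -
  have "(\<Sum>j\<in>UNIV. (if i = j then d i else 0) * x $ j) = (\<Sum>j\<in>UNIV. if j = i then d i * x $ i else 0)"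
    by (rule sum.cong) auto
  then show ?thesis by (simp add: diagm_def matrix_vector_mult_def)
qed

lemma orthogonal_rows_iff:
  fixes V :: "real^'k^'k"
  shows "V ** transpose V = mat 1 \<longleftrightarrow> (\<forall>i j. V$i \<bullet> V$j = (if i = j then 1 else 0))"
  by (simp add: vec_eq_iff matrix_matrix_mult_def inner_vec_def mat_def)

lemma orthogonal_norm_bound:
  fixes V :: "real^'k^'k"
  assumes "V ** transpose V = mat 1"
  shows "norm V \<le> sqrt (real CARD('k))"
proof -
  have "norm (V$i) = 1" for i
    using assms by (simp add: orthogonal_rows_iff norm_eq_sqrt_inner)
  then show ?thesis by (simp add: norm_vec_def L2_set_def)
qed

lemma compact_orthogonal: "compact {V :: real^'k^'k. V ** transpose V = mat 1}"
proof (rule compact_eq_bounded_closed[THEN iffD2], intro conjI)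
  show "bounded {V :: real^'k^'k. V ** transpose V = mat 1}"
    using orthogonal_norm_bound by (auto simp: bounded_iff)
  show "closed {V :: real^'k^'k. V ** transpose V = mat 1}"
    by (intro closed_Collect_eq continuous_intros)
qed

text \<open>For small \<open>x\<close> with the sign of \<open>b\<close> the linear term would
  outweigh the quadratic one. This is the first-order condition at an extremum, free of
  derivatives.\<close>

lemma quadratic_nonpos_imp_linear_zero:
  fixes a b :: real
  assumes "\<And>x. x\<^sup>2 * a + x * b \<le> 0"
  shows "b = 0"
proof (rule ccontr)
  assume b: "b \<noteq> 0"
  define e where "e = b / (2 * (\<bar>a\<bar> + 1))"
  have "e\<^sup>2 * a + e * b \<le> 0" by (rule assms)
  moreover have "e * b = 2 * (\<bar>a\<bar> + 1) * e\<^sup>2"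
    by (simp add: e_def power2_eq_square)
  ultimately have "e\<^sup>2 * (a + 2 * (\<bar>a\<bar> + 1)) \<le> 0" by (simp add: algebra_simps)
  moreover have "e\<^sup>2 > 0" using b by (simp add: e_def)
  moreover have "a + 2 * (\<bar>a\<bar> + 1) > 0" by (simp add: abs_if)
  ultimately show False by (simp add: mult_le_0_iff)
qed

text \<open>The diagonalizing frame maximizes a weighted sum of the diagonal entries with pairwise distinct
  weights: a rotation in the plane of two frame vectors cannot increase it.\<close>

theorem spectral_theorem:
  fixes P :: "real^'k::finite^'k"
  assumes sym: "transpose P = P"
  obtains V :: "real^'k^'k" and d where "V ** transpose V = mat 1" "P = transpose V ** diagm d ** V"
proof -
  obtain w :: "'k \<Rightarrow> real" where w: "inj w"
  proof -
    obtain g :: "'k \<Rightarrow> nat" where "inj g" using finite_imp_inj_to_nat_seg[of "UNIV::'k set"] by auto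
    then have "inj (\<lambda>k. real (g k))" by (simp add: inj_def)
    then show thesis using that by blast
  qed
  let ?O = "{V :: real^'k^'k. V ** transpose V = mat 1}"
  define f :: "real^'k^'k \<Rightarrow> real" where "f V = (\<Sum>k\<in>UNIV. w k * (V$k \<bullet> (P *v V$k)))" for V
  have "continuous_on ?O f" unfolding f_def by (intro continuous_intros)
  moreover have "mat 1 \<in> ?O" by simp
  ultimately obtain V where V: "V \<in> ?O" and max: "\<And>V'. V' \<in> ?O \<Longrightarrow> f V' \<le> f V"
    using continuous_attains_sup[OF compact_orthogonal, of f] by blast
  have on: "V$i \<bullet> V$j = (if i = j then 1 else 0)" for i j
    using V by (simp add: orthogonal_rows_iff)
  have off: "V$i \<bullet> (P *v V$j) = 0" if ij: "i \<noteq> j" for i j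
  proof -
    define a b d where "a = V$i \<bullet> (P *v V$i)" and "b = V$i \<bullet> (P *v V$j)" and "d = V$j \<bullet> (P *v V$j)"
    have b': "V$j \<bullet> (P *v V$i) = b"
      unfolding b_def by (metis inner_commute inner_transpose sym)
    \<comment> \<open>Rotating the frame vectors \<open>i\<close> and \<open>j\<close> by an angle
      with tangent \<open>x\<close> changes \<open>f\<close> by this quantity times
      \<open>r\<^sup>2 = 1 / (1 + x\<^sup>2)\<close>. Maximality makes it nonpositive for every
      \<open>x\<close>, so its linear coefficient vanishes.\<close>
    have "x\<^sup>2 * ((w i - w j) * (d - a)) + x * (2 * (w i - w j) * b) \<le> 0" for x
    proof -
      define r where "r = 1 / sqrt (1 + x\<^sup>2)"
      have r: "r\<^sup>2 * (1 + x\<^sup>2) = 1" and rpos: "r\<^sup>2 > 0"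
        using sum_power2_gt_zero_iff[of 1 x] by (simp_all add: r_def power_divide)
      define c e where "c = r" and "e = x * r"
      have cs: "c * c + e * e = 1" using r by (simp add: c_def e_def power2_eq_square algebra_simps)
      define V' where "V' = (\<chi> k. if k = i then c *\<^sub>R V$i + e *\<^sub>R V$j else if k = j then c *\<^sub>R V$j - e *\<^sub>R V$i else V$k)"
      have "V' \<in> ?O"
        unfolding mem_Collect_eq orthogonal_rows_iff V'_def using ij cs
        by (auto simp: on inner_add_left inner_add_right inner_diff_left inner_diff_right mult.commute)
      then have le: "f V' \<le> f V" by (rule max)
      have split: "(\<Sum>k\<in>UNIV. g k) = g i + g j + (\<Sum>k\<in>UNIV - {i,j}. g k)" for g :: "'k \<Rightarrow> real"
        using ij by (simp add: sum.remove[of UNIV i] sum.remove[of "UNIV - {i}" j] Diff_insert[symmetric] insert_commute)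
      have "(\<Sum>k\<in>UNIV - {i,j}. w k * (V'$k \<bullet> (P *v V'$k))) = (\<Sum>k\<in>UNIV - {i,j}. w k * (V$k \<bullet> (P *v V$k)))"
        by (rule sum.cong) (auto simp: V'_def)
      moreover have "V'$i \<bullet> (P *v V'$i) = c*c*a + 2*c*e*b + e*e*d"
        by (simp add: V'_def mvec inner_add_left inner_add_right a_def[symmetric] b_def[symmetric] b' d_def[symmetric] algebra_simps)
      moreover have "V'$j \<bullet> (P *v V'$j) = e*e*a - 2*c*e*b + c*c*d"
        using ij by (simp add: V'_def mvec inner_add_left inner_add_right inner_diff_left inner_diff_right a_def[symmetric] b_def[symmetric] b' d_def[symmetric] algebra_simps)
      ultimately have "w i * (c*c*a + 2*c*e*b + e*e*d) + w j * (e*e*a - 2*c*e*b + c*c*d) \<le> w i * a + w j * d"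
        using le unfolding f_def split[of "\<lambda>k. w k * (V'$k \<bullet> (P *v V'$k))"] split[of "\<lambda>k. w k * (V$k \<bullet> (P *v V$k))"]
        by (simp add: a_def d_def)
      moreover have "c*c*a + 2*c*e*b + e*e*d = a + (e*e*(d - a) + 2*c*e*b)"
        using arg_cong[OF cs, of "\<lambda>y. y * a"] by (simp add: algebra_simps)
      moreover have "e*e*a - 2*c*e*b + c*c*d = d - (e*e*(d - a) + 2*c*e*b)"
        using arg_cong[OF cs, of "\<lambda>y. y * d"] by (simp add: algebra_simps)
      ultimately have "w i * (a + (e*e*(d - a) + 2*c*e*b)) + w j * (d - (e*e*(d - a) + 2*c*e*b)) \<le> w i * a + w j * d"
        by (simp only:)
      then have "(w i - w j) * (e*e*(d - a) + 2*c*e*b) \<le> 0"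
        by (simp add: distrib_left left_diff_distrib right_diff_distrib)
      then have "r\<^sup>2 * (x\<^sup>2 * ((w i - w j) * (d - a)) + x * (2 * (w i - w j) * b)) \<le> 0"
        by (simp add: c_def e_def power2_eq_square algebra_simps)
      then show ?thesis using rpos by (simp add: mult_le_0_iff)
    qed
    then have "2 * (w i - w j) * b = 0" by (rule quadratic_nonpos_imp_linear_zero)
    moreover have "w i \<noteq> w j" using w ij by (metis injD)
    ultimately have "b = 0" by simp
    then show ?thesis unfolding b_def .
  qed
  define d where "d k = V$k \<bullet> (P *v V$k)" for k
  have "V ** (P ** transpose V) = diagm d"
  proof -
    have "(V ** (P ** transpose V)) $ i $ j = V$i \<bullet> (P *v V$j)" for i j
      by (simp add: matrix_matrix_mult_def matrix_vector_mult_def inner_vec_def)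
    then show ?thesis using off by (simp add: vec_eq_iff diagm_def d_def)
  qed
  then have "transpose V ** diagm d ** V = (transpose V ** V) ** P ** (transpose V ** V)"
    by (metis matrix_mul_assoc)
  moreover have "transpose V ** V = mat 1" using V by (simp add: matrix_left_right_inverse)
  ultimately have "P = transpose V ** diagm d ** V" by simp
  with V that show thesis by blast
qed

text \<open>The rows of \<open>V\<close> are eigenvectors. In this form the signs of the eigenvalues
  can be read off the quadratic form of \<open>P\<close>.\<close>

lemma spectral_eigenvalue:
  fixes V :: "real^'k^'k"
  assumes "V ** transpose V = mat 1" "P = transpose V ** diagm d ** V"
  shows "V$i \<bullet> (P *v V$i) = d i"
proof -
  have "V *v V$i = axis i 1"
    using assms(1)[unfolded orthogonal_rows_iff]
    by (simp add: matrix_vector_mul_component vec_eq_iff axis_def)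
  then have "V$i \<bullet> (P *v V$i) = axis i 1 \<bullet> (diagm d *v axis i 1)"
    by (simp add: assms(2) mvec inner_transpose)
  then show ?thesis by (simp add: inner_axis_axis inner_axis' diagm_vector)
qed

text \<open>In an eigenbasis of \<open>H\<close> the trace is a sum of eigenvalues times values of
  the quadratic form of \<open>K\<close>. Symmetry is asked of \<open>H\<close> only, since
  \<open>K\<close> will be the nonsymmetric matrix \<open>M ** matrix_inv (lin M)\<close>.\<close>

lemma trace_mult_nonneg:
  fixes H K :: "real^'k::finite^'k"
  assumes "transpose H = H" "\<And>v. v \<bullet> (H *v v) \<ge> 0" "\<And>v. v \<bullet> (K *v v) \<ge> 0"
  shows "trace (H ** K) \<ge> 0"
proof -
  obtain V :: "real^'k^'k" and d where V: "V ** transpose V = mat 1" and H: "H = transpose V ** diagm d ** V"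
    using spectral_theorem[OF assms(1)] .
  have d: "d i \<ge> 0" for i using spectral_eigenvalue[OF V H, of i] assms(2) by metis
  have "trace (H ** K) = trace (transpose V ** (diagm d ** V ** K))"
    by (simp add: H matrix_mul_assoc)
  also have "\<dots> = trace (diagm d ** (V ** (K ** transpose V)))"
    by (subst trace_mul_sym) (simp add: matrix_mul_assoc)
  also have "\<dots> = (\<Sum>i\<in>UNIV. d i * (V$i \<bullet> (K *v V$i)))"
  proof -
    have 1: "(diagm d ** M) $ i $ i = d i * M $ i $ i" for M i
      using diagm_vector[of d "column i M" i]
      by (simp add: matrix_matrix_mult_def matrix_vector_mult_def column_def)
    have 2: "(V ** (K ** transpose V)) $ i $ i = V$i \<bullet> (K *v V$i)" for i
      by (simp add: matrix_matrix_mult_def matrix_vector_mult_def inner_vec_def)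
    show ?thesis by (simp add: trace_def 1 2)
  qed
  also have "\<dots> \<ge> 0" using d assms(3) by (intro sum_nonneg mult_nonneg_nonneg) auto
  finally show ?thesis .
qed

definition spd :: "real^'k^'k \<Rightarrow> bool" where
  "spd P \<longleftrightarrow> transpose P = P \<and> (\<forall>v. v \<noteq> 0 \<longrightarrow> v \<bullet> (P *v v) > 0)"

lemma spd_mat_1: "spd (mat 1)" by (simp add: spd_def)

lemma spd_invertible: "spd P \<Longrightarrow> invertible P"
  by (rule invertibleI_inj) (metis inner_zero_right less_irrefl spd_def)

lemma spd_sqrt:
  fixes P :: "real^'k^'k"
  assumes "spd P"
  obtains Q where "spd Q" "Q ** Q = P"
proof -
  obtain V :: "real^'k^'k" and d where V: "V ** transpose V = mat 1" and P: "P = transpose V ** diagm d ** V"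
    using spectral_theorem assms unfolding spd_def by metis
  have "V$i \<noteq> 0" for i using V[unfolded orthogonal_rows_iff, rule_format, of i i] by auto
  then have d: "d i > 0" for i using spectral_eigenvalue[OF V P, of i] assms by (metis spd_def)
  define Q where "Q = transpose V ** diagm (\<lambda>i. sqrt (d i)) ** V"
  have "Q ** Q = transpose V ** diagm (\<lambda>i. sqrt (d i)) ** (V ** transpose V) ** diagm (\<lambda>i. sqrt (d i)) ** V"
    by (simp add: Q_def matrix_mul_assoc)
  also have "\<dots> = transpose V ** (diagm (\<lambda>i. sqrt (d i)) ** diagm (\<lambda>i. sqrt (d i))) ** V"
    by (simp add: V matrix_mul_assoc)
  also have "\<dots> = P" using d by (simp add: diagm_mult P less_imp_le)
  finally have "Q ** Q = P" .
  moreover have "spd Q"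
    unfolding spd_def
  proof (intro conjI allI impI)
    show "transpose Q = Q" by (simp add: Q_def transpose_simps matrix_mul_assoc)
    fix v :: "real^'k" assume v: "v \<noteq> 0"
    have VV: "transpose V ** V = mat 1" using V by (simp add: matrix_left_right_inverse)
    define x where "x = V *v v"
    have "x \<noteq> 0" using v VV unfolding x_def
      by (metis matrix_vector_mul_assoc matrix_vector_mul_lid matrix_vector_mult_0_right)
    then obtain i where i: "x $ i \<noteq> 0" by (auto simp: vec_eq_iff)
    have "v \<bullet> (Q *v v) = (V *v v) \<bullet> (diagm (\<lambda>i. sqrt (d i)) *v (V *v v))"
      by (simp add: Q_def mvec inner_transpose)
    also have "\<dots> = (\<Sum>i\<in>UNIV. sqrt (d i) * (x$i)\<^sup>2)"
      by (simp add: x_def[symmetric] inner_vec_def diagm_vector power2_eq_square algebra_simps)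
    also have "\<dots> > 0"
      using d i by (intro sum_pos2[of _ i]) (auto simp: less_imp_le)
    finally show "v \<bullet> (Q *v v) > 0" .
  qed
  ultimately show thesis using that by blast
qed

text \<open>The difference \<open>D = P - Q\<close> satisfies \<open>P D + D Q = 0\<close>.
  Multiplying by \<open>D\<close> and taking traces gives two nonnegative numbers with sum zero, so
  the trace of \<open>D P D\<close> vanishes, which forces \<open>D = 0\<close> because
  \<open>P\<close> is definite.\<close>

lemma spd_sqrt_unique:
  assumes "spd P" "spd Q" "P ** P = Q ** Q"
  shows "P = Q"
proof -
  define D where "D = P - Q"
  have D: "transpose D = D" using assms by (simp add: D_def transpose_simps spd_def)
  have zero: "P ** D + D ** Q = 0"
    using assms(3) by (simp add: D_def matrix_mult_distribs)
  have tr: "trace (P ** (D ** D)) + trace (Q ** (D ** D)) = 0"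
  proof -
    have "trace (Q ** (D ** D)) = trace ((D ** Q) ** D)"
      by (metis matrix_mul_assoc trace_mul_sym)
    then have "trace (P ** (D ** D)) + trace (Q ** (D ** D)) = trace ((P ** D + D ** Q) ** D)"
      by (simp add: trace_add matrix_mult_distribs matrix_mul_assoc)
    also have "\<dots> = 0" unfolding zero by (simp add: trace_def matrix_matrix_mult_def)
    finally show ?thesis .
  qed
  have nn: "v \<bullet> ((D ** D) *v v) \<ge> 0" for v
    by (simp add: matrix_mult_vector inner_transpose[of v D] D)
  have ge: "trace (R ** (D ** D)) \<ge> 0" if "spd R" for R
    using that nn by (intro trace_mult_nonneg) (auto simp: spd_def, metis inner_zero_left less_eq_real_def)
  have Dv: "D *v v = 0" for v
  proof -
    have "trace (P ** (D ** D)) = 0" using tr ge[OF assms(1)] ge[OF assms(2)] by simp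
    then have "trace (D ** (P ** D)) = 0" by (metis matrix_mul_assoc trace_mul_sym)
    then have s: "(\<Sum>i\<in>UNIV. D$i \<bullet> (P *v D$i)) = 0"
    proof -
      have "(D ** (P ** D)) $ i $ i = D$i \<bullet> (P *v D$i)" for i
      proof -
        have "D $ k $ i = D $ i $ k" for k using D by (metis transpose_nth)
        then show ?thesis by (simp add: matrix_matrix_mult_def matrix_vector_mult_def inner_vec_def)
      qed
      then show ?thesis using \<open>trace (D ** (P ** D)) = 0\<close> by (simp add: trace_def)
    qed
    have "D$i \<bullet> (P *v D$i) \<ge> 0" for i
      using assms(1) unfolding spd_def by (cases "D$i = 0") (auto simp: less_imp_le)
    then have "\<forall>i. D$i \<bullet> (P *v D$i) = 0" using s by (simp add: sum_nonneg_eq_0_iff)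
    then have "D = 0" using assms(1) unfolding spd_def by (metis less_irrefl vec_eq_iff zero_index)
    then show ?thesis by simp
  qed
  then have "D = 0" by (intro matrix_eqI) simp
  then show ?thesis by (simp add: D_def)
qed



subsection \<open>Symplectic matrices and the polar decomposition\<close>

lemma sum_UNIV_Plus: "(\<Sum>k\<in>(UNIV :: ('a::finite + 'b::finite) set). f k) = (\<Sum>a\<in>UNIV. f (Inl a)) + (\<Sum>b\<in>UNIV. f (Inr b))"
  unfolding UNIV_Plus_UNIV[symmetric] by (subst sum.Plus) auto

lemma vec_eq_Plus_iff: "x = y \<longleftrightarrow> (\<forall>a. x $ Inl a = y $ Inl a) \<and> (\<forall>b. x $ Inr b = y $ Inr b)"
  for x y :: "'c^('a::finite + 'b::finite)"
  by (auto simp: vec_eq_iff) (metis sum.exhaust)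

lemma Jmat_vector [simp]:
  fixes v :: "real^('n::finite + 'n)"
  shows "(Jmat *v v) $ Inl a = - v $ Inr a" "(Jmat *v v) $ Inr a = v $ Inl a"
proof -
  have *: "(\<Sum>b\<in>UNIV. (if a = b then c else 0) * g b) = c * g a" for c :: real and g :: "'n \<Rightarrow> real" and a
    by (subst sum.cong[OF refl, of _ _ "\<lambda>b. if b = a then c * g a else 0"]) auto
  show "(Jmat *v v) $ Inl a = - v $ Inr a" "(Jmat *v v) $ Inr a = v $ Inl a"
    by (simp_all add: Jmat_def matrix_vector_mult_def sum_UNIV_Plus *)
qed

lemma Jmat_Jmat_vector [simp]: "Jmat *v (Jmat *v x) = - x"
  by (simp add: vec_eq_Plus_iff)

lemma transpose_Jmat [simp]: "transpose Jmat = - Jmat"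
  by (auto simp: vec_eq_Plus_iff Jmat_def)

lemma Jmat_Jmat [simp]: "Jmat ** Jmat = - mat 1"
  by (rule matrix_eqI) (simp add: mvec)

lemma Jmat_Jmat_mult [simp]: "Jmat ** (Jmat ** A) = - A"
  by (rule matrix_eqI) (simp add: mvec)

lemma inner_Jmat: "x \<bullet> (Jmat *v y) = - ((Jmat *v x) \<bullet> y)"
  by (simp add: inner_transpose matrix_uminus_vector)

lemma inner_Jmat_self [simp]: "x \<bullet> (Jmat *v x) = 0"
  using inner_Jmat[of x x] by (simp add: inner_commute)

lemma inner_Jmat_Jmat [simp]: "(Jmat *v x) \<bullet> (Jmat *v y) = x \<bullet> y"
  by (simp add: inner_Jmat inner_minus_left)

lemma norm_Jmat [simp]: "norm (Jmat *v x) = norm x"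
  by (simp add: norm_eq_sqrt_inner)

lemma Jmat_vector_eq_0_iff [simp]: "Jmat *v x = 0 \<longleftrightarrow> x = 0"
  by (metis norm_Jmat norm_eq_zero)

section \<open>Complex linear, symplectic and unitary matrices\<close>

definition Jcomm :: "'n::finite smat \<Rightarrow> bool" where
  "Jcomm Y \<longleftrightarrow> Y ** Jmat = Jmat ** Y"

lemma Jcomm_vector: "Jcomm Y \<longleftrightarrow> (\<forall>x. Y *v (Jmat *v x) = Jmat *v (Y *v x))"
  by (simp add: Jcomm_def matrix_eq matrix_mult_vector)

lemma Jcomm_mat_1 [simp]: "Jcomm (mat 1)" and Jcomm_Jmat [simp]: "Jcomm Jmat"
  by (simp_all add: Jcomm_vector)

lemma Jcomm_mult: "Jcomm Y \<Longrightarrow> Jcomm Z \<Longrightarrow> Jcomm (Y ** Z)"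
  and Jcomm_add: "Jcomm Y \<Longrightarrow> Jcomm Z \<Longrightarrow> Jcomm (Y + Z)"
  and Jcomm_scaleR: "Jcomm Y \<Longrightarrow> Jcomm (c *\<^sub>R Y)"
  by (auto simp: Jcomm_vector mvec)

lemma Jcomm_transpose:
  assumes "Jcomm Y" shows "Jcomm (transpose Y)"
proof -
  have "transpose (Y ** Jmat) = transpose (Jmat ** Y)" using assms by (simp add: Jcomm_def)
  then show ?thesis by (simp add: Jcomm_def transpose_simps matrix_mult_distribs)
qed

lemma Jcomm_matrix_inv:
  assumes "Jcomm Y" "invertible Y" shows "Jcomm (matrix_inv Y)"
proof -
  have "matrix_inv Y ** (Y ** Jmat) ** matrix_inv Y = matrix_inv Y ** (Jmat ** Y) ** matrix_inv Y"
    using assms by (simp add: Jcomm_def)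
  moreover have "matrix_inv Y ** (Y ** Jmat) ** matrix_inv Y = Jmat ** matrix_inv Y"
    by (simp add: matrix_mul_assoc matrix_inv_left assms)
  moreover have "matrix_inv Y ** (Jmat ** Y) ** matrix_inv Y = matrix_inv Y ** Jmat"
    by (simp add: matrix_mul_assoc[symmetric] matrix_inv_right assms)
  ultimately show ?thesis by (simp add: Jcomm_def)
qed

lemma Sp_iff: "M \<in> Sp \<longleftrightarrow> transpose M ** (Jmat ** M) = Jmat"
  by (simp add: Sp_def matrix_mul_assoc)

lemma Sp_left_inverse: "M \<in> Sp \<Longrightarrow> (- (Jmat ** transpose M ** Jmat)) ** M = mat 1"
  by (simp add: Sp_iff matrix_mult_distribs matrix_mul_assoc[symmetric])

lemma Sp_invertible: "M \<in> Sp \<Longrightarrow> invertible M"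
  using Sp_left_inverse invertible_left_inverse by blast

lemma matrix_inv_Sp: "M \<in> Sp \<Longrightarrow> matrix_inv M = - (Jmat ** transpose M ** Jmat)"
  using Sp_left_inverse matrix_inv_unique matrix_left_right_inverse by blast

lemma Sp_mat_1 [simp]: "mat 1 \<in> Sp" by (simp add: Sp_def)

lemma Sp_mult: "M \<in> Sp \<Longrightarrow> N \<in> Sp \<Longrightarrow> M ** N \<in> Sp"
  by (simp add: Sp_iff transpose_simps matrix_mul_assoc) (metis matrix_mul_assoc)

lemma Sp_transpose: assumes "M \<in> Sp" shows "transpose M \<in> Sp"
proof -
  have "M ** (- (Jmat ** transpose M ** Jmat)) = mat 1"
    using Sp_left_inverse[OF assms] by (simp add: matrix_left_right_inverse)
  then have "M ** (- (Jmat ** transpose M ** Jmat)) ** Jmat = Jmat" by simp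
  then show ?thesis by (simp add: Sp_iff matrix_mult_distribs matrix_mul_assoc[symmetric])
qed

lemma Sp_matrix_inv: assumes "M \<in> Sp" shows "matrix_inv M \<in> Sp"
proof -
  have M: "transpose M ** (Jmat ** M) = Jmat" using assms by (simp add: Sp_iff)
  have "transpose (matrix_inv M) ** transpose M = mat 1" "M ** matrix_inv M = mat 1"
    using Sp_invertible[OF assms] by (metis matrix_inv_right matrix_transpose_mul transpose_mat) (simp add: Sp_invertible assms matrix_inv_right)
  then have "transpose (matrix_inv M) ** (transpose M ** (Jmat ** M)) ** matrix_inv M = Jmat"
    by (metis matrix_mul_assoc matrix_mul_lid matrix_mul_rid)
  then show ?thesis unfolding M by (simp add: Sp_iff matrix_mul_assoc)
qed

text \<open>The unitary group \<open>U(n)\<close>, written as the orthogonal matrices that are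
  complex linear.\<close>

definition Usp :: "'n::finite smat set" where
  "Usp = {U. transpose U ** U = mat 1 \<and> Jcomm U}"

lemma Usp_subset_Sp: "Usp \<subseteq> Sp"
  by (auto simp: Usp_def Sp_iff Jcomm_def) (metis matrix_mul_assoc matrix_mul_lid)

lemma Usp_inverse: "U \<in> Usp \<Longrightarrow> transpose U ** U = mat 1" "U \<in> Usp \<Longrightarrow> U ** transpose U = mat 1"
  by (simp_all add: Usp_def matrix_left_right_inverse)

lemma Usp_mult: "U \<in> Usp \<Longrightarrow> V \<in> Usp \<Longrightarrow> U ** V \<in> Usp"
  by (auto simp: Usp_def Jcomm_mult transpose_simps) (metis matrix_mul_assoc matrix_mul_lid)

lemma Usp_transpose: "U \<in> Usp \<Longrightarrow> transpose U \<in> Usp"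
  by (auto simp: Usp_def Jcomm_transpose matrix_left_right_inverse)

lemma Usp_mat_1 [simp]: "mat 1 \<in> Usp" and Usp_Jmat [simp]: "Jmat \<in> Usp"
  by (simp_all add: Usp_def matrix_mult_distribs)

lemma matrix_inv_Usp: "U \<in> Usp \<Longrightarrow> matrix_inv U = transpose U"
  by (rule matrix_inv_unique) (rule Usp_inverse)

lemma Usp_inner: "U \<in> Usp \<Longrightarrow> (U *v x) \<bullet> (U *v y) = x \<bullet> y"
  by (simp add: inner_transpose2 matrix_vector_mul_assoc Usp_inverse)

lemma Usp_norm: "U \<in> Usp \<Longrightarrow> norm (U *v x) = norm x"
  by (simp add: norm_eq_sqrt_inner Usp_inner)

text \<open>The complex linear part \<open>lin M\<close> and the complex antilinear part \<open>ant M\<close> of \<open>M\<close>, where \<open>Jmat\<close> is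
  multiplication by \<open>i\<close>. For symplectic \<open>M\<close> the complex determinant of \<open>lin M\<close> has the same argument as
  that of the unitary polar factor, and unlike the latter it is a polynomial in the entries of \<open>M\<close>.\<close>

definition lin :: "'n::finite smat \<Rightarrow> 'n smat" where
  "lin M = (1/2) *\<^sub>R (M - Jmat ** M ** Jmat)"

definition ant :: "'n::finite smat \<Rightarrow> 'n smat" where
  "ant M = (1/2) *\<^sub>R (M + Jmat ** M ** Jmat)"

lemma lin_plus_ant: "lin M + ant M = M"
  by (simp add: lin_def ant_def scaleR_right_diff_distrib scaleR_right_distrib flip: scaleR_add_left)

lemma lin_vector: "lin M *v x = (1/2) *\<^sub>R (M *v x - Jmat *v (M *v (Jmat *v x)))"
  and ant_vector: "ant M *v x = (1/2) *\<^sub>R (M *v x + Jmat *v (M *v (Jmat *v x)))"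
  by (simp_all add: lin_def ant_def mvec)

lemma lin_J: "lin M *v (Jmat *v x) = Jmat *v (lin M *v x)"
  and ant_J: "ant M *v (Jmat *v x) = - (Jmat *v (ant M *v x))"
  by (simp_all add: lin_vector ant_vector mvec scaleR_right_diff_distrib scaleR_right_distrib)

lemma Jcomm_lin: "Jcomm (lin M)"
  by (simp add: Jcomm_vector lin_J)

lemma lin_of_Jcomm: "Jcomm Y \<Longrightarrow> lin Y = Y"
  by (rule matrix_eqI) (simp add: lin_vector Jcomm_vector flip: scaleR_add_left scaleR_2)

lemma ant_of_Jcomm: "Jcomm Y \<Longrightarrow> ant Y = 0"
  by (rule matrix_eqI) (simp add: ant_vector Jcomm_vector)

text \<open>Two antilinear maps compose to a linear one, and the mixed products are
  antilinear.\<close>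

lemma lin_mult: "lin (M ** N) = lin M ** lin N + ant M ** ant N"
proof (rule matrix_eqI)
  fix x
  have *: "M *v y = lin M *v y + ant M *v y" for M :: "'a smat" and y
    by (metis lin_plus_ant matrix_mult_sum_vector)
  define y where "y = lin M *v (lin N *v x) + ant M *v (ant N *v x)"
  have "lin (M ** N) *v x = (1/2) *\<^sub>R (y + y)"
    unfolding lin_vector[of "M ** N"] matrix_mult_vector *[of M] *[of N] y_def
    by (simp add: mvec lin_J ant_J)
  then show "lin (M ** N) *v x = (lin M ** lin N + ant M ** ant N) *v x"
    unfolding scaleR_half_double by (simp add: y_def mvec)
qed

lemma lin_Jcomm_mult: "Jcomm Y \<Longrightarrow> lin (Y ** M) = Y ** lin M"
  and lin_mult_Jcomm: "Jcomm Y \<Longrightarrow> lin (M ** Y) = lin M ** Y"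
  by (simp_all add: lin_mult lin_of_Jcomm ant_of_Jcomm)

lemma lin_transpose: "lin (transpose M) = transpose (lin M)"
  and ant_transpose: "ant (transpose M) = transpose (ant M)"
  by (simp_all add: lin_def ant_def transpose_simps matrix_mult_distribs matrix_mul_assoc)

lemma lin_add: "lin (M + N) = lin M + lin N"
  and lin_scaleR: "lin (c *\<^sub>R M) = c *\<^sub>R lin M"
  by (rule matrix_eqI, simp add: lin_vector mvec algebra_simps)+

lemma continuous_on_lin [continuous_intros]: "continuous_on S f \<Longrightarrow> continuous_on S (\<lambda>x. lin (f x))"
  unfolding lin_def by (intro continuous_intros)

lemma continuous_on_ant [continuous_intros]: "continuous_on S f \<Longrightarrow> continuous_on S (\<lambda>x. ant (f x))"
  unfolding ant_def by (intro continuous_intros)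

text \<open>The symplectic identity evaluated on the pair \<open>x\<close>,
  \<open>Jmat *v x\<close>. It says that the linear part strictly dominates the antilinear part,
  which is the source of all later nonvanishing statements.\<close>

lemma Sp_lin_ant_norm:
  assumes "M \<in> Sp"
  shows "(norm (lin M *v x))\<^sup>2 = (norm (ant M *v x))\<^sup>2 + (norm x)\<^sup>2"
proof -
  have *: "M *v y = lin M *v y + ant M *v y" for y
    by (metis lin_plus_ant matrix_mult_sum_vector)
  have "(M *v x) \<bullet> (Jmat *v (M *v (Jmat *v x))) = x \<bullet> (Jmat *v (Jmat *v x))"
    using assms unfolding Sp_iff by (metis inner_transpose2 matrix_vector_mul_assoc)
  then have "(lin M *v x + ant M *v x) \<bullet> (- (lin M *v x) + ant M *v x) = - (x \<bullet> x)"
    unfolding *[of x] *[of "Jmat *v x"] by (simp add: lin_J ant_J mvec)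
  then show ?thesis
    unfolding power2_norm_eq_inner inner_add_left inner_add_right inner_minus_right
    by (simp add: inner_commute[of "ant M *v x" "lin M *v x"])
qed

lemma Sp_lin_invertible:
  assumes "M \<in> Sp" shows "invertible (lin M)"
proof (rule invertibleI_inj)
  fix x assume 0: "lin M *v x = 0"
  have "(norm x)\<^sup>2 \<le> (norm (lin M *v x))\<^sup>2"
    unfolding Sp_lin_ant_norm[OF assms] by simp
  then show "x = 0" by (simp add: 0)
qed

section \<open>The complex determinant\<close>

definition cmat :: "'n::finite smat \<Rightarrow> complex^'n^'n" where
  "cmat U = (\<chi> i j. complex_of_real (U $ Inl i $ Inl j) + \<i> * complex_of_real (U $ Inr i $ Inl j))"

lemma cdet_cmat: "cdet U = det (cmat U)"
  by (simp add: cdet_def cmat_def)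

lemma Jcomm_entries:
  assumes "Jcomm Y"
  shows "Y $ Inr i $ Inr j = Y $ Inl i $ Inl j" "Y $ Inl i $ Inr j = - Y $ Inr i $ Inl j"
proof -
  have J: "Jmat *v axis (Inl j) 1 = (axis (Inr j) 1 :: real^('a+'a))"
    by (simp add: vec_eq_Plus_iff axis_def)
  have col: "(Y *v axis k 1) $ l = Y $ l $ k" for k l
    by (simp add: matrix_vector_mult_basis column_def)
  have "Y *v axis (Inr j) 1 = Jmat *v (Y *v axis (Inl j) 1)"
    using assms by (metis J Jcomm_vector)
  from arg_cong[OF this, of "\<lambda>v. v $ Inr i"] arg_cong[OF this, of "\<lambda>v. v $ Inl i"]
  show "Y $ Inr i $ Inr j = Y $ Inl i $ Inl j" "Y $ Inl i $ Inr j = - Y $ Inr i $ Inl j"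
    by (simp_all add: col)
qed

lemma cmat_mult: assumes "Jcomm Y" shows "cmat (Y ** Z) = cmat Y ** cmat Z"
proof -
  have "cmat (Y ** Z) $ i $ j = (cmat Y ** cmat Z) $ i $ j" for i j
  proof (rule complex_eqI)
    have c: "(cmat Y ** cmat Z) $ i $ j = (\<Sum>k\<in>UNIV. cmat Y $ i $ k * cmat Z $ k $ j)"
      by (simp add: matrix_matrix_mult_def)
    have r: "(Y ** Z) $ p $ q = (\<Sum>k\<in>UNIV. Y $ p $ Inl k * Z $ Inl k $ q) + (\<Sum>k\<in>UNIV. Y $ p $ Inr k * Z $ Inr k $ q)" for p q
      by (simp add: matrix_matrix_mult_def sum_UNIV_Plus)
    show "Re (cmat (Y ** Z) $ i $ j) = Re ((cmat Y ** cmat Z) $ i $ j)"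
      unfolding c by (simp add: cmat_def r Jcomm_entries[OF assms] sum_subtractf sum_negf)
    show "Im (cmat (Y ** Z) $ i $ j) = Im ((cmat Y ** cmat Z) $ i $ j)"
      unfolding c by (simp add: cmat_def r Jcomm_entries[OF assms] sum.distrib)
  qed
  then show ?thesis by (simp add: vec_eq_iff)
qed

lemma cmat_mat_1: "cmat (mat 1) = mat 1"
  by (simp add: cmat_def mat_def vec_eq_iff)

lemma cdet_mult: "Jcomm Y \<Longrightarrow> cdet (Y ** Z) = cdet Y * cdet Z"
  by (simp add: cdet_cmat cmat_mult det_mul)

lemma cdet_mat_1 [simp]: "cdet (mat 1) = 1"
  by (simp add: cdet_cmat cmat_mat_1)

lemma cdet_nonzero:
  assumes "Jcomm Y" "invertible Y" shows "cdet Y \<noteq> 0"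
  using cdet_mult[OF assms(1), of "matrix_inv Y"] matrix_inv_right[OF assms(2)] by auto

lemma continuous_on_cdet [continuous_intros]:
  "continuous_on S f \<Longrightarrow> continuous_on S (\<lambda>x. cdet (f x))"
  unfolding cdet_def by (intro continuous_intros)

lemma cdet_transpose: assumes "Jcomm Y" shows "cdet (transpose Y) = cnj (cdet Y)"
proof -
  have "cmat (transpose Y) = transpose (\<chi> i j. cnj (cmat Y $ i $ j))"
    using assms by (simp add: cmat_def vec_eq_iff complex_eq_iff Jcomm_entries)
  then have "cdet (transpose Y) = det (\<chi> i j. cnj (cmat Y $ i $ j))" by (simp add: cdet_cmat det_transpose)
  also have "\<dots> = cnj (det (cmat Y))" by (simp add: det_def)
  finally show ?thesis by (simp add: cdet_cmat)
qed

lemma norm_cdet_Usp: assumes "U \<in> Usp" shows "norm (cdet U) = 1"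
proof -
  have J: "Jcomm U" using assms by (simp add: Usp_def)
  have "cdet U * cnj (cdet U) = 1"
    using cdet_mult[OF J, of "transpose U"] Usp_inverse[OF assms] by (simp add: cdet_transpose J)
  then have "(norm (cdet U))\<^sup>2 = 1" by (metis complex_norm_square of_real_1 of_real_eq_iff)
  then show ?thesis by (simp add: power2_eq_1_iff) (metis norm_ge_zero not_one_le_zero neg_0_le_iff_le)
qed

text \<open>Along the segment from the identity to \<open>P\<close> all matrices are positive
  definite and complex linear, so their complex determinants are real and nonzero. Starting from 1
  they cannot become negative.\<close>

lemma cdet_spd_pos:
  assumes "spd P" "Jcomm P"
  obtains r where "r > 0" "cdet P = complex_of_real r"
proof -
  define Q where "Q s = (1 - s) *\<^sub>R mat 1 + s *\<^sub>R P" for s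
  have "spd (Q s)" if "s \<in> {0..1}" for s
    unfolding spd_def
  proof (intro conjI allI impI)
    show "transpose (Q s) = Q s" using assms(1) by (simp add: Q_def transpose_simps spd_def)
    fix v :: "real^('a+'a)" assume v: "v \<noteq> 0"
    have "v \<bullet> (Q s *v v) = (1 - s) * (v \<bullet> v) + s * (v \<bullet> (P *v v))"
      by (simp add: Q_def mvec inner_add_right)
    moreover have "v \<bullet> v > 0" "v \<bullet> (P *v v) > 0" using v assms(1) by (auto simp: spd_def)
    ultimately show "v \<bullet> (Q s *v v) > 0" using that
      by (cases "s = 0") (auto intro!: add_nonneg_pos)
  qed
  moreover have J: "Jcomm (Q s)" for s
    unfolding Q_def by (intro Jcomm_add Jcomm_scaleR assms Jcomm_mat_1)
  ultimately have nz: "cdet (Q s) \<noteq> 0" and T: "transpose (Q s) = Q s" if "s \<in> {0..1}" for s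
    using that cdet_nonzero spd_invertible unfolding spd_def by blast+
  have im: "Im (cdet (Q s)) = 0" if "s \<in> {0..1}" for s
    using cdet_transpose[OF J[of s]] T[OF that] by (metis complex_cnj_cancel_iff Reals_cnj_iff complex_is_Real_iff)
  have "Re (cdet (Q 1)) > 0"
  proof (rule ccontr)
    assume "\<not> ?thesis"
    moreover have "continuous_on {0..1} (\<lambda>s. Re (cdet (Q s)))" unfolding Q_def by (intro continuous_intros)
    ultimately obtain s where "s \<in> {0..1}" "Re (cdet (Q s)) = 0"
      using IVT2'[of "\<lambda>s. Re (cdet (Q s))" 1 0 0] by (auto simp: Q_def)
    then show False using nz im by (simp add: complex_eq_iff)
  qed
  moreover have "cdet P = complex_of_real (Re (cdet (Q 1)))"
    using im[of 1] by (simp add: complex_eq_iff Q_def)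
  ultimately show thesis using that by blast
qed

section \<open>The polar decomposition and its continuity\<close>

lemma pd_eq_spd: "spd P \<longleftrightarrow> transpose P = P \<and> pd P"
  by (simp add: spd_def pd_def)

text \<open>Each positive factor squares to \<open>transpose M ** M\<close>, so uniqueness of the
  positive square root identifies them.\<close>

lemma polar_unique:
  assumes "transpose U ** U = mat 1" "spd (transpose U ** M)"
    and "transpose V ** V = mat 1" "spd (transpose V ** M)" and "invertible M"
  shows "U = (V :: 'n::finite smat)"
proof -
  have *: "(transpose U ** M) ** (transpose U ** M) = transpose M ** M"
    if "transpose U ** U = mat 1" "spd (transpose U ** M)" for U
  proof -
    have "(transpose U ** M) ** (transpose U ** M) = transpose (transpose U ** M) ** (transpose U ** M)"
      using that by (simp add: spd_def)
    also have "\<dots> = transpose M ** (U ** transpose U) ** M" by (simp add: transpose_simps matrix_mul_assoc)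
    also have "U ** transpose U = mat 1" using that by (simp add: matrix_left_right_inverse)
    finally show ?thesis by simp
  qed
  have "transpose U ** M = transpose V ** M"
    by (rule spd_sqrt_unique) (use assms * in auto)
  then have "transpose U ** M ** matrix_inv M = transpose V ** M ** matrix_inv M" by simp
  then have "transpose U = transpose V"
    by (metis assms(5) matrix_inv_right matrix_mul_assoc matrix_mul_rid)
  then show ?thesis by simp
qed

lemma spd_matrix_inv:
  fixes P :: "real^'k^'k"
  assumes "spd P" shows "spd (matrix_inv P)"
  unfolding spd_def
proof (intro conjI allI impI)
  let ?R = "matrix_inv P"
  have inv: "P ** ?R = mat 1" "?R ** P = mat 1" using assms spd_invertible matrix_inv_left matrix_inv_right by blast+
  have T: "transpose P = P" using assms by (simp add: spd_def)
  have "P ** transpose ?R = mat 1" using inv T by (metis matrix_transpose_mul transpose_mat)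
  then show "transpose ?R = ?R" using matrix_inv_unique by metis
  fix v :: "real^'k" assume "v \<noteq> 0"
  define w where "w = ?R *v v"
  have v: "v = P *v w" using inv by (simp add: w_def matrix_vector_mul_assoc)
  then have "w \<noteq> 0" using \<open>v \<noteq> 0\<close> by auto
  then have "w \<bullet> (P *v w) > 0" using assms by (simp add: spd_def)
  then show "v \<bullet> (?R *v v) > 0" by (metis inner_commute v w_def)
qed

lemma spd_congruence:
  fixes P A :: "real^'k^'k"
  assumes "spd P" "invertible A" shows "spd (transpose A ** P ** A)"
  unfolding spd_def
proof (intro conjI allI impI)
  show "transpose (transpose A ** P ** A) = transpose A ** P ** A"
    using assms by (simp add: transpose_simps spd_def matrix_mul_assoc)
  fix v :: "real^'k" assume "v \<noteq> 0"
  then have "A *v v \<noteq> 0"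
    by (metis assms(2) matrix_inv_left matrix_vector_mul_assoc matrix_vector_mul_lid matrix_vector_mult_0_right)
  then have "(A *v v) \<bullet> (P *v (A *v v)) > 0" using assms by (simp add: spd_def)
  then show "v \<bullet> ((transpose A ** P ** A) *v v) > 0" by (simp add: mvec inner_transpose)
qed

lemma polar_exists:
  fixes M :: "'n::finite smat"
  assumes "M \<in> Sp"
  shows "\<exists>U. U \<in> Usp \<and> spd (transpose U ** M)"
proof -
  have inv: "invertible M" using assms by (rule Sp_invertible)
  have "spd (transpose M ** M)"
    using spd_congruence[OF spd_mat_1 inv] by simp
  then obtain P where P: "spd P" "P ** P = transpose M ** M" using spd_sqrt by blast
  have PT: "transpose P = P" using P by (simp add: spd_def)
  define R where "R = matrix_inv P"
  have R: "R ** P = mat 1" "P ** R = mat 1" "spd R"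
    using P by (simp_all add: R_def spd_invertible matrix_inv_left matrix_inv_right spd_matrix_inv)
  define U where "U = M ** R"
  have RT: "transpose R = R" using R by (simp add: spd_def)
  have U1: "transpose U ** U = mat 1"
  proof -
    have "transpose U ** U = R ** (P ** P) ** R"
      by (simp add: U_def transpose_simps RT P(2) matrix_mul_assoc)
    then show ?thesis using R by (metis matrix_mul_assoc matrix_mul_rid)
  qed
  have UM: "transpose U ** M = P"
  proof -
    have "transpose U ** M = R ** (P ** P)" by (simp add: U_def transpose_simps RT P(2) matrix_mul_assoc)
    then show ?thesis using R by (metis matrix_mul_assoc matrix_mul_lid)
  qed
  txt \<open>The inverse transpose of a symplectic matrix is its conjugate by \<open>J\<close>, so conjugating the
    polar decomposition by \<open>J\<close> gives another one of the same matrix.\<close>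
  define V where "V = - (Jmat ** U ** Jmat)"
  define N where "N = - (Jmat ** M ** Jmat)"
  have MU: "M = U ** P" by (metis U1 UM matrix_left_right_inverse matrix_mul_assoc matrix_mul_lid)
  have NM: "transpose M ** N = mat 1"
    using assms Sp_left_inverse[OF Sp_transpose[OF assms]] by (simp add: N_def matrix_left_right_inverse)
  have NU: "N = U ** R"
  proof -
    have "transpose M ** (U ** R) = P ** (transpose U ** U) ** R"
      by (simp add: MU transpose_simps PT matrix_mul_assoc)
    then have 1: "transpose M ** (U ** R) = mat 1" using R U1 by simp
    have "matrix_inv (transpose M) = N" "matrix_inv (transpose M) = U ** R"
      using NM 1 matrix_inv_unique by blast+
    then show ?thesis by simp
  qed
  have V1: "transpose V ** V = mat 1"
  proof -
    have "transpose V ** V = - (Jmat ** (transpose U ** U) ** Jmat)"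
      by (simp add: V_def transpose_simps matrix_mult_distribs matrix_mul_assoc[symmetric])
    then show ?thesis by (simp add: U1)
  qed
  have VN: "transpose V ** N = transpose Jmat ** P ** Jmat"
    by (simp add: V_def N_def UM[symmetric] transpose_simps matrix_mult_distribs matrix_mul_assoc[symmetric])
  have "U = V"
  proof (rule polar_unique[where M = N])
    show "spd (transpose U ** N)" using NU U1 R by (simp add: matrix_mul_assoc)
    show "spd (transpose V ** N)" unfolding VN
      by (intro spd_congruence P Sp_invertible subsetD[OF Usp_subset_Sp] Usp_Jmat)
    show "invertible N" using NM invertible_right_inverse invertible_left_inverse matrix_left_right_inverse by metis
  qed (use U1 V1 in auto)
  then have "U ** Jmat = Jmat ** U"
    by (metis (no_types, lifting) V_def Jmat_Jmat matrix_mul_assoc matrix_mult_distribs(6) matrix_mult_distribs(5) matrix_mul_rid minus_minus)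
  then have "U \<in> Usp" using U1 by (simp add: Usp_def Jcomm_def)
  then show ?thesis using UM P(1) by auto
qed

lemma polar_U_eqI:
  assumes "M \<in> Sp" "transpose U ** U = mat 1" "spd (transpose U ** M)"
  shows "polar_U M = U"
  unfolding polar_U_def orthogonal_smat_def
proof (rule the_equality)
  show "transpose U ** U = mat 1 \<and> transpose (transpose U ** M) = transpose U ** M \<and> pd (transpose U ** M)"
    using assms by (simp add: pd_eq_spd)
  fix V
  assume "transpose V ** V = mat 1 \<and> transpose (transpose V ** M) = transpose V ** M \<and> pd (transpose V ** M)"
  then have "transpose V ** V = mat 1" "spd (transpose V ** M)" by (simp_all add: pd_eq_spd)
  then show "V = U" using assms Sp_invertible polar_unique by metis
qed

lemma
  assumes "M \<in> Sp"
  shows polar_U_Usp: "polar_U M \<in> Usp" and polar_U_spd: "spd (transpose (polar_U M) ** M)"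
proof -
  obtain U where U: "U \<in> Usp" "spd (transpose U ** M)" using polar_exists[OF assms] by blast
  then have "polar_U M = U" using polar_U_eqI[OF assms] by (simp add: Usp_inverse)
  with U show "polar_U M \<in> Usp" "spd (transpose (polar_U M) ** M)" by simp_all
qed

lemma polar_U_of_Usp: "U \<in> Usp \<Longrightarrow> polar_U U = U"
  by (rule polar_U_eqI) (simp_all add: Usp_inverse spd_mat_1 subsetD[OF Usp_subset_Sp])

text \<open>For any \<open>P\<close>, \<open>lin P\<close> is the average of \<open>P\<close> and
  its congruence \<open>transpose Jmat ** P ** Jmat\<close>, so positivity is inherited.\<close>

lemma spd_lin: assumes "spd P" shows "spd (lin P)"
  unfolding spd_def
proof (intro conjI allI impI)
  show "transpose (lin P) = lin P" using assms by (simp add: lin_transpose[symmetric] spd_def)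
  fix v :: "real^('a+'a)" assume "v \<noteq> 0"
  then have "v \<bullet> (P *v v) > 0" "(Jmat *v v) \<bullet> (P *v (Jmat *v v)) > 0" using assms by (simp_all add: spd_def)
  then show "v \<bullet> (lin P *v v) > 0" by (simp add: lin_vector inner_diff_right inner_Jmat)
qed

definition clin :: "'n::finite smat \<Rightarrow> complex" where
  "clin M = cdet (lin M)"

lemma clin_nonzero: "M \<in> Sp \<Longrightarrow> clin M \<noteq> 0"
  by (simp add: clin_def cdet_nonzero Jcomm_lin Sp_lin_invertible)

text \<open>With \<open>M = U P\<close> the unitary \<open>U\<close> factors out of
  \<open>lin M\<close>, leaving the positive number \<open>cdet (lin P)\<close>. From here on
  arguments are computed from \<open>clin\<close> and the polar factor can be ignored.\<close>

lemma cdet_polar_U: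
  assumes "M \<in> Sp"
  shows "cdet (polar_U M) = clin M / of_real (norm (clin M))"
proof -
  define U where "U = polar_U M"
  define P where "P = transpose U ** M"
  have U: "U \<in> Usp" and P: "spd P" using polar_U_Usp polar_U_spd assms by (auto simp: U_def P_def)
  have M: "M = U ** P" using Usp_inverse[OF U] by (simp add: P_def matrix_mul_assoc)
  obtain r where r: "r > 0" "cdet (lin P) = complex_of_real r"
    using cdet_spd_pos[OF spd_lin[OF P] Jcomm_lin] .
  have JU: "Jcomm U" using U by (simp add: Usp_def)
  have "clin M = cdet U * of_real r"
    by (simp add: clin_def M lin_Jcomm_mult JU cdet_mult r)
  then show ?thesis using r norm_cdet_Usp[OF U] by (simp add: U_def[symmetric] norm_mult)
qed

text \<open>The form attains its minimum 0 at \<open>v\<close>; varying \<open>v\<close> in the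
  direction \<open>N *v v\<close> has first-order term \<open>2 |N v|^2\<close>, which must
  vanish.\<close>

lemma sym_psd_kernel:
  fixes N :: "real^'k^'k"
  assumes sym: "transpose N = N" and psd: "\<And>v. v \<bullet> (N *v v) \<ge> 0" and z: "v \<bullet> (N *v v) = 0"
  shows "N *v v = 0"
proof -
  define w where "w = N *v v"
  have vw: "v \<bullet> (N *v w) = w \<bullet> w" by (simp add: w_def inner_transpose[of v] sym)
  have "x\<^sup>2 * (- (w \<bullet> (N *v w))) + x * (- 2 * (w \<bullet> w)) \<le> 0" for x
    using psd[of "v + x *\<^sub>R w"] z vw
    by (simp add: mvec inner_add_left inner_add_right power2_eq_square w_def[symmetric] algebra_simps)
  then have "- 2 * (w \<bullet> w) = 0" by (rule quadratic_nonpos_imp_linear_zero)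
  then show ?thesis by (simp add: w_def)
qed

lemma closed_Sp: "closed Sp"
  unfolding Sp_def by (intro closed_Collect_eq continuous_intros)

text \<open>The values lie in the compact orthogonal group, so a closed graph suffices. Positive
  definiteness is not a closed condition; the graph is described with semidefiniteness instead, and
  invertibility of \<open>M\<close> recovers definiteness.\<close>

lemma continuous_on_polar_U: "continuous_on Sp (polar_U :: 'n::finite smat \<Rightarrow> 'n smat)"
proof (rule continuous_from_closed_graph)
  show "compact {V :: 'n smat. V ** transpose V = mat 1}" by (rule compact_orthogonal)
  show "polar_U \<in> Sp \<rightarrow> {V :: 'n smat. V ** transpose V = mat 1}"
    using polar_U_Usp Usp_inverse by auto
  let ?G = "{x :: 'n smat \<times> 'n smat. fst x \<in> Sp \<and> transpose (snd x) ** snd x = mat 1 \<and>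
      transpose (transpose (snd x) ** fst x) = transpose (snd x) ** fst x \<and>
      (\<forall>v. v \<bullet> ((transpose (snd x) ** fst x) *v v) \<ge> 0)}"
  have "(\<lambda>x. Pair x (polar_U x)) ` Sp = ?G"
  proof (intro equalityI subsetI)
    fix x :: "'n smat \<times> 'n smat" assume "x \<in> (\<lambda>x. Pair x (polar_U x)) ` Sp"
    then obtain M where M: "M \<in> Sp" "x = (M, polar_U M)" by auto
    have "0 \<le> v \<bullet> ((transpose (polar_U M) ** M) *v v)" for v
      using polar_U_spd[OF M(1)] by (cases "v = 0") (auto simp: spd_def less_imp_le)
    then show "x \<in> ?G"
      using M polar_U_spd[OF M(1)] Usp_inverse[OF polar_U_Usp[OF M(1)]] by (simp add: spd_def)
  next
    fix x :: "'n smat \<times> 'n smat" assume x: "x \<in> ?G"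
    obtain M U where xMU: "x = (M, U)" by (cases x)
    define N where "N = transpose U ** M"
    have M: "M \<in> Sp" and U: "transpose U ** U = mat 1" and N: "transpose N = N" "\<And>v. v \<bullet> (N *v v) \<ge> 0"
      using x by (auto simp: xMU N_def)
    have "spd N" unfolding spd_def
    proof (intro conjI allI impI N)
      fix v :: "real^('n+'n)" assume v: "v \<noteq> 0"
      have "v \<bullet> (N *v v) \<noteq> 0"
      proof
        assume "v \<bullet> (N *v v) = 0"
        then have "N *v v = 0" using sym_psd_kernel N by blast
        then have "(U ** N) *v v = 0" by (simp add: mvec)
        moreover have "U ** N = M" using U by (simp add: N_def matrix_mul_assoc matrix_left_right_inverse)
        ultimately have "matrix_inv M *v (M *v v) = 0" by simp
        then show False using v matrix_inv_left[OF Sp_invertible[OF M]] by (simp add: matrix_vector_mul_assoc)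
      qed
      then show "v \<bullet> (N *v v) > 0" using N(2)[of v] by simp
    qed
    then have "polar_U M = U" using M U by (intro polar_U_eqI) (auto simp: N_def)
    then show "x \<in> (\<lambda>x. Pair x (polar_U x)) ` Sp" using M xMU by auto
  qed
  moreover have "closed ?G"
    by (intro closed_Collect_conj closed_Collect_all closed_Collect_eq closed_Collect_le continuous_intros)
      (use closed_vimage_fst[OF closed_Sp] in \<open>simp add: vimage_def\<close>)
  ultimately show "closed ((\<lambda>x. Pair x (polar_U x :: 'n smat)) ` Sp)" by simp
qed



subsection \<open>The Maslov quasimorphism\<close>

text \<open>Distinct logarithms of one number are at least \<open>2 * pi\<close> apart, so a
  continuous choice cannot move.\<close>

lemma exp_constant_imp_eq:
  fixes D :: "real \<Rightarrow> complex"
  assumes "continuous_on {0..1} D" "\<And>t. t \<in> {0..1} \<Longrightarrow> exp (D t) = c"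
  shows "D 1 = D 0"
proof -
  have "D constant_on {0..1}"
  proof (rule continuous_discrete_range_constant)
    show "connected {0..1::real}" by simp
    show "continuous_on {0..1} D" by fact
    fix x :: real assume x: "x \<in> {0..1}"
    show "\<exists>e>0. \<forall>y. y \<in> {0..1} \<and> D y \<noteq> D x \<longrightarrow> e \<le> norm (D y - D x)"
    proof (intro exI[of _ "2 * pi"] conjI allI impI)
      fix y :: real assume y: "y \<in> {0..1} \<and> D y \<noteq> D x"
      then have "exp (D y) = exp (D x)" using assms x by simp
      then obtain k :: int where k: "D y = D x + of_int (2 * k) * pi * \<i>" unfolding exp_eq by blast
      then have "k \<noteq> 0" using y by auto
      then have "1 \<le> \<bar>real_of_int k\<bar>" by linarith
      then have "2 * pi * 1 \<le> 2 * pi * \<bar>real_of_int k\<bar>" by (intro mult_left_mono) auto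
      then show "2 * pi \<le> norm (D y - D x)" by (simp add: k norm_mult)
    qed simp
  qed
  then show ?thesis by (auto simp: constant_on_def)
qed

lemma continuous_log_interval:
  fixes f :: "real \<Rightarrow> complex"
  assumes "continuous_on {0..1} f" "\<And>t. t \<in> {0..1} \<Longrightarrow> f t \<noteq> 0"
  obtains L where "continuous_on {0..1} L" "\<forall>t\<in>{0..1}. exp (L t) = f t"
  using continuous_logarithm_on_contractible[OF assms(1) convex_imp_contractible assms(2)]
  by (metis convex_real_interval(5))

lemma continuous_log_square:
  fixes f :: "real \<times> real \<Rightarrow> complex"
  assumes "continuous_on ({0..1} \<times> {0..1}) f" "\<And>x. x \<in> {0..1} \<times> {0..1} \<Longrightarrow> f x \<noteq> 0"
  obtains L where "continuous_on ({0..1} \<times> {0..1}) L" "\<forall>s\<in>{0..1}. \<forall>t\<in>{0..1}. exp (L (s, t)) = f (s, t)"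
proof -
  have "contractible ({0..1::real} \<times> {0..1::real})"
    by (intro convex_imp_contractible convex_Times) auto
  then obtain L where "continuous_on ({0..1} \<times> {0..1}) L" "\<And>x. x \<in> {0..1} \<times> {0..1} \<Longrightarrow> f x = exp (L x)"
    using continuous_logarithm_on_contractible[OF assms(1) _ assms(2)] by metis
  with that show thesis by (metis SigmaI)
qed

lemma continuous_on_square_row:
  assumes "continuous_on ({0..1} \<times> {0..1}) h" "s \<in> {0..1}"
  shows "continuous_on {0..1} (\<lambda>t. h (s, t))"
  using assms by (intro continuous_on_compose2[OF assms(1)] continuous_intros) auto

lemma continuous_on_square_column:
  assumes "continuous_on ({0..1} \<times> {0..1}) h" "t \<in> {0..1}"
  shows "continuous_on {0..1} (\<lambda>s. h (s, t))"
  using assms by (intro continuous_on_compose2[OF assms(1)] continuous_intros) auto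

lemma log_increment_unique:
  fixes L M :: "real \<Rightarrow> complex"
  assumes "continuous_on {0..1} L" "continuous_on {0..1} M"
    and "\<And>t. t \<in> {0..1} \<Longrightarrow> exp (L t) = c * exp (M t)"
  shows "L 1 - L 0 = M 1 - M 0"
proof -
  have "(\<lambda>t. L t - M t) 1 = (\<lambda>t. L t - M t) 0"
    by (rule exp_constant_imp_eq[where c = c])
      (use assms in \<open>auto intro!: continuous_intros simp: exp_diff\<close>)
  then show ?thesis by (simp add: algebra_simps)
qed

text \<open>Each linear factor \<open>1 - s/r\<close> with \<open>|r| > 1\<close> stays in the right half plane.\<close>

lemma poly_argument_variation:
  fixes p :: "complex poly"
  assumes "\<And>z. norm z \<le> 1 \<Longrightarrow> poly p z \<noteq> 0" "continuous_on {0..1} L"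
    and "\<And>s. s \<in> {0..1} \<Longrightarrow> exp (L s) = poly p (complex_of_real s)"
  shows "\<bar>Im (L 1 - L 0)\<bar> \<le> real (degree p) * pi / 2"
  using assms
proof (induction "degree p" arbitrary: p L)
  case 0
  then obtain c where "p = [:c:]" by (metis degree_eq_zeroE)
  then have "L 1 = L 0" using 0 by (intro exp_constant_imp_eq[where c = c]) auto
  then show ?case by simp
next
  case (Suc n)
  then have "\<not> constant (poly p)" by (simp add: constant_degree)
  then obtain r where r: "poly p r = 0" using fundamental_theorem_of_algebra by blast
  then have nr: "norm r > 1" using Suc.prems(1)[of r] by force
  then have r0: "r \<noteq> 0" by auto
  from r obtain q where q: "p = [:- r, 1:] * q" by (metis dvdE poly_eq_0_iff_dvd)
  \<comment> \<open>Absorbing \<open>- r\<close> into the other factor normalizes the linear one to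
    \<open>1 - z / r\<close>, which equals 1 at 0, so that its principal logarithm starts at
    0.\<close>
  define q' where "q' = smult (- r) q"
  have "q \<noteq> 0" using q Suc.hyps(2) by auto
  then have "degree p = Suc (degree q)" using q degree_mult_eq[of "[:- r, 1:]" q] by auto
  then have deg: "degree q' = n" using Suc.hyps(2) r0 by (simp add: q'_def)
  have pq: "poly p z = poly q' z * (1 - z / r)" for z
    using r0 by (simp add: q q'_def field_simps)
  define M where "M s = L s - Ln (1 - complex_of_real s / r)" for s :: real
  have pos: "Re (1 - complex_of_real s / r) > 0" if "s \<in> {0..1}" for s
  proof -
    have "Re (complex_of_real s / r) \<le> norm (complex_of_real s / r)" by (rule complex_Re_le_cmod)
    also have "\<dots> < 1" using nr r0 that by (simp add: norm_divide divide_less_eq)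
    finally show ?thesis by simp
  qed
  have "\<bar>Im (M 1 - M 0)\<bar> \<le> real (degree q') * pi / 2"
  proof (rule Suc.hyps(1))
    show "n = degree q'" using deg by simp
    show "poly q' z \<noteq> 0" if "norm z \<le> 1" for z using Suc.prems(1)[OF that] pq by auto
    show "continuous_on {0..1} M"
      unfolding M_def using pos r0 Suc.prems(2)
      by (intro continuous_intros) (auto simp: complex_nonpos_Reals_iff not_le)
    show "exp (M s) = poly q' (complex_of_real s)" if s: "s \<in> {0..1}" for s
    proof -
      have "1 - complex_of_real s / r \<noteq> 0" using pos[OF s] by force
      then show ?thesis using Suc.prems(3)[OF s] by (simp add: M_def exp_diff pq)
    qed
  qed
  moreover have "\<bar>Im (Ln (1 - 1 / r))\<bar> < pi / 2"
    using pos[of 1] by (subst Re_Ln_pos_lt) force+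
  moreover have "Im (M 1 - M 0) = Im (L 1 - L 0) - Im (Ln (1 - 1 / r))" by (simp add: M_def)
  ultimately have "\<bar>Im (L 1 - L 0)\<bar> \<le> real n * pi / 2 + pi / 2"
    unfolding deg abs_le_iff abs_less_iff by linarith
  then show ?case using Suc.hyps(2)[symmetric] by (simp add: field_simps)
qed

section \<open>Polynomial pencils built from two symplectic matrices\<close>

lemma det_pencil_poly:
  fixes A B :: "complex^'n^'n"
  obtains p where "degree p \<le> CARD('n)" "\<And>z. poly p z = det (\<chi> i j. A$i$j + z * B$i$j)"
proof -
  define p where "p = det (\<chi> i j. [:A$i$j, B$i$j:])"
  have "poly p z = det (\<chi> i j. A$i$j + z * B$i$j)" for z
    by (simp add: p_def det_def poly_sum poly_prod)
  moreover have "degree p \<le> CARD('n)"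
    unfolding p_def det_def
  proof (intro degree_sum_le)
    fix \<pi> :: "'n \<Rightarrow> 'n"
    have "degree (\<Prod>i\<in>UNIV. [:A$i$\<pi> i, B$i$\<pi> i:]) \<le> (\<Sum>i\<in>UNIV. degree [:A$i$\<pi> i, B$i$\<pi> i:])"
      using degree_prod_sum_le[of UNIV "\<lambda>i. [:A$i$\<pi> i, B$i$\<pi> i:]"] by (simp add: o_def)
    also have "\<dots> \<le> (\<Sum>i\<in>(UNIV::'n set). 1)" by (intro sum_mono) simp
    finally show "degree (of_int (sign \<pi>) * (\<Prod>i\<in>UNIV. (\<chi> i j. [:A$i$j, B$i$j:]) $ i $ \<pi> i)) \<le> CARD('n)"
      by (intro order.trans[OF degree_mult_le]) (simp add: sign_def)
  qed (simp add: finite_permutations)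
  ultimately show thesis using that by blast
qed

lemma cmat_add: "cmat (A + B) = cmat A + cmat B"
  by (simp add: cmat_def vec_eq_iff algebra_simps)

lemma cmat_complex_scalar: "cmat ((a *\<^sub>R mat 1 + b *\<^sub>R Jmat) ** B) = (\<chi> i j. Complex a b * cmat B $ i $ j)"
proof -
  have "Jcomm (a *\<^sub>R mat 1 + b *\<^sub>R Jmat)" by (intro Jcomm_add Jcomm_scaleR) simp_all
  then have "cmat ((a *\<^sub>R mat 1 + b *\<^sub>R Jmat) ** B) = cmat (a *\<^sub>R mat 1 + b *\<^sub>R Jmat) ** cmat B" by (rule cmat_mult)
  also have "cmat (a *\<^sub>R mat 1 + b *\<^sub>R Jmat) = (\<chi> i j. if i = j then Complex a b else 0)"
    by (simp add: cmat_def vec_eq_iff mat_def Jmat_def complex_eq_iff)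
  also have "\<dots> ** cmat B = (\<chi> i j. Complex a b * cmat B $ i $ j)"
  proof -
    have "(\<Sum>k\<in>UNIV. (if i = k then Complex a b else 0) * cmat B $ k $ j) = Complex a b * cmat B $ i $ j" for i j
      by (subst sum.cong[OF refl, of _ _ "\<lambda>k. if k = i then Complex a b * cmat B $ i $ j else 0"]) auto
    then show ?thesis by (simp add: matrix_matrix_mult_def vec_eq_iff)
  qed
  finally show ?thesis .
qed

text \<open>Equivalently, \<open>(lin M)\<^sup>-\<^sup>1 ant M\<close> is a contraction.\<close>

lemma Sp_lin_ant_contraction:
  assumes M: "M \<in> Sp" and eq: "lin M *v w = ant M *v u"
  shows "norm w \<le> norm u"
proof (cases "w = 0")
  case False
  define A where "A = transpose (lin M)"
  \<comment> \<open>The norm identity compares \<open>ant\<close> and \<open>lin\<close> on one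
    argument vector. A bound for the inverse of \<open>lin M\<close> applied after
    \<open>ant M\<close> is its dual, hence the passage to the transpose, which is symplectic as
    well.\<close>
  have MT: "transpose M \<in> Sp" using M by (rule Sp_transpose)
  have "invertible A" using Sp_lin_invertible[OF MT] by (simp add: A_def lin_transpose)
  define y where "y = matrix_inv A *v w"
  have Ay: "A *v y = w" using matrix_inv_right[OF \<open>invertible A\<close>] by (simp add: y_def matrix_vector_mul_assoc)
  have "(norm (ant (transpose M) *v y))\<^sup>2 \<le> (norm (lin (transpose M) *v y))\<^sup>2"
    unfolding Sp_lin_ant_norm[OF MT] by simp
  then have "norm (ant (transpose M) *v y) \<le> norm (lin (transpose M) *v y)"
    using norm_ge_zero by (rule power2_le_imp_le)
  then have "norm (transpose (ant M) *v y) \<le> norm (A *v y)"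
    unfolding A_def lin_transpose ant_transpose .
  then have le: "norm (transpose (ant M) *v y) \<le> norm w" by (simp add: Ay)
  have "norm w * norm w = w \<bullet> (A *v y)" by (simp add: Ay power2_norm_eq_inner flip: power2_eq_square)
  also have "\<dots> = (ant M *v u) \<bullet> y" by (simp add: A_def inner_transpose2[symmetric] eq)
  also have "\<dots> = u \<bullet> (transpose (ant M) *v y)" by (rule inner_transpose2)
  also have "\<dots> \<le> norm u * norm (transpose (ant M) *v y)" by (rule norm_cauchy_schwarz)
  also have "\<dots> \<le> norm u * norm w" using le by (intro mult_left_mono) auto
  finally show ?thesis using False by simp
qed simp

lemma complex_scalar_norm: "norm ((a *\<^sub>R mat 1 + b *\<^sub>R Jmat) *v x) = norm (Complex a b) * norm x"
proof -
  have "(norm ((a *\<^sub>R mat 1 + b *\<^sub>R Jmat) *v x))\<^sup>2 = (a\<^sup>2 + b\<^sup>2) * (norm x)\<^sup>2"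
    unfolding power2_norm_eq_inner
    by (simp add: mvec inner_add_left inner_add_right inner_commute[of "Jmat *v x" x] power2_eq_square algebra_simps)
  also have "\<dots> = (norm (Complex a b) * norm x)\<^sup>2"
    by (simp add: power_mult_distrib cmod_power2)
  finally show ?thesis by (simp add: power2_eq_iff_nonneg)
qed

text \<open>A complex scalar passes through \<open>ant M\<close> as its conjugate. For a kernel
  vector \<open>v\<close> the contraction property then gives
  \<open>norm (lin N *v v) \<le> norm (ant N *v v)\<close>, contradicting the norm identity for
  \<open>N\<close> unless \<open>v = 0\<close>.\<close>

lemma pencil_nonzero:
  assumes M: "M \<in> Sp" and N: "N \<in> Sp" and z: "norm (Complex a b) \<le> 1"
  shows "cdet (lin M ** lin N + (a *\<^sub>R mat 1 + b *\<^sub>R Jmat) ** (ant M ** ant N)) \<noteq> 0"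
proof (rule cdet_nonzero)
  let ?z = "a *\<^sub>R mat 1 + b *\<^sub>R Jmat" and ?z' = "a *\<^sub>R mat 1 + (- b) *\<^sub>R Jmat"
  have "Jcomm (ant M ** ant N)" by (simp add: Jcomm_vector mvec ant_J)
  then show "Jcomm (lin M ** lin N + ?z ** (ant M ** ant N))"
    by (intro Jcomm_add Jcomm_mult[of "lin M"] Jcomm_mult[of ?z] Jcomm_scaleR Jcomm_lin) simp_all
  show "invertible (lin M ** lin N + ?z ** (ant M ** ant N))"
  proof (rule invertibleI_inj)
    fix v assume "(lin M ** lin N + ?z ** (ant M ** ant N)) *v v = 0"
    then have "lin M *v (lin N *v v) = - (?z *v (ant M *v (ant N *v v)))"
      by (simp add: mvec add_eq_0_iff)
    also have "?z *v (ant M *v (ant N *v v)) = ant M *v (?z' *v (ant N *v v))"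
      by (simp add: mvec ant_J)
    finally have "lin M *v (lin N *v v) = ant M *v (- (?z' *v (ant N *v v)))" by (simp add: matrix_vector_uminus)
    then have "norm (lin N *v v) \<le> norm (- (?z' *v (ant N *v v)))"
      by (rule Sp_lin_ant_contraction[OF M])
    also have "\<dots> = norm (Complex a b) * norm (ant N *v v)"
      unfolding norm_minus_cancel complex_scalar_norm by (simp add: cmod_def)
    also have "\<dots> \<le> norm (ant N *v v)" using z by (simp add: mult_left_le_one_le)
    finally have "(norm (lin N *v v))\<^sup>2 \<le> (norm (ant N *v v))\<^sup>2" by (simp add: power_mono)
    then show "v = 0" unfolding Sp_lin_ant_norm[OF N] by simp
  qed
qed

text \<open>Only real parameters occur here, but the bound needs the whole disc: the determinant is
  a polynomial of degree at most \<open>n\<close> whose roots all lie outside it.\<close>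

lemma pencil_argument_variation:
  fixes M N :: "'n::finite smat"
  assumes M: "M \<in> Sp" and N: "N \<in> Sp" and L: "continuous_on {0..1} L"
    and e: "\<And>s. s \<in> {0..1} \<Longrightarrow> exp (L s) = cdet (lin M ** lin N + s *\<^sub>R (ant M ** ant N))"
  shows "\<bar>Im (L 1 - L 0)\<bar> \<le> real CARD('n) * pi / 2"
proof -
  obtain p where p: "degree p \<le> CARD('n)"
      "\<And>z. poly p z = det (\<chi> i j. cmat (lin M ** lin N)$i$j + z * cmat (ant M ** ant N)$i$j)"
    using det_pencil_poly[of "cmat (lin M ** lin N)" "cmat (ant M ** ant N)"] by blast
  have pc: "poly p (Complex a b) = cdet (lin M ** lin N + (a *\<^sub>R mat 1 + b *\<^sub>R Jmat) ** (ant M ** ant N))" for a b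
  proof -
    have "cmat (lin M ** lin N + (a *\<^sub>R mat 1 + b *\<^sub>R Jmat) ** (ant M ** ant N)) =
      (\<chi> i j. cmat (lin M ** lin N)$i$j + Complex a b * cmat (ant M ** ant N)$i$j)"
      by (simp add: cmat_add cmat_complex_scalar vec_eq_iff)
    then show ?thesis by (simp add: p(2) cdet_cmat)
  qed
  have "\<bar>Im (L 1 - L 0)\<bar> \<le> real (degree p) * pi / 2"
  proof (rule poly_argument_variation[OF _ L])
    show "poly p z \<noteq> 0" if "norm z \<le> 1" for z
    proof (cases z)
      case (Complex a b)
      then show ?thesis using pencil_nonzero[OF M N] that pc by simp
    qed
    show "exp (L s) = poly p (complex_of_real s)" if "s \<in> {0..1}" for s
      using e[OF that] pc[of s 0] by (simp add: complex_of_real_def matrix_mult_distribs)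
  qed
  also have "\<dots> \<le> real CARD('n) * pi / 2" using p(1) by (intro divide_right_mono mult_right_mono) auto
  finally show ?thesis .
qed

section \<open>The Maslov index computed from logarithms of \<open>clin\<close>\<close>

definition Sp_path :: "(real \<Rightarrow> 'n::finite smat) \<Rightarrow> bool" where
  "Sp_path p \<longleftrightarrow> continuous_on {0..1} p \<and> (\<forall>t\<in>{0..1}. p t \<in> Sp)"

definition clin_log :: "(real \<Rightarrow> 'n::finite smat) \<Rightarrow> (real \<Rightarrow> complex) \<Rightarrow> bool" where
  "clin_log p L \<longleftrightarrow> continuous_on {0..1} L \<and> (\<forall>t\<in>{0..1}. exp (L t) = clin (p t))"

lemma spath_iff: "spath p \<longleftrightarrow> Sp_path p \<and> p 0 = mat 1"
  by (auto simp: spath_def Sp_path_def path_def path_image_def pathstart_def)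

lemma continuous_on_clin [continuous_intros]: "continuous_on S f \<Longrightarrow> continuous_on S (\<lambda>x. clin (f x))"
  unfolding clin_def by (intro continuous_intros)

lemma clin_log_exists:
  assumes "Sp_path p" obtains L where "clin_log p L"
proof -
  have "continuous_on {0..1} (\<lambda>t. clin (p t))" "\<And>t. t \<in> {0..1} \<Longrightarrow> clin (p t) \<noteq> 0"
    using assms by (auto simp: Sp_path_def clin_nonzero intro!: continuous_intros)
  then obtain L where "continuous_on {0..1} L" "\<forall>t\<in>{0..1}. exp (L t) = clin (p t)"
    by (rule continuous_log_interval)
  then show thesis using that by (auto simp: clin_log_def)
qed

text \<open>The imaginary part of the logarithm is an admissible angle function, and any other one
  differs from it by a constant. This resolves the definite description in
  \<open>maslov\<close>.\<close>

lemma maslov_eq: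
  assumes p: "Sp_path p" and L: "clin_log p L"
  shows "maslov p = Im (L 1 - L 0)"
proof -
  have polar: "cdet (polar_U (p t)) = exp (\<i> * complex_of_real (Im (L t)))" if "t \<in> {0..1}" for t
  proof -
    have "cdet (polar_U (p t)) = exp (L t) / of_real (norm (exp (L t)))"
      using p L that by (simp add: cdet_polar_U Sp_path_def clin_log_def)
    also have "\<dots> = exp (L t - complex_of_real (Re (L t)))"
      by (simp add: exp_diff flip: exp_of_real)
    also have "L t - complex_of_real (Re (L t)) = \<i> * complex_of_real (Im (L t))"
      by (simp add: complex_eq_iff)
    finally show ?thesis .
  qed
  have cL: "continuous_on {0..1} L" using L by (simp add: clin_log_def)
  show ?thesis unfolding maslov_def
  proof (rule the_equality)
    show "\<exists>\<theta>. continuous_on {0..1} \<theta> \<and> (\<forall>t\<in>{0..1}. cdet (polar_U (p t)) = exp (\<i> * complex_of_real (\<theta> t)))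
        \<and> Im (L 1 - L 0) = \<theta> 1 - \<theta> 0"
      using polar cL by (intro exI[of _ "\<lambda>t. Im (L t)"]) (auto intro!: continuous_intros)
    fix m assume "\<exists>\<theta>. continuous_on {0..1} \<theta> \<and> (\<forall>t\<in>{0..1}. cdet (polar_U (p t)) = exp (\<i> * complex_of_real (\<theta> t)))
        \<and> m = \<theta> 1 - \<theta> 0"
    then obtain \<theta> where \<theta>: "continuous_on {0..1} \<theta>"
      "\<And>t. t \<in> {0..1} \<Longrightarrow> cdet (polar_U (p t)) = exp (\<i> * complex_of_real (\<theta> t))" "m = \<theta> 1 - \<theta> 0" by blast
    have "\<i> * complex_of_real (\<theta> 1) - \<i> * complex_of_real (\<theta> 0)
        = \<i> * complex_of_real (Im (L 1)) - \<i> * complex_of_real (Im (L 0))"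
      by (rule log_increment_unique[where c = 1]) (use \<theta> cL polar in \<open>auto intro!: continuous_intros\<close>)
    then show "m = Im (L 1 - L 0)" using \<theta>(3) by (simp add: complex_eq_iff)
  qed
qed

text \<open>A logarithm over the whole homotopy square is constant on the two sides where the end
  points stay fixed, so both paths have the same increment.\<close>

lemma maslov_homotopic:
  assumes "homotopic_paths Sp p q"
  shows "maslov p = maslov q"
proof -
  obtain h where h: "continuous_on ({0..1} \<times> {0..1}) h" "h \<in> ({0..1} \<times> {0..1}) \<rightarrow> Sp"
    and hp: "\<forall>x\<in>{0..1}. h (0, x) = p x" and hq: "\<forall>x\<in>{0..1}. h (1, x) = q x"
    and he: "\<forall>t\<in>{0..1::real}. pathstart (h \<circ> Pair t) = pathstart p \<and> pathfinish (h \<circ> Pair t) = pathfinish p"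
    using assms unfolding homotopic_paths by blast
  have inSp: "h (s, t) \<in> Sp" if "s \<in> {0..1}" "t \<in> {0..1}" for s t using h(2) that by auto
  obtain K where K: "continuous_on ({0..1} \<times> {0..1}) K"
      "\<forall>s\<in>{0..1}. \<forall>t\<in>{0..1}. exp (K (s, t)) = clin (h (s, t))"
  proof (rule continuous_log_square[where f = "\<lambda>x. clin (h x)"])
    show "continuous_on ({0..1} \<times> {0..1}) (\<lambda>x. clin (h x))" using h by (intro continuous_intros)
    show "clin (h x) \<noteq> 0" if "x \<in> {0..1} \<times> {0..1}" for x using that inSp clin_nonzero by (cases x) auto
  qed
  have "Sp_path p" "Sp_path q"
    using assms homotopic_paths_imp_path homotopic_paths_imp_subset
    unfolding Sp_path_def path_def[symmetric] path_image_def by blast+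
  moreover have "clin_log p (\<lambda>t. K (0, t))" "clin_log q (\<lambda>t. K (1, t))"
    using K hp hq continuous_on_square_row[OF K(1)] by (auto simp: clin_log_def)
  ultimately have "maslov p = Im (K (0, 1) - K (0, 0))" "maslov q = Im (K (1, 1) - K (1, 0))"
    using maslov_eq by blast+
  moreover have "K (1, 0) = K (0, 0)"
    by (rule exp_constant_imp_eq[OF continuous_on_square_column[OF K(1)], where c = "clin (p 0)"])
      (use K he in \<open>auto simp: pathstart_def\<close>)
  moreover have "K (1, 1) = K (0, 1)"
    by (rule exp_constant_imp_eq[OF continuous_on_square_column[OF K(1)], where c = "clin (p 1)"])
      (use K he in \<open>auto simp: pathfinish_def\<close>)
  ultimately show ?thesis by simp
qed

lemma Sp_path_pmult: "Sp_path p \<Longrightarrow> Sp_path q \<Longrightarrow> Sp_path (pmult p q)"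
  by (auto simp: Sp_path_def pmult_def Sp_mult intro!: continuous_intros)

lemma Sp_path_pinv: "Sp_path p \<Longrightarrow> Sp_path (pinv p)"
  by (auto simp: Sp_path_def pinv_def Sp_matrix_inv Sp_invertible intro!: continuous_on_matrix_inv)

text \<open>The reason for omitting the base point in \<open>Sp_path\<close>: conjugation by a fixed
  matrix becomes a product with constant paths.\<close>

lemma Sp_path_const: "M \<in> Sp \<Longrightarrow> Sp_path (\<lambda>t. M)"
  by (simp add: Sp_path_def)

text \<open>The complex linear part of a product is \<open>lin p lin q + ant p ant q\<close>. Scaling the second summand by
  \<open>s \<in> [0,1]\<close> deforms its determinant to the product of the two determinants without ever vanishing, and
  at each end of the paths the argument changes by at most \<open>n \<pi> / 2\<close> during this deformation.\<close>

theorem maslov_quasimorphism: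
  fixes p q :: "real \<Rightarrow> 'n::finite smat"
  assumes p: "Sp_path p" and q: "Sp_path q"
  shows "\<bar>maslov (pmult p q) - maslov p - maslov q\<bar> \<le> real CARD('n) * pi"
proof -
  define f where "f x = cdet (lin (p (snd x)) ** lin (q (snd x)) + fst x *\<^sub>R (ant (p (snd x)) ** ant (q (snd x))))" for x :: "real \<times> real"
  have cp: "continuous_on ({0..1} \<times> {0..1}) (\<lambda>x::real\<times>real. p (snd x))" and cq: "continuous_on ({0..1} \<times> {0..1}) (\<lambda>x::real\<times>real. q (snd x))"
    using p q by (auto simp: Sp_path_def intro!: continuous_on_compose2[of "{0..1}" _ _ snd] continuous_intros)
  obtain K where K: "continuous_on ({0..1} \<times> {0..1}) K"
      "\<forall>s\<in>{0..1}. \<forall>t\<in>{0..1}. exp (K (s, t)) = f (s, t)"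
  proof (rule continuous_log_square[where f = f])
    show "continuous_on ({0..1} \<times> {0..1}) f" unfolding f_def by (intro continuous_intros cp cq)
    fix x :: "real \<times> real" assume x: "x \<in> {0..1} \<times> {0..1}"
    obtain s t where st: "x = (s, t)" by (cases x)
    have "norm (Complex s 0) \<le> 1" using x st by (simp add: cmod_def)
    moreover have "p t \<in> Sp" "q t \<in> Sp" using p q x st by (auto simp: Sp_path_def)
    ultimately have "cdet (lin (p t) ** lin (q t) + (s *\<^sub>R mat 1 + 0 *\<^sub>R Jmat) ** (ant (p t) ** ant (q t))) \<noteq> 0"
      using pencil_nonzero by blast
    then show "f x \<noteq> 0" by (simp add: f_def st matrix_mult_distribs)
  qed
  obtain L M where L: "clin_log p L" and M: "clin_log q M" using p q clin_log_exists by metis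
  have "clin_log (pmult p q) (\<lambda>t. K (1, t))"
    using K continuous_on_square_row[OF K(1)] by (auto simp: clin_log_def f_def clin_def pmult_def lin_mult)
  then have 1: "maslov (pmult p q) = Im (K (1, 1) - K (1, 0))"
    using maslov_eq Sp_path_pmult p q by blast
  have "K (0, 1) - K (0, 0) = (L 1 + M 1) - (L 0 + M 0)"
    by (rule log_increment_unique[where c = 1 and L = "\<lambda>t. K (0, t)" and M = "\<lambda>t. L t + M t"])
      (use K L M continuous_on_square_row[OF K(1)] in
       \<open>auto simp: clin_log_def f_def clin_def exp_add cdet_mult Jcomm_lin intro!: continuous_intros\<close>)
  then have 2: "maslov p + maslov q = Im (K (0, 1) - K (0, 0))"
    using maslov_eq[OF p L] maslov_eq[OF q M] by simp
  have "\<bar>Im (K (1, t) - K (0, t))\<bar> \<le> real CARD('n) * pi / 2" if "t \<in> {0..1}" for t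
    by (rule pencil_argument_variation[where M = "p t" and N = "q t"])
      (use that p q K continuous_on_square_column[OF K(1) that] in \<open>auto simp: Sp_path_def f_def\<close>)
  then have "\<bar>Im (K (1, 0) - K (0, 0))\<bar> \<le> real CARD('n) * pi / 2" "\<bar>Im (K (1, 1) - K (0, 1))\<bar> \<le> real CARD('n) * pi / 2"
    by auto
  with 1 2 show ?thesis unfolding minus_complex.simps abs_le_iff by linarith
qed

lemma maslov_const: "M \<in> Sp \<Longrightarrow> maslov (\<lambda>t. M) = 0"
  using maslov_eq[OF Sp_path_const, of M "\<lambda>t. Ln (clin M)"] by (simp add: clin_log_def clin_nonzero)

lemma maslov_pinv:
  fixes p :: "real \<Rightarrow> 'n::finite smat"
  assumes p: "Sp_path p"
  shows "\<bar>maslov (pinv p) + maslov p\<bar> \<le> real CARD('n) * pi"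
proof -
  have "homotopic_paths Sp (pmult p (pinv p)) (\<lambda>t. mat 1)"
  proof (rule homotopic_paths_eq)
    show "path (pmult p (pinv p))" "path_image (pmult p (pinv p)) \<subseteq> Sp"
      using Sp_path_pmult[OF p Sp_path_pinv[OF p]] by (auto simp: Sp_path_def path_def path_image_def)
    show "pmult p (pinv p) t = mat 1" if "t \<in> {0..1}" for t
      using p that by (simp add: pmult_def pinv_def Sp_path_def Sp_invertible matrix_inv_right)
  qed
  then have "maslov (pmult p (pinv p)) = 0" using maslov_homotopic maslov_const[OF Sp_mat_1] by metis
  then show ?thesis using maslov_quasimorphism[OF p Sp_path_pinv[OF p]] by (simp add: algebra_simps)
qed



subsection \<open>Positive paths have nonnegative Maslov index\<close>

text \<open>A permutation other than the identity moves at least two indices. The product rule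
  differentiates one factor, so each of its terms keeps an off-diagonal entry of the
  identity.\<close>

lemma has_vector_derivative_det_at_mat_1:
  fixes C :: "real \<Rightarrow> complex^'n^'n"
  assumes C0: "C t0 = mat 1"
    and der: "\<And>i j. ((\<lambda>t. C t $ i $ j) has_vector_derivative C' $ i $ j) (at t0 within S)"
  shows "((\<lambda>t. det (C t)) has_vector_derivative trace C') (at t0 within S)"
proof -
  let ?P = "{\<pi>. \<pi> permutes (UNIV::'n set)}"
  define T where "T \<pi> = (\<Sum>i\<in>UNIV. C' $ i $ \<pi> i * (\<Prod>j\<in>UNIV - {i}. C t0 $ j $ \<pi> j))" for \<pi>
  have prod: "((\<lambda>t. of_int (sign \<pi>) * (\<Prod>i\<in>UNIV. C t $ i $ \<pi> i)) has_vector_derivative of_int (sign \<pi>) * T \<pi>) (at t0 within S)" for \<pi>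
  proof -
    have "((\<lambda>t. \<Prod>i\<in>UNIV. C t $ i $ \<pi> i) has_derivative
        (\<lambda>y. \<Sum>i\<in>UNIV. (y *\<^sub>R C' $ i $ \<pi> i) * (\<Prod>j\<in>UNIV - {i}. C t0 $ j $ \<pi> j))) (at t0 within S)"
      by (rule has_derivative_prod) (use der in \<open>simp add: has_vector_derivative_def\<close>)
    then have "((\<lambda>t. \<Prod>i\<in>UNIV. C t $ i $ \<pi> i) has_vector_derivative T \<pi>) (at t0 within S)"
      unfolding has_vector_derivative_def T_def by (simp add: scaleR_sum_right)
    then show ?thesis by (rule has_vector_derivative_mult_right)
  qed
  have T0: "T \<pi> = 0" if "\<pi> permutes UNIV" "\<pi> \<noteq> id" for \<pi>
  proof -
    obtain k where k: "\<pi> k \<noteq> k" using \<open>\<pi> \<noteq> id\<close> by (auto simp: fun_eq_iff)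
    then have l: "\<pi> (\<pi> k) \<noteq> \<pi> k" using permutes_inj[OF that(1)] by (metis injD)
    have "(\<Prod>j\<in>UNIV - {i}. C t0 $ j $ \<pi> j) = 0" for i
    proof -
      obtain m where "m \<noteq> i" "\<pi> m \<noteq> m" using k l by metis
      then have "C t0 $ m $ \<pi> m = 0" by (simp add: C0 mat_def)
      then show ?thesis using \<open>m \<noteq> i\<close> by (intro prod_zero) auto
    qed
    then show ?thesis unfolding T_def by (intro sum.neutral ballI) (simp only: mult_zero_right)
  qed
  have "(\<Sum>\<pi>\<in>?P. of_int (sign \<pi>) * T \<pi>) = (\<Sum>\<pi>\<in>{id}. of_int (sign \<pi>) * T \<pi>)"
    by (rule sum.mono_neutral_right) (auto simp: T0 permutes_id finite_permutations)
  also have "\<dots> = trace C'"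
    by (simp add: T_def trace_def C0 mat_def)
  finally have "(\<Sum>\<pi>\<in>?P. of_int (sign \<pi>) * T \<pi>) = trace C'" .
  moreover have "((\<lambda>t. \<Sum>\<pi>\<in>?P. of_int (sign \<pi>) * (\<Prod>i\<in>UNIV. C t $ i $ \<pi> i)) has_vector_derivative
      (\<Sum>\<pi>\<in>?P. of_int (sign \<pi>) * T \<pi>)) (at t0 within S)"
    by (intro has_vector_derivative_sum prod)
  ultimately show ?thesis by (simp add: det_def)
qed

text \<open>Dividing by \<open>F t0\<close> brings the values near 1, away from the branch cut of
  \<open>Ln\<close>. Continuity of \<open>L\<close> then makes \<open>L - L t0\<close> agree locally
  with this principal branch.\<close>

lemma has_vector_derivative_log:
  fixes L F :: "real \<Rightarrow> complex"
  assumes L: "continuous_on S L" and e: "\<And>t. t \<in> S \<Longrightarrow> exp (L t) = F t"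
    and t0: "t0 \<in> S" and F: "(F has_vector_derivative F') (at t0 within S)"
  shows "(L has_vector_derivative F' / F t0) (at t0 within S)"
proof -
  have nz: "F t0 \<noteq> 0" using e[OF t0] by (metis exp_not_eq_zero)
  obtain d where d: "d > 0" "\<And>t. t \<in> S \<Longrightarrow> dist t t0 < d \<Longrightarrow> dist (L t) (L t0) < pi"
    using L t0 unfolding continuous_on_iff by (metis pi_gt_zero)
  have "((\<lambda>t. F t * inverse (F t0)) has_vector_derivative F' * inverse (F t0)) (at t0 within S)"
    using F by (rule has_vector_derivative_mult_left)
  moreover have "(Ln has_field_derivative inverse 1) (at (F t0 * inverse (F t0)) within (\<lambda>t. F t * inverse (F t0)) ` S)"
    using nz by (simp add: has_field_derivative_at_within has_field_derivative_Ln[of 1, simplified])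
  ultimately have "(Ln \<circ> (\<lambda>t. F t * inverse (F t0)) has_vector_derivative F' * inverse (F t0) * inverse 1) (at t0 within S)"
    by (rule field_vector_diff_chain_within)
  then have "((\<lambda>t. Ln (F t * inverse (F t0)) + L t0) has_vector_derivative F' / F t0) (at t0 within S)"
    by (simp add: o_def divide_inverse has_vector_derivative_add_const)
  then show ?thesis
  proof (rule has_vector_derivative_transform_within[OF _ d(1) t0])
    fix t assume t: "t \<in> S" "dist t t0 < d"
    have "F t * inverse (F t0) = exp (L t - L t0)"
      using e[OF t(1)] e[OF t0] by (simp add: exp_diff divide_inverse)
    moreover have "\<bar>Im (L t - L t0)\<bar> < pi"
      using d(2)[OF t] abs_Im_le_cmod[of "L t - L t0"] by (simp add: dist_norm)
    ultimately show "Ln (F t * inverse (F t0)) + L t0 = L t" by (simp add: abs_less_iff)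
  qed
qed

text \<open>The real trace of a complex linear map is twice the real part of its complex trace; here
  this is read for \<open>Jmat ** Y\<close>, that is, for \<open>i\<close> times
  \<open>Y\<close>.\<close>

lemma trace_cmat: "Im (trace (cmat Y)) = - trace (Jmat ** Y) / 2" if "Jcomm Y"
proof -
  have J: "(Jmat ** Y) $ k $ k = (Jmat *v column k Y) $ k" for k
    by (simp add: matrix_matrix_mult_def matrix_vector_mult_def column_def)
  have "trace (Jmat ** Y) = (\<Sum>i\<in>UNIV. - 2 * Y $ Inr i $ Inl i)"
    by (simp add: trace_def sum_UNIV_Plus J column_def Jcomm_entries[OF that] sum_negf flip: sum.distrib sum_distrib_left)
  then show ?thesis by (simp add: trace_def cmat_def sum_negf flip: sum_distrib_left)
qed

lemma trace_lin: "trace (lin Y) = trace Y"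
proof -
  have "trace (Jmat ** (Y ** Jmat)) = trace ((Y ** Jmat) ** Jmat)" by (rule trace_mul_sym)
  then have "trace (Jmat ** Y ** Jmat) = - trace Y"
    by (simp add: matrix_mul_assoc[symmetric] matrix_mult_distribs trace_def sum_negf)
  then have "trace (Y - Jmat ** Y ** Jmat) = 2 * trace Y" by (simp add: trace_sub)
  moreover have "trace (lin Y) = (1/2) * trace (Y - Jmat ** Y ** Jmat)"
    by (simp add: lin_def trace_def sum_distrib_left sum_divide_distrib)
  ultimately show ?thesis by simp
qed

definition pos_path :: "(real \<Rightarrow> 'n::finite smat) \<Rightarrow> bool" where
  "pos_path q \<longleftrightarrow> spath q \<and> (\<exists>q'. (\<forall>t\<in>{0..1}. (q has_vector_derivative q' t) (at t within {0..1})) \<and>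
      continuous_on {0..1} q' \<and>
      (\<forall>t\<in>{0..1}. \<exists>H. transpose H = H \<and> psd H \<and> q' t = Jmat ** H ** q t))"

lemma in_cone_iff: "in_cone p \<longleftrightarrow> spath p \<and> (\<exists>q. pos_path q \<and> homotopic_paths Sp p q)"
proof -
  have "q' t ** matrix_inv (q t) = Jmat ** H \<longleftrightarrow> q' t = Jmat ** H ** q t"
    if q: "spath q" and t: "t \<in> {0..1}" for q q' :: "real \<Rightarrow> 'a smat" and t H
  proof -
    have "q t \<in> Sp" using q t by (auto simp: spath_iff Sp_path_def)
    then have inv: "q t ** matrix_inv (q t) = mat 1" "matrix_inv (q t) ** q t = mat 1"
      by (simp_all add: Sp_invertible matrix_inv_left matrix_inv_right)
    show ?thesis
    proof
      assume "q' t ** matrix_inv (q t) = Jmat ** H"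
      then have "Jmat ** H ** q t = q' t ** matrix_inv (q t) ** q t" by simp
      also have "\<dots> = q' t" by (simp add: matrix_mul_assoc[symmetric] inv)
      finally show "q' t = Jmat ** H ** q t" by simp
    next
      assume "q' t = Jmat ** H ** q t"
      then show "q' t ** matrix_inv (q t) = Jmat ** H" by (simp add: matrix_mul_assoc[symmetric] inv)
    qed
  qed
  then have "in_cone p \<longleftrightarrow> spath p \<and> (\<exists>q q'. spath q \<and> same_elem p q \<and>
      (\<forall>t\<in>{0..1}. (q has_vector_derivative q' t) (at t within {0..1})) \<and>
      continuous_on {0..1} q' \<and>
      (\<forall>t\<in>{0..1}. \<exists>H. transpose H = H \<and> psd H \<and> q' t = Jmat ** H ** q t))"
    unfolding in_cone_def by (intro conj_cong refl ex_cong1 ball_cong) auto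
  then show ?thesis by (auto simp: pos_path_def same_elem_def)
qed

text \<open>With \<open>v = lin M *v y\<close> the form equals \<open>|lin M y|^2\<close> plus the
  inner product of \<open>lin M y\<close> with the shorter vector \<open>ant M y\<close>, so
  Cauchy-Schwarz applies.\<close>

lemma Sp_lin_inv_nonneg:
  assumes "M \<in> Sp" shows "v \<bullet> ((M ** matrix_inv (lin M)) *v v) \<ge> 0"
proof -
  define y where "y = matrix_inv (lin M) *v v"
  have v: "v = lin M *v y"
    using matrix_inv_right[OF Sp_lin_invertible[OF assms]] by (simp add: y_def matrix_vector_mul_assoc)
  have "(norm (ant M *v y))\<^sup>2 \<le> (norm (lin M *v y))\<^sup>2" unfolding Sp_lin_ant_norm[OF assms] by simp
  then have "norm (ant M *v y) \<le> norm (lin M *v y)" using norm_ge_zero by (rule power2_le_imp_le)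
  then have "norm (lin M *v y) * norm (ant M *v y) \<le> norm (lin M *v y) * norm (lin M *v y)"
    by (intro mult_left_mono) auto
  moreover have "- (norm (lin M *v y) * norm (ant M *v y)) \<le> (lin M *v y) \<bullet> (ant M *v y)"
    using Cauchy_Schwarz_ineq2[of "lin M *v y" "ant M *v y"] by (simp add: abs_le_iff)
  moreover have "v \<bullet> ((M ** matrix_inv (lin M)) *v v) = (lin M *v y) \<bullet> (lin M *v y) + (lin M *v y) \<bullet> (ant M *v y)"
  proof -
    have "(M ** matrix_inv (lin M)) *v v = (lin M + ant M) *v y" by (simp add: matrix_mult_vector y_def lin_plus_ant)
    then show ?thesis by (simp add: v mvec inner_add_right)
  qed
  ultimately show ?thesis by (simp add: power2_norm_eq_inner[symmetric] power2_eq_square)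
qed

text \<open>By Jacobi's formula the argument of \<open>clin (q t)\<close> grows at the rate
  \<open>trace (H q (lin q)\<^sup>-\<^sup>1) / 2\<close>, and \<open>q (lin q)\<^sup>-\<^sup>1 = 1 + ant q (lin q)\<^sup>-\<^sup>1\<close> has a positive quadratic form.\<close>

lemma pos_path_maslov_nonneg:
  fixes q :: "real \<Rightarrow> 'n::finite smat"
  assumes "pos_path q" shows "maslov q \<ge> 0"
proof -
  obtain q' where q': "\<And>t. t \<in> {0..1} \<Longrightarrow> (q has_vector_derivative q' t) (at t within {0..1})"
    and H: "\<And>t. t \<in> {0..1} \<Longrightarrow> \<exists>H. transpose H = H \<and> psd H \<and> q' t = Jmat ** H ** q t"
    using assms unfolding pos_path_def by blast
  have q: "Sp_path q" using assms by (simp add: pos_path_def spath_iff)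
  obtain L where L: "clin_log q L" using clin_log_exists[OF q] .
  have "\<exists>F'. ((\<lambda>t. clin (q t)) has_vector_derivative F') (at t0 within {0..1}) \<and> Im (F' / clin (q t0)) \<ge> 0"
    if t0: "t0 \<in> {0..1}" for t0
  proof -
    obtain H where H: "transpose H = H" "psd H" "q' t0 = Jmat ** H ** q t0" using H[OF t0] by blast
    define a where "a = matrix_inv (lin (q t0))"
    have Sp: "q t0 \<in> Sp" using q t0 by (simp add: Sp_path_def)
    have Ja: "Jcomm a" unfolding a_def by (intro Jcomm_matrix_inv Jcomm_lin Sp_lin_invertible Sp)
    \<comment> \<open>Normalizing by the inverse at \<open>t0\<close> makes the matrix equal to the
      identity there, so the derivative of its complex determinant is a trace.\<close>
    define B where "B t = lin (q t) ** a" for t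
    have B0: "B t0 = mat 1" by (simp add: B_def a_def matrix_inv_right Sp_lin_invertible Sp)
    define Y where "Y = lin (q' t0) ** a"
    have JY: "Jcomm Y" unfolding Y_def by (intro Jcomm_mult Jcomm_lin Ja)
    have "bounded_linear (\<lambda>M::'n smat. lin M ** a)"
      by (rule linear_conv_bounded_linear[THEN iffD1], rule linearI) (simp_all add: lin_add lin_scaleR matrix_mult_distribs)
    then have derB: "(B has_vector_derivative Y) (at t0 within {0..1})"
      unfolding B_def Y_def using q'[OF t0] by (rule bounded_linear.has_vector_derivative)
    have derE: "((\<lambda>t. cmat (B t) $ i $ j) has_vector_derivative cmat Y $ i $ j) (at t0 within {0..1})" for i j
    proof -
      have "bounded_linear (\<lambda>M::'n smat. cmat M $ i $ j)"
        by (rule linear_conv_bounded_linear[THEN iffD1], rule linearI) (simp_all add: cmat_def complex_eq_iff)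
      then show ?thesis using derB by (rule bounded_linear.has_vector_derivative)
    qed
    have "((\<lambda>t. det (cmat (B t))) has_vector_derivative trace (cmat Y)) (at t0 within {0..1})"
      by (rule has_vector_derivative_det_at_mat_1[OF _ derE]) (simp add: B0 cmat_mat_1)
    then have "((\<lambda>t. cdet (B t) * clin (q t0)) has_vector_derivative trace (cmat Y) * clin (q t0)) (at t0 within {0..1})"
      unfolding cdet_cmat by (rule has_vector_derivative_mult_left)
    moreover have "cdet (B t) * clin (q t0) = clin (q t)" for t
    proof -
      have "B t ** lin (q t0) = lin (q t)"
        by (simp add: B_def a_def matrix_mul_assoc[symmetric] matrix_inv_left Sp_lin_invertible Sp)
      moreover have "Jcomm (B t)" unfolding B_def by (intro Jcomm_mult Jcomm_lin Ja)
      ultimately show ?thesis unfolding clin_def by (metis cdet_mult)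
    qed
    ultimately have "((\<lambda>t. clin (q t)) has_vector_derivative trace (cmat Y) * clin (q t0)) (at t0 within {0..1})"
      by simp
    moreover have "Im (trace (cmat Y)) \<ge> 0"
    proof -
      have "Y = Jmat ** lin (H ** (q t0 ** a))"
        by (simp add: Y_def H(3) lin_Jcomm_mult lin_mult_Jcomm[OF Ja, symmetric] matrix_mul_assoc[symmetric])
      then have "Jmat ** Y = - lin (H ** (q t0 ** a))" by simp
      then have "Im (trace (cmat Y)) = trace (H ** (q t0 ** a)) / 2"
        unfolding trace_cmat[OF JY] trace_lin[symmetric, of "H ** (q t0 ** a)"] by (simp add: trace_def sum_negf)
      moreover have "trace (H ** (q t0 ** a)) \<ge> 0"
        unfolding a_def using H Sp_lin_inv_nonneg[OF Sp] by (intro trace_mult_nonneg) (auto simp: psd_def)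
      ultimately show ?thesis by simp
    qed
    ultimately show ?thesis using clin_nonzero[OF Sp]
      by (intro exI[of _ "trace (cmat Y) * clin (q t0)"]) simp
  qed
  then obtain F' where F': "\<And>t. t \<in> {0..1} \<Longrightarrow> ((\<lambda>t. clin (q t)) has_vector_derivative F' t) (at t within {0..1})"
      "\<And>t. t \<in> {0..1} \<Longrightarrow> Im (F' t / clin (q t)) \<ge> 0" by metis
  have "(L has_vector_derivative F' t / clin (q t)) (at t within {0..1})" if "t \<in> {0..1}" for t
    using L that F' by (intro has_vector_derivative_log[where F = "\<lambda>t. clin (q t)"]) (auto simp: clin_log_def)
  then have "((\<lambda>t. Im (L t)) has_vector_derivative Im (F' t / clin (q t))) (at t within {0..1})" if "t \<in> {0..1}" for t
    using that bounded_linear.has_vector_derivative[OF bounded_linear_Im] by blast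
  then have "\<exists>x\<in>{0<..<1::real}. Im (L 1) - Im (L 0) = (\<lambda>y. y *\<^sub>R Im (F' x / clin (q x))) (1 - 0)"
    by (intro mvt_simple) (auto simp: has_vector_derivative_def)
  then have "Im (L 1) - Im (L 0) \<ge> 0" using F'(2) by force
  then show ?thesis using maslov_eq[OF q L] by simp
qed

lemma in_cone_maslov_nonneg: "in_cone p \<Longrightarrow> maslov p \<ge> 0"
  unfolding in_cone_iff using maslov_homotopic pos_path_maslov_nonneg by metis



subsection \<open>Complex rotations and reflections\<close>

lemma homotopic_Sp_I:
  fixes h :: "real \<Rightarrow> real \<Rightarrow> 'n::finite smat"
  assumes "continuous_on ({0..1} \<times> {0..1}) (\<lambda>x. h (fst x) (snd x))"
    and "\<And>s t. s \<in> {0..1} \<Longrightarrow> t \<in> {0..1} \<Longrightarrow> h s t \<in> Sp"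
    and "\<And>t. t \<in> {0..1} \<Longrightarrow> h 0 t = p t" "\<And>t. t \<in> {0..1} \<Longrightarrow> h 1 t = q t"
    and "\<And>s. s \<in> {0..1} \<Longrightarrow> h s 0 = p 0" "\<And>s. s \<in> {0..1} \<Longrightarrow> h s 1 = p 1"
  shows "homotopic_paths Sp p q"
  unfolding homotopic_paths using assms
  by (intro exI[of _ "\<lambda>x. h (fst x) (snd x)"]) (auto simp: pathstart_def pathfinish_def)

lemma homotopic_Sp_D:
  fixes p q :: "real \<Rightarrow> 'n::finite smat"
  assumes "homotopic_paths Sp p q"
  obtains h where "continuous_on ({0..1} \<times> {0..1}) h"
    "\<forall>s\<in>{0..1::real}. \<forall>t\<in>{0..1::real}. h (s, t) \<in> Sp"
    "\<forall>t\<in>{0..1::real}. h (0, t) = p t" "\<forall>t\<in>{0..1::real}. h (1, t) = q t"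
    "\<forall>s\<in>{0..1::real}. h (s, 0) = p 0" "\<forall>s\<in>{0..1::real}. h (s, 1) = p 1"
proof -
  obtain h where "continuous_on ({0..1} \<times> {0..1}) h" "h \<in> ({0..1} \<times> {0..1}) \<rightarrow> Sp"
    "\<forall>x\<in>{0..1}. h (0, x) = p x" "\<forall>x\<in>{0..1}. h (1, x) = q x"
    "\<forall>t\<in>{0..1::real}. pathstart (h \<circ> Pair t) = pathstart p \<and> pathfinish (h \<circ> Pair t) = pathfinish p"
    using assms unfolding homotopic_paths by blast
  then show thesis by (intro that[of h]) (auto simp: pathstart_def pathfinish_def)
qed

lemma homotopic_pmult:
  fixes p q :: "real \<Rightarrow> 'n::finite smat"
  assumes "homotopic_paths Sp p p'" "homotopic_paths Sp q q'"
  shows "homotopic_paths Sp (pmult p q) (pmult p' q')"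
proof -
  obtain h where h: "continuous_on ({0..1} \<times> {0..1}) h"
    "\<forall>s\<in>{0..1::real}. \<forall>t\<in>{0..1::real}. h (s, t) \<in> Sp"
    "\<forall>t\<in>{0..1::real}. h (0, t) = p t" "\<forall>t\<in>{0..1::real}. h (1, t) = p' t"
    "\<forall>s\<in>{0..1::real}. h (s, 0) = p 0" "\<forall>s\<in>{0..1::real}. h (s, 1) = p 1"
    using homotopic_Sp_D[OF assms(1)] .
  obtain k where k: "continuous_on ({0..1} \<times> {0..1}) k"
    "\<forall>s\<in>{0..1::real}. \<forall>t\<in>{0..1::real}. k (s, t) \<in> Sp"
    "\<forall>t\<in>{0..1::real}. k (0, t) = q t" "\<forall>t\<in>{0..1::real}. k (1, t) = q' t"
    "\<forall>s\<in>{0..1::real}. k (s, 0) = q 0" "\<forall>s\<in>{0..1::real}. k (s, 1) = q 1"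
    using homotopic_Sp_D[OF assms(2)] .
  show ?thesis
    by (rule homotopic_Sp_I[where h = "\<lambda>s t. h (s, t) ** k (s, t)"])
      (use h k in \<open>auto intro!: continuous_intros simp: Sp_mult pmult_def\<close>)
qed

lemma homotopic_Sp_eq:
  assumes "Sp_path p" "\<And>t. t \<in> {0..1} \<Longrightarrow> p t = q t"
  shows "homotopic_paths Sp p q"
  using assms by (intro homotopic_paths_eq) (auto simp: Sp_path_def path_def path_image_def)

lemma spath_pmult: "spath p \<Longrightarrow> spath q \<Longrightarrow> spath (pmult p q)"
  by (simp add: spath_iff Sp_path_pmult) (simp add: pmult_def)

lemma matrix_inv_mat_1: "matrix_inv (mat 1 :: real^'k^'k) = mat 1"
  by (rule matrix_inv_unique) simp

lemma spath_pinv: "spath p \<Longrightarrow> spath (pinv p)"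
  by (simp add: spath_iff Sp_path_pinv) (simp add: pinv_def matrix_inv_mat_1)

lemma psd_congruence: "psd H \<Longrightarrow> psd (transpose A ** H ** A)"
  by (simp add: psd_def matrix_mult_vector inner_transpose[of _ "transpose A"])

lemma psd_add: "psd H \<Longrightarrow> psd K \<Longrightarrow> psd (H + K)"
  by (simp add: psd_def mvec inner_add_right)

lemma Sp_Jmat_right: "M \<in> Sp \<Longrightarrow> M ** Jmat = Jmat ** transpose (matrix_inv M)"
proof -
  assume M: "M \<in> Sp"
  have "transpose M ** transpose (matrix_inv M) = mat 1"
    by (metis M Sp_invertible matrix_inv_left matrix_transpose_mul transpose_mat)
  moreover have "M ** (Jmat ** transpose M) = Jmat" using Sp_transpose[OF M] by (simp add: Sp_iff)
  ultimately show ?thesis by (metis matrix_mul_assoc matrix_mul_rid)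
qed

text \<open>The Hamiltonian of the product is that of \<open>p\<close> plus that of \<open>q\<close>
  transported by \<open>p t\<close>. Transport is a congruence by the inverse of \<open>p t\<close>,
  because moving \<open>Jmat\<close> past a symplectic matrix produces its inverse
  transpose.\<close>

lemma pos_path_pmult:
  fixes p q :: "real \<Rightarrow> 'n::finite smat"
  assumes "pos_path p" "pos_path q"
  shows "pos_path (pmult p q)"
proof -
  obtain p' where p: "spath p" "\<And>t. t \<in> {0..1} \<Longrightarrow> (p has_vector_derivative p' t) (at t within {0..1})"
      "continuous_on {0..1} p'" "\<And>t. t \<in> {0..1} \<Longrightarrow> \<exists>H. transpose H = H \<and> psd H \<and> p' t = Jmat ** H ** p t"
    using assms(1) unfolding pos_path_def by blast
  obtain q' where q: "spath q" "\<And>t. t \<in> {0..1} \<Longrightarrow> (q has_vector_derivative q' t) (at t within {0..1})"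
      "continuous_on {0..1} q'" "\<And>t. t \<in> {0..1} \<Longrightarrow> \<exists>H. transpose H = H \<and> psd H \<and> q' t = Jmat ** H ** q t"
    using assms(2) unfolding pos_path_def by blast
  have c: "continuous_on {0..1} p" "continuous_on {0..1} q" using p(1) q(1) by (auto simp: spath_iff Sp_path_def)
  show ?thesis unfolding pos_path_def
  proof (intro conjI exI[of _ "\<lambda>t. p t ** q' t + p' t ** q t"] ballI)
    show "spath (pmult p q)" using p q by (simp add: spath_pmult)
    show "continuous_on {0..1} (\<lambda>t. p t ** q' t + p' t ** q t)"
      using p q c by (intro continuous_intros) auto
    fix t :: real assume t: "t \<in> {0..1}"
    show "(pmult p q has_vector_derivative p t ** q' t + p' t ** q t) (at t within {0..1})"
      unfolding pmult_def by (rule has_vector_derivative_matrix_mult[OF p(2)[OF t] q(2)[OF t]])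
    obtain H K where H: "transpose H = H" "psd H" "p' t = Jmat ** H ** p t"
      and K: "transpose K = K" "psd K" "q' t = Jmat ** K ** q t"
      using p(4)[OF t] q(4)[OF t] by blast
    define R where "R = matrix_inv (p t)"
    have pt: "p t \<in> Sp" using p(1) t by (auto simp: spath_iff Sp_path_def)
    have Rp: "R ** p t = mat 1" using pt by (simp add: R_def Sp_invertible matrix_inv_left)
    have "p t ** q' t = p t ** Jmat ** K ** q t" by (simp add: K(3) matrix_mul_assoc)
    also have "\<dots> = Jmat ** transpose R ** K ** q t" by (simp add: Sp_Jmat_right pt R_def)
    also have "\<dots> = Jmat ** (transpose R ** K ** R) ** (p t ** q t)"
      by (simp add: matrix_mul_assoc[symmetric]) (simp add: matrix_mul_assoc Rp flip: matrix_mul_assoc[of _ R])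
    finally have "p t ** q' t + p' t ** q t = Jmat ** (transpose R ** K ** R + H) ** pmult p q t"
      by (simp add: H(3) pmult_def matrix_mult_distribs matrix_mul_assoc)
    moreover have "transpose (transpose R ** K ** R + H) = transpose R ** K ** R + H"
      by (simp add: transpose_simps H K matrix_mul_assoc)
    moreover have "psd (transpose R ** K ** R + H)" by (intro psd_add psd_congruence H K)
    ultimately show "\<exists>H. transpose H = H \<and> psd H \<and> p t ** q' t + p' t ** q t = Jmat ** H ** pmult p q t"
      by blast
  qed
qed

text \<open>Conjugation turns the Hamiltonian \<open>H\<close> into the congruent
  \<open>transpose Q ** H ** Q\<close>.\<close>

lemma pos_path_conjugate:
  fixes q :: "real \<Rightarrow> 'n::finite smat"
  assumes "pos_path q" and Q: "Q \<in> Sp"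
  shows "pos_path (\<lambda>t. matrix_inv Q ** q t ** Q)"
proof -
  obtain q' where q: "spath q" "\<And>t. t \<in> {0..1} \<Longrightarrow> (q has_vector_derivative q' t) (at t within {0..1})"
      "continuous_on {0..1} q'" "\<And>t. t \<in> {0..1} \<Longrightarrow> \<exists>H. transpose H = H \<and> psd H \<and> q' t = Jmat ** H ** q t"
    using assms(1) unfolding pos_path_def by blast
  let ?R = "matrix_inv Q"
  have RQ: "?R ** Q = mat 1" "Q ** ?R = mat 1" using Q by (simp_all add: Sp_invertible matrix_inv_left matrix_inv_right)
  have inv: "matrix_inv ?R = Q" using RQ by (intro matrix_inv_unique)
  show ?thesis unfolding pos_path_def
  proof (intro conjI exI[of _ "\<lambda>t. ?R ** q' t ** Q"] ballI)
    show "spath (\<lambda>t. ?R ** q t ** Q)"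
      using q(1) Q RQ by (auto simp: spath_iff Sp_path_def Sp_mult Sp_matrix_inv intro!: continuous_intros)
    show "continuous_on {0..1} (\<lambda>t. ?R ** q' t ** Q)" using q by (intro continuous_intros) auto
    fix t :: real assume t: "t \<in> {0..1}"
    have "bounded_linear (\<lambda>M. ?R ** M ** Q)"
      by (rule linear_conv_bounded_linear[THEN iffD1], rule linearI) (simp_all add: matrix_mult_distribs)
    then show "((\<lambda>t. ?R ** q t ** Q) has_vector_derivative ?R ** q' t ** Q) (at t within {0..1})"
      using q(2)[OF t] by (rule bounded_linear.has_vector_derivative)
    obtain H where H: "transpose H = H" "psd H" "q' t = Jmat ** H ** q t" using q(4)[OF t] by blast
    have "?R ** q' t ** Q = (?R ** Jmat) ** H ** q t ** Q" by (simp add: H(3) matrix_mul_assoc)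
    also have "?R ** Jmat = Jmat ** transpose Q" using Sp_Jmat_right[OF Sp_matrix_inv[OF Q]] inv by simp
    also have "Jmat ** transpose Q ** H ** q t ** Q = Jmat ** transpose Q ** H ** (Q ** ?R) ** q t ** Q"
      by (simp add: RQ)
    finally have "?R ** q' t ** Q = Jmat ** (transpose Q ** H ** Q) ** (?R ** q t ** Q)"
      by (simp add: matrix_mul_assoc)
    then show "\<exists>H. transpose H = H \<and> psd H \<and> ?R ** q' t ** Q = Jmat ** H ** (?R ** q t ** Q)"
      using H psd_congruence by (intro exI[of _ "transpose Q ** H ** Q"]) (simp add: transpose_simps matrix_mul_assoc)
  qed
qed

section \<open>Complex scalars and rotations on the range of a Hermitian projection\<close>

definition Cscal :: "complex \<Rightarrow> 'n::finite smat" where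
  "Cscal c = Re c *\<^sub>R mat 1 + Im c *\<^sub>R Jmat"

lemma Cscal_vector: "Cscal c *v x = Re c *\<^sub>R x + Im c *\<^sub>R (Jmat *v x)"
  by (simp add: Cscal_def mvec)

lemma Cscal_mult_vector: "Cscal c *v (Cscal d *v x) = Cscal (c * d) *v x"
  by (simp add: Cscal_vector mvec algebra_simps)

lemma Cscal_diff_vector: "Cscal (c - d) *v x = Cscal c *v x - Cscal d *v x"
  and Cscal_minus_vector: "Cscal (- c) *v x = - (Cscal c *v x)"
  by (simp_all add: Cscal_vector algebra_simps)

lemma Cscal_0 [simp]: "Cscal 0 = 0" and Cscal_1 [simp]: "Cscal 1 = mat 1" and Cscal_ii: "Cscal \<i> = Jmat"
  by (simp_all add: Cscal_def)

lemma transpose_Cscal: "transpose (Cscal c) = Cscal (cnj c)"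
  by (simp add: Cscal_def transpose_simps)

lemma Jcomm_Cscal: "Jcomm (Cscal c)"
  unfolding Cscal_def by (intro Jcomm_add Jcomm_scaleR) simp_all

lemma Jcomm_Cscal_vector: "Jcomm Y \<Longrightarrow> Y *v (Cscal c *v x) = Cscal c *v (Y *v x)"
  by (simp add: Cscal_vector mvec Jcomm_vector)

lemma bounded_linear_Cscal: "bounded_linear Cscal"
  by (rule linear_conv_bounded_linear[THEN iffD1], rule linearI) (simp_all add: Cscal_def algebra_simps)

lemmas continuous_on_Cscal [continuous_intros] = bounded_linear.continuous_on[OF bounded_linear_Cscal]

text \<open>\<open>crot P \<theta>\<close> multiplies by \<open>exp(i \<theta>)\<close> on the range of the Hermitian projection \<open>P\<close> and is the
  identity on its kernel.\<close>

definition hproj :: "'n::finite smat \<Rightarrow> bool" where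
  "hproj P \<longleftrightarrow> transpose P = P \<and> P ** P = P \<and> Jcomm P"

definition crot :: "'n::finite smat \<Rightarrow> real \<Rightarrow> 'n smat" where
  "crot P \<theta> = mat 1 - P + Cscal (cis \<theta>) ** P"

lemma hproj_vector: "hproj P \<Longrightarrow> P *v (P *v x) = P *v x"
  by (simp add: hproj_def matrix_vector_mul_assoc)

lemma hproj_mat_1 [simp]: "hproj (mat 1)"
  by (simp add: hproj_def)

lemma hproj_complement: "hproj P \<Longrightarrow> hproj (mat 1 - P)"
  by (simp add: hproj_def transpose_simps matrix_mult_distribs Jcomm_def)

lemma crot_vector: "crot P \<theta> *v x = x - P *v x + Cscal (cis \<theta>) *v (P *v x)"
  by (simp add: crot_def mvec)

lemma hproj_crot: "hproj P \<Longrightarrow> P *v (crot P \<theta> *v x) = Cscal (cis \<theta>) *v (P *v x)"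
  by (simp add: crot_vector mvec hproj_vector Jcomm_Cscal_vector hproj_def[of P])

lemma crot_0 [simp]: "crot P 0 = mat 1"
  by (simp add: crot_def)

lemma crot_add: assumes "hproj P" shows "crot P \<theta> ** crot P \<phi> = crot P (\<theta> + \<phi>)"
proof (rule matrix_eqI)
  fix x
  show "(crot P \<theta> ** crot P \<phi>) *v x = crot P (\<theta> + \<phi>) *v x"
    unfolding matrix_mult_vector crot_vector[of P \<theta>] hproj_crot[OF assms] Cscal_mult_vector cis_mult
    by (simp add: crot_vector)
qed

lemma transpose_crot: assumes "hproj P" shows "transpose (crot P \<theta>) = crot P (- \<theta>)"
proof -
  have "transpose P = P" "Jcomm P" using assms by (auto simp: hproj_def)
  then show ?thesis
    by (intro matrix_eqI) (simp add: crot_def transpose_simps mvec transpose_Cscal cis_cnj Jcomm_Cscal_vector)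
qed

lemma crot_Usp: "hproj P \<Longrightarrow> crot P \<theta> \<in> Usp"
  unfolding Usp_def
  by (auto simp: transpose_crot crot_add crot_vector Jcomm_vector mvec hproj_def Jcomm_Cscal[unfolded Jcomm_vector])

lemma crot_Sp: "hproj P \<Longrightarrow> crot P \<theta> \<in> Sp"
  using crot_Usp Usp_subset_Sp by blast

lemma crot_complement: assumes "hproj P" shows "crot (mat 1 - P) \<theta> ** crot P \<theta> = crot (mat 1) \<theta>"
proof (rule matrix_eqI)
  fix x
  show "(crot (mat 1 - P) \<theta> ** crot P \<theta>) *v x = crot (mat 1) \<theta> *v x"
    unfolding matrix_mult_vector crot_vector[of "mat 1 - P"] matrix_mult_diff_vector hproj_crot[OF assms]
    by (simp add: crot_vector mvec)
qed

lemma continuous_on_crot [continuous_intros]: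
  "continuous_on S f \<Longrightarrow> continuous_on S (\<lambda>x. crot P (f x))"
  unfolding crot_def by (intro continuous_intros)

lemma spath_crot: "hproj P \<Longrightarrow> spath (\<lambda>t. crot P (\<alpha> * t))"
  by (auto simp: spath_iff Sp_path_def crot_Sp intro!: continuous_intros)

text \<open>The Hamiltonian is constant, equal to \<open>\<alpha> *\<^sub>R P\<close>.\<close>

lemma pos_path_crot:
  assumes P: "hproj P" and "\<alpha> \<ge> 0"
  shows "pos_path (\<lambda>t. crot P (\<alpha> * t))"
  unfolding pos_path_def
proof (intro conjI exI[of _ "\<lambda>t. Cscal (\<i> * of_real \<alpha> * cis (\<alpha> * t)) ** P"] ballI)
  show "spath (\<lambda>t. crot P (\<alpha> * t))" using P by (rule spath_crot)
  show "continuous_on {0..1} (\<lambda>t. Cscal (\<i> * of_real \<alpha> * cis (\<alpha> * t)) ** P)" by (intro continuous_intros)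
  fix t :: real
  have "((\<lambda>t. cis (\<alpha> * t)) has_vector_derivative (\<i> * of_real \<alpha> * cis (\<alpha> * t))) (at t within {0..1})"
  proof -
    have "((\<lambda>z. exp (\<i> * of_real \<alpha> * z)) has_field_derivative \<i> * of_real \<alpha> * exp (\<i> * of_real \<alpha> * of_real t)) (at (of_real t))"
      by (auto intro!: derivative_eq_intros)
    then have "((\<lambda>t. exp (\<i> * of_real \<alpha> * of_real t)) has_vector_derivative \<i> * of_real \<alpha> * exp (\<i> * of_real \<alpha> * of_real t)) (at t within {0..1})"
      by (rule has_vector_derivative_real_field)
    then show ?thesis by (simp add: cis_conv_exp mult.assoc)
  qed
  then have d: "((\<lambda>t. Cscal (cis (\<alpha> * t))) has_vector_derivative Cscal (\<i> * of_real \<alpha> * cis (\<alpha> * t))) (at t within {0..1})"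
    by (rule bounded_linear.has_vector_derivative[OF bounded_linear_Cscal])
  show "((\<lambda>t. crot P (\<alpha> * t)) has_vector_derivative Cscal (\<i> * of_real \<alpha> * cis (\<alpha> * t)) ** P) (at t within {0..1})"
  proof -
    have "((\<lambda>t. Cscal (cis (\<alpha> * t)) ** P) has_vector_derivative Cscal (\<i> * of_real \<alpha> * cis (\<alpha> * t)) ** P) (at t within {0..1})"
      using bounded_linear.has_vector_derivative[OF bounded_bilinear.bounded_linear_left[OF bounded_bilinear_matrix_mult] d] .
    then show ?thesis unfolding crot_def
      by (subst add.commute) (simp add: has_vector_derivative_add_const)
  qed
  have PP: "P ** P = P" "transpose P = P" using P by (simp_all add: hproj_def)
  have "Cscal (\<i> * of_real \<alpha> * cis (\<alpha> * t)) ** P = Jmat ** (\<alpha> *\<^sub>R P) ** crot P (\<alpha> * t)"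
  proof (rule matrix_eqI)
    fix x
    have "Cscal (\<i> * of_real \<alpha> * cis (\<alpha> * t)) *v y = Jmat *v (\<alpha> *\<^sub>R (Cscal (cis (\<alpha> * t)) *v y))" for y
      by (simp add: Cscal_vector mvec algebra_simps)
    then show "(Cscal (\<i> * of_real \<alpha> * cis (\<alpha> * t)) ** P) *v x = (Jmat ** (\<alpha> *\<^sub>R P) ** crot P (\<alpha> * t)) *v x"
      by (simp add: matrix_mult_vector scaleR_matrix_vector hproj_crot[OF P])
  qed
  moreover have "psd (\<alpha> *\<^sub>R P)"
    unfolding psd_def
  proof
    fix v
    have "v \<bullet> (P *v v) = (P *v v) \<bullet> (P *v v)"
      using inner_transpose[of v P "P *v v"] PP by (simp add: matrix_vector_mul_assoc)
    then show "0 \<le> v \<bullet> ((\<alpha> *\<^sub>R P) *v v)" using assms(2) by (simp add: mvec)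
  qed
  ultimately show "\<exists>H. transpose H = H \<and> psd H \<and> Cscal (\<i> * of_real \<alpha> * cis (\<alpha> * t)) ** P = Jmat ** H ** crot P (\<alpha> * t)"
    using PP by (intro exI[of _ "\<alpha> *\<^sub>R P"]) (simp add: transpose_simps)
qed

lemma crot_mat_1: "crot (mat 1) \<theta> = Cscal (cis \<theta>)"
  by (simp add: crot_def)

lemma maslov_rotation:
  "maslov (\<lambda>t. crot (mat 1 :: 'n::finite smat) (\<alpha> * t)) = real CARD('n) * \<alpha>"
proof -
  have c: "clin (crot (mat 1 :: 'n smat) \<theta>) = exp (\<i> * of_real (real CARD('n) * \<theta>))" for \<theta>
  proof -
    have "cmat (Cscal (cis \<theta>) :: 'n smat) = (\<chi> i j. if i = j then cis \<theta> else 0)"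
      by (simp add: cmat_def Cscal_def vec_eq_iff mat_def Jmat_def complex_eq_iff)
    then have "clin (crot (mat 1 :: 'n smat) \<theta>) = cis \<theta> ^ CARD('n)"
      by (simp add: clin_def crot_mat_1 lin_of_Jcomm Jcomm_Cscal cdet_cmat det_diagonal)
    then show ?thesis by (simp add: cis_conv_exp exp_of_nat_mult[symmetric] mult_ac)
  qed
  have "maslov (\<lambda>t. crot (mat 1 :: 'n smat) (\<alpha> * t))
      = Im ((\<lambda>t. \<i> * of_real (real CARD('n) * (\<alpha> * t))) 1 - (\<lambda>t. \<i> * of_real (real CARD('n) * (\<alpha> * t))) 0)"
    by (rule maslov_eq) (use spath_crot[of "mat 1"] in \<open>auto simp: spath_iff clin_log_def c intro!: continuous_intros\<close>)
  then show ?thesis by simp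
qed

text \<open>The complementary rotation is positive too, and both together form the scalar rotation
  with index \<open>n * \<alpha>\<close>. Up to one defect, neither factor exceeds this; the rank of
  \<open>P\<close> need not be computed.\<close>

lemma maslov_crot_le:
  fixes P :: "'n::finite smat"
  assumes "hproj P" "\<alpha> \<ge> 0"
  shows "maslov (\<lambda>t. crot P (\<alpha> * t)) \<le> real CARD('n) * (\<alpha> + pi)"
proof -
  let ?q = "\<lambda>t. crot P (\<alpha> * t)" and ?r = "\<lambda>t. crot (mat 1 - P) (\<alpha> * t)"
  have "pmult ?r ?q = (\<lambda>t. crot (mat 1) (\<alpha> * t))"
    using assms by (simp add: pmult_def crot_complement)
  moreover have "\<bar>maslov (pmult ?r ?q) - maslov ?r - maslov ?q\<bar> \<le> real CARD('n) * pi"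
    using spath_crot assms(1) hproj_complement by (intro maslov_quasimorphism) (auto simp: spath_iff)
  moreover have "maslov ?r \<ge> 0"
    using assms by (intro pos_path_maslov_nonneg pos_path_crot hproj_complement)
  moreover have "maslov (\<lambda>t. crot (mat 1 :: 'n smat) (\<alpha> * t)) = real CARD('n) * \<alpha>"
    by (rule maslov_rotation)
  ultimately show ?thesis unfolding distrib_left abs_le_iff by simp
qed

text \<open>The inverse path is a positive rotation. Read contrapositively, an index above
  \<open>n * pi\<close> reveals a positive angle.\<close>

lemma maslov_crot_nonpos:
  fixes P :: "'n::finite smat"
  assumes "hproj P" "\<alpha> \<le> 0"
  shows "maslov (\<lambda>t. crot P (\<alpha> * t)) \<le> real CARD('n) * pi"
proof -
  let ?q = "\<lambda>t. crot P (\<alpha> * t)"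
  have "pinv ?q = (\<lambda>t. crot P ((- \<alpha>) * t))"
    using assms(1) by (simp add: pinv_def fun_eq_iff matrix_inv_Usp crot_Usp transpose_crot)
  moreover have "maslov (\<lambda>t. crot P ((- \<alpha>) * t)) \<ge> 0"
    using assms by (intro pos_path_maslov_nonneg pos_path_crot) auto
  ultimately have "maslov (pinv ?q) \<ge> 0" by (simp only:)
  moreover have "\<bar>maslov (pinv ?q) + maslov ?q\<bar> \<le> real CARD('n) * pi"
    using spath_crot[OF assms(1)] by (intro maslov_pinv) (auto simp: spath_iff)
  ultimately show ?thesis by linarith
qed

section \<open>Complex reflections and unitary maps between unit vectors\<close>

definition outer :: "real^'m \<Rightarrow> real^'m \<Rightarrow> real^'m^'m" where
  "outer u v = (\<chi> i j. u $ i * v $ j)"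

lemma outer_vector: "outer u v *v x = (v \<bullet> x) *\<^sub>R u"
  by (simp add: outer_def matrix_vector_mult_def inner_vec_def vec_eq_iff sum_distrib_left mult_ac)

lemma transpose_outer: "transpose (outer u v) = outer v u"
  by (simp add: outer_def vec_eq_iff mult.commute)

lemma continuous_on_outer [continuous_intros]:
  "continuous_on S f \<Longrightarrow> continuous_on S g \<Longrightarrow> continuous_on S (\<lambda>x. outer (f x) (g x))"
  unfolding outer_def by (intro continuous_intros)

text \<open>Up to the factor \<open>v \<bullet> v\<close>, \<open>cline v\<close> projects onto the complex line spanned by \<open>v\<close>.\<close>

definition cline :: "real^('n::finite + 'n) \<Rightarrow> 'n smat" where
  "cline v = outer v v + outer (Jmat *v v) (Jmat *v v)"

lemma cline_vector: "cline v *v x = (v \<bullet> x) *\<^sub>R v + ((Jmat *v v) \<bullet> x) *\<^sub>R (Jmat *v v)"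
  by (simp add: cline_def mvec outer_vector)

lemma cline_Cscal: "cline v *v x = Cscal (Complex (v \<bullet> x) ((Jmat *v v) \<bullet> x)) *v v"
  by (simp add: cline_vector Cscal_vector)

lemma Jcomm_cline: "Jcomm (cline v)"
  by (simp add: Jcomm_vector cline_vector mvec inner_Jmat[of v] inner_Jmat_Jmat)

lemma cline_cline: "cline v *v (cline v *v x) = (v \<bullet> v) *\<^sub>R (cline v *v x)"
  by (simp add: cline_vector inner_add_right inner_commute[of "Jmat *v v" v] algebra_simps)

lemma hproj_cline: "norm v = 1 \<Longrightarrow> hproj (cline v)"
  unfolding hproj_def
  by (intro conjI matrix_eqI Jcomm_cline)
    (simp_all add: cline_def transpose_simps transpose_outer matrix_mult_vector cline_cline[unfolded cline_def] norm_eq_1)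

lemma continuous_on_cline [continuous_intros]:
  "continuous_on S f \<Longrightarrow> continuous_on S (\<lambda>x. cline (f x))"
  unfolding cline_def by (intro continuous_intros)

definition crefl :: "real^('n::finite + 'n) \<Rightarrow> complex \<Rightarrow> 'n smat" where
  "crefl v c = mat 1 - Cscal c ** cline v"

lemma crefl_vector: "crefl v c *v x = x - Cscal c *v (cline v *v x)"
  by (simp add: crefl_def mvec)

lemma crefl_mult: "crefl v c ** crefl v d = crefl v (c + d - of_real (v \<bullet> v) * c * d)"
proof (rule matrix_eqI)
  fix x
  define y where "y = cline v *v x"
  have "(crefl v c ** crefl v d) *v x = x - Cscal d *v y - Cscal c *v (y - Cscal d *v ((v \<bullet> v) *\<^sub>R y))"
    by (simp add: matrix_mult_vector crefl_vector y_def matrix_vector_mult_diff_distrib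
        Jcomm_Cscal_vector[OF Jcomm_cline] cline_cline)
  also have "\<dots> = x - Cscal (c + d - of_real (v \<bullet> v) * c * d) *v y"
    by (simp add: Cscal_vector mvec algebra_simps)
  finally show "(crefl v c ** crefl v d) *v x = crefl v (c + d - of_real (v \<bullet> v) * c * d) *v x"
    by (simp add: crefl_vector y_def)
qed

lemma crefl_0 [simp]: "crefl v 0 = mat 1"
  by (simp add: crefl_def matrix_eq mvec)

lemma Jcomm_crefl: "Jcomm (crefl v c)"
  by (simp add: Jcomm_vector crefl_vector mvec Jcomm_cline[unfolded Jcomm_vector] Jcomm_Cscal[unfolded Jcomm_vector])

lemma transpose_crefl: "transpose (crefl v c) = crefl v (cnj c)"
proof -
  have "transpose (cline v) = cline v" by (simp add: cline_def transpose_simps transpose_outer)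
  then show ?thesis
    by (intro matrix_eqI)
      (simp add: crefl_def transpose_simps mvec transpose_Cscal Jcomm_Cscal_vector[OF Jcomm_cline])
qed

text \<open>The condition states that the parameter of the product of \<open>crefl v (cnj c)\<close>
  and \<open>crefl v c\<close> is zero.\<close>

lemma crefl_Usp:
  assumes "2 * Re c = (v \<bullet> v) * (norm c)\<^sup>2" shows "crefl v c \<in> Usp"
proof -
  have "cnj c + c - of_real (v \<bullet> v) * cnj c * c = 0"
    using assms unfolding cmod_power2 by (simp add: complex_eq_iff power2_eq_square algebra_simps)
  then show ?thesis by (simp add: Usp_def transpose_crefl crefl_mult Jcomm_crefl)
qed

text \<open>A unitary map taking the unit vector \<open>x\<close> to \<open>y\<close>: the reflection sending \<open>x\<close> to \<open>- x\<close> followed by the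
  complex reflection sending \<open>- x\<close> to \<open>y\<close>. Unlike a single reflection from \<open>x\<close> to \<open>y\<close>, it extends
  continuously to \<open>y = x\<close>, and it degenerates only at \<open>y = - x\<close>.\<close>

definition umove :: "real^('n::finite + 'n) \<Rightarrow> real^('n + 'n) \<Rightarrow> 'n smat" where
  "umove x y = crefl (x + y) (1 / Complex (1 + x \<bullet> y) ((Jmat *v y) \<bullet> x)) ** crefl x 2"

lemma unit_inner_gt: 
  fixes x y :: "'a::real_inner"
  assumes "norm x = 1" "norm y = 1" "y \<noteq> - x"
  shows "1 + x \<bullet> y > 0"
proof -
  have "(norm (x + y))\<^sup>2 = 2 * (1 + x \<bullet> y)"
    using assms(1,2) by (simp add: power2_norm_eq_inner inner_add_left inner_add_right inner_commute norm_eq_1)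
  moreover have "x + y \<noteq> 0" using assms(3) by (metis add_eq_0_iff)
  ultimately show ?thesis by (metis zero_less_mult_pos zero_less_numeral zero_less_norm_iff zero_less_power)
qed

lemma
  assumes x: "norm x = 1" and y: "norm y = 1" and ne: "y \<noteq> - x"
  shows umove_Usp: "umove x y \<in> Usp" and umove_vector: "umove x y *v x = y"
proof -
  \<comment> \<open>The number \<open>h\<close> is the Hermitian product of \<open>x + y\<close> and
    \<open>x\<close>. The coefficient \<open>1 / h\<close> is exactly the one with which the
    reflection adds \<open>x + y\<close> to \<open>- x\<close>, and \<open>h\<close> vanishes only
    at \<open>y = - x\<close>.\<close>
  define h where "h = Complex (1 + x \<bullet> y) ((Jmat *v y) \<bullet> x)"
  have xx: "x \<bullet> x = 1" "y \<bullet> y = 1" using x y by (simp_all add: norm_eq_1)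
  have h0: "h \<noteq> 0" using unit_inner_gt[OF x y ne] by (auto simp: h_def complex_eq_iff)
  have "Re (1 / h) = Re h / (norm h)\<^sup>2" by (simp add: Re_divide cmod_power2)
  then have "2 * Re (1 / h) = ((x + y) \<bullet> (x + y)) * (norm (1 / h))\<^sup>2"
    using h0 by (simp add: h_def inner_add_left inner_add_right xx inner_commute[of y x] norm_divide power_divide field_simps)
  then have 1: "crefl (x + y) (1 / h) \<in> Usp" by (rule crefl_Usp)
  have 2: "crefl x 2 \<in> Usp" by (rule crefl_Usp) (simp add: xx)
  show "umove x y \<in> Usp" unfolding umove_def h_def[symmetric] using 1 2 by (rule Usp_mult)
  have "Cscal 2 *v x = 2 *\<^sub>R x" by (simp add: Cscal_vector)
  then have "crefl x 2 *v x = - x"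
    by (simp add: crefl_vector cline_vector xx inner_commute[of "Jmat *v x" x] scaleR_2)
  moreover have "crefl (x + y) (1 / h) *v (- x) = y"
  proof -
    have "Complex ((x + y) \<bullet> (- x)) ((Jmat *v (x + y)) \<bullet> (- x)) = - h"
      by (simp add: h_def complex_eq_iff mvec inner_add_left xx inner_commute[of y x] inner_commute[of "Jmat *v x" x])
    then show ?thesis
      using h0 unfolding crefl_vector cline_Cscal Cscal_mult_vector by (simp add: Cscal_minus_vector)
  qed
  ultimately show "umove x y *v x = y" by (simp add: umove_def h_def[symmetric] matrix_mult_vector)
qed

lemma umove_same: assumes "norm x = 1" shows "umove x x = mat 1"
proof -
  have xx: "x \<bullet> x = 1" using assms by (simp add: norm_eq_1)
  have "1 / Complex 2 0 = of_real (1/2)" by (simp add: complex_eq_iff Re_divide Im_divide)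
  then have "crefl (x + x) (1 / Complex (1 + x \<bullet> x) ((Jmat *v x) \<bullet> x)) = crefl x 2"
    by (intro matrix_eqI) (simp add: xx inner_commute[of "Jmat *v x" x] crefl_vector cline_vector mvec
        Cscal_vector inner_add_left scaleR_add_left[symmetric] scaleR_2[symmetric] algebra_simps)
  then show ?thesis by (simp add: umove_def crefl_mult xx)
qed

lemma crefl_fixes: "v \<bullet> z = 0 \<Longrightarrow> (Jmat *v v) \<bullet> z = 0 \<Longrightarrow> crefl v c *v z = z"
  by (simp add: crefl_vector cline_vector)

lemma umove_fixes:
  assumes "x \<bullet> z = 0" "(Jmat *v x) \<bullet> z = 0" "y \<bullet> z = 0" "(Jmat *v y) \<bullet> z = 0"
  shows "umove x y *v z = z"
  using assms by (simp add: umove_def matrix_mult_vector crefl_fixes mvec inner_add_left)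

lemma continuous_on_umove:
  assumes "continuous_on S f" "continuous_on S g"
    and "\<And>x. x \<in> S \<Longrightarrow> norm (f x) = 1" "\<And>x. x \<in> S \<Longrightarrow> norm (g x) = 1" "\<And>x. x \<in> S \<Longrightarrow> g x \<noteq> - f x"
  shows "continuous_on S (\<lambda>x. umove (f x) (g x))"
proof -
  have "Complex (1 + f x \<bullet> g x) ((Jmat *v g x) \<bullet> f x) \<noteq> 0" if "x \<in> S" for x
    using unit_inner_gt[of "f x" "g x"] assms that by (auto simp: complex_eq_iff)
  then show ?thesis unfolding umove_def crefl_def
    by (intro continuous_intros continuous_on_Complex assms) auto
qed

text \<open>A complex reflection along \<open>x - y\<close> takes \<open>x\<close> to
  \<open>y\<close> when its eigenvalue is \<open>1 - r / h\<close>; this has modulus one since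
  \<open>Re h = r / 2\<close>. Taking its argument in \<open>[0, 2 pi)\<close> makes the rotation
  both positive and bounded, which \<open>umove\<close> does not provide. The orthogonality clause
  keeps coordinates that are already fixed in place.\<close>

lemma crot_moves:
  assumes x: "norm x = 1" and y: "norm y = 1"
  obtains v \<alpha> where "norm v = 1" "0 \<le> \<alpha>" "\<alpha> \<le> 2 * pi" "crot (cline v) \<alpha> *v x = y"
    "\<And>z. x \<bullet> z = 0 \<Longrightarrow> y \<bullet> z = 0 \<Longrightarrow> (Jmat *v x) \<bullet> z = 0 \<Longrightarrow> (Jmat *v y) \<bullet> z = 0 \<Longrightarrow>
       v \<bullet> z = 0 \<and> (Jmat *v v) \<bullet> z = 0"
proof (cases "x = y")
  case True
  then show thesis using x by (intro that[of x 0]) auto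
next
  case False
  define r where "r = norm (x - y)"
  have r: "r > 0" using False by (simp add: r_def)
  define v where "v = (1 / r) *\<^sub>R (x - y)"
  have xx: "x \<bullet> x = 1" "y \<bullet> y = 1" using x y by (simp_all add: norm_eq_1)
  have r2: "r\<^sup>2 = 2 - 2 * (x \<bullet> y)"
    by (simp add: r_def power2_norm_eq_inner inner_diff_left inner_diff_right xx inner_commute[of y x])
  have nv: "norm v = 1" using r by (simp add: v_def r_def)
  define h where "h = Complex (v \<bullet> x) ((Jmat *v v) \<bullet> x)"
  have Reh: "Re h = r / 2"
    using r r2 by (simp add: h_def v_def inner_diff_left xx inner_commute[of y x] power2_eq_square field_simps)
  have h0: "h \<noteq> 0" using Reh r by auto
  have "(norm (1 - of_real r / h))\<^sup>2 = (norm ((h - of_real r) / h))\<^sup>2" using h0 by (simp add: diff_divide_distrib)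
  also have "\<dots> = (norm (h - of_real r))\<^sup>2 / (norm h)\<^sup>2" by (simp add: norm_divide power_divide)
  also have "(norm (h - of_real r))\<^sup>2 = (norm h)\<^sup>2"
    by (simp add: cmod_power2 Reh)
  finally have "(norm (1 - of_real r / h))\<^sup>2 = 1\<^sup>2" using h0 by simp
  then have "norm (1 - of_real r / h) = 1" by (subst (asm) power2_eq_iff_nonneg) auto
  then have e: "1 - of_real r / h = cis (Arg2pi (1 - of_real r / h))"
    using Arg2pi_eq[of "1 - of_real r / h"] by (simp add: cis_conv_exp)
  define \<alpha> where "\<alpha> = Arg2pi (1 - of_real r / h)"
  show thesis
  proof (rule that[of v \<alpha>])
    show "norm v = 1" by fact
    show "0 \<le> \<alpha>" "\<alpha> \<le> 2 * pi" by (auto simp: \<alpha>_def Arg2pi_ge_0 Arg2pi_lt_2pi less_imp_le)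
    have "crot (cline v) \<alpha> *v x = x - Cscal (1 - cis \<alpha>) *v (cline v *v x)"
      by (simp add: crot_vector Cscal_diff_vector)
    also have "1 - cis \<alpha> = of_real r / h" using e unfolding \<alpha>_def by (metis diff_diff_eq2 add_diff_cancel_left')
    also have "Cscal (of_real r / h) *v (cline v *v x) = r *\<^sub>R v"
      using h0 unfolding cline_Cscal Cscal_mult_vector h_def[symmetric] by (simp add: Cscal_vector)
    also have "x - r *\<^sub>R v = y" using r by (simp add: v_def)
    finally show "crot (cline v) \<alpha> *v x = y" .
    fix z assume "x \<bullet> z = 0" "y \<bullet> z = 0" "(Jmat *v x) \<bullet> z = 0" "(Jmat *v y) \<bullet> z = 0"
    then show "v \<bullet> z = 0 \<and> (Jmat *v v) \<bullet> z = 0" by (simp add: v_def mvec inner_diff_left)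
  qed
qed

lemma crot_fixes: "v \<bullet> z = 0 \<Longrightarrow> (Jmat *v v) \<bullet> z = 0 \<Longrightarrow> crot (cline v) \<alpha> *v z = z"
  by (simp add: crot_vector cline_vector)

lemma homotopic_crot:
  assumes P: "hproj P" and \<phi>: "continuous_on {0..1} \<phi>" "\<phi> 0 = 0"
  shows "homotopic_paths Sp (\<lambda>t. crot P (\<phi> t)) (\<lambda>t. crot P (\<phi> 1 * t))"
proof (rule homotopic_Sp_I[where h = "\<lambda>s t. crot P ((1 - s) * \<phi> t + s * (\<phi> 1 * t))"])
  show "continuous_on ({0..1} \<times> {0..1}) (\<lambda>x. crot P ((1 - fst x) * \<phi> (snd x) + fst x * (\<phi> 1 * snd x)))"
    using \<phi>(1) by (intro continuous_intros continuous_on_compose2[OF \<phi>(1)]) auto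
qed (use P \<phi> crot_Sp in \<open>auto simp: algebra_simps\<close>)



subsection \<open>Paths of large Maslov index lie in the cone\<close>

definition csphere :: "'n::finite set \<Rightarrow> (real^('n + 'n)) set" where
  "csphere A = {x. norm x = 1 \<and> (\<forall>a\<in>A. x $ Inl a = 0 \<and> x $ Inr a = 0)}"

text \<open>Complex linearity already determines the images of the vectors
  \<open>axis (Inr a) 1\<close>, so this is the unitary group of the coordinates outside
  \<open>A\<close>, acting on \<open>csphere A\<close>.\<close>

definition Ufix :: "'n::finite set \<Rightarrow> 'n smat set" where
  "Ufix A = {U \<in> Usp. \<forall>a\<in>A. U *v axis (Inl a) 1 = axis (Inl a) 1}"

lemma Jmat_axis: "Jmat *v axis (Inl a) 1 = (axis (Inr a) 1 :: real^('n::finite + 'n))"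
  by (simp add: vec_eq_Plus_iff axis_def)

lemma Ufix_empty [simp]: "Ufix {} = Usp" by (simp add: Ufix_def)

lemma Ufix_subset_Sp: "Ufix A \<subseteq> Sp" using Usp_subset_Sp by (auto simp: Ufix_def)

lemma Ufix_Sp: "U \<in> Ufix A \<Longrightarrow> U \<in> Sp" using Ufix_subset_Sp by blast

lemma Ufix_mult: "U \<in> Ufix A \<Longrightarrow> V \<in> Ufix A \<Longrightarrow> U ** V \<in> Ufix A"
  by (simp add: Ufix_def Usp_mult matrix_mult_vector)

lemma Usp_transpose_vector: "U \<in> Usp \<Longrightarrow> U *v x = y \<Longrightarrow> transpose U *v y = x"
  using Usp_inverse(1)[of U] by (metis matrix_vector_mul_assoc matrix_vector_mul_lid)

lemma Ufix_transpose: "U \<in> Ufix A \<Longrightarrow> transpose U \<in> Ufix A"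
  by (auto simp: Ufix_def Usp_transpose intro: Usp_transpose_vector)

lemma csphere_orthogonal:
  assumes "x \<in> csphere A" "a \<in> A"
  shows "x \<bullet> axis (Inl a) 1 = 0" "(Jmat *v x) \<bullet> axis (Inl a) 1 = 0"
  using assms by (simp_all add: csphere_def inner_axis)

lemma Ufix_csphere:
  assumes U: "U \<in> Ufix A" and x: "x \<in> csphere A" shows "U *v x \<in> csphere A"
proof -
  have Usp: "U \<in> Usp" using U by (simp add: Ufix_def)
  have "(U *v x) $ Inl a = 0 \<and> (U *v x) $ Inr a = 0" if a: "a \<in> A" for a
  proof -
    have fix1: "U *v axis (Inl a) 1 = axis (Inl a) 1" using U a by (simp add: Ufix_def)
    have fix2: "U *v axis (Inr a) 1 = axis (Inr a) 1"
      unfolding Jmat_axis[symmetric] using Usp fix1 by (simp add: Usp_def Jcomm_vector)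
    have "(U *v x) $ Inl a = (U *v x) \<bullet> (U *v axis (Inl a) 1)" unfolding fix1 by (simp add: inner_axis)
    also have "\<dots> = x $ Inl a" by (simp add: Usp_inner Usp inner_axis)
    moreover have "(U *v x) $ Inr a = (U *v x) \<bullet> (U *v axis (Inr a) 1)" unfolding fix2 by (simp add: inner_axis)
    moreover have "\<dots> = x $ Inr a" by (simp add: Usp_inner Usp inner_axis)
    ultimately show ?thesis using x a by (simp add: csphere_def)
  qed
  then show ?thesis using x Usp by (simp add: csphere_def Usp_norm)
qed

lemma umove_Ufix:
  assumes "x \<in> csphere A" "y \<in> csphere A" "y \<noteq> - x"
  shows "umove x y \<in> Ufix A"
  using assms unfolding Ufix_def
  by (auto intro!: umove_Usp umove_fixes csphere_orthogonal) (auto simp: csphere_def)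

lemma axis_csphere: "b \<notin> A \<Longrightarrow> axis (Inl b) 1 \<in> csphere A"
  by (auto simp: csphere_def axis_def norm_axis_1[unfolded axis_def])

text \<open>Two free complex coordinates give a unit sphere in a real space of dimension at least 4.
  One coordinate would leave a circle, which is why the last coordinate is treated
  separately.\<close>

lemma simply_connected_csphere:
  fixes A :: "'n::finite set"
  assumes "card (- A) \<ge> 2"
  shows "simply_connected (csphere A)"
proof -
  define D where "D = Inl ` (- A) \<union> Inr ` (- A)"
  define V where "V = {x :: real^('n+'n). \<forall>i. i \<notin> D \<longrightarrow> x $ i = 0}"
  have V: "subspace V" by (auto simp: V_def subspace_def)
  have "card D = 2 * card (- A)"
    unfolding D_def by (subst card_Un_disjoint) (auto simp: card_image)
  moreover have "dim V = card D" unfolding V_def by (rule dim_substandard_cart[where 'a = real, unfolded dim_vec_eq])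
  ultimately have dim: "dim V \<ge> 4" using assms by simp
  have V0: "0 \<in> V" by (simp add: V_def)
  have cs: "csphere A = sphere 0 1 \<inter> V"
  proof -
    have "(\<forall>a\<in>A. x $ Inl a = 0 \<and> x $ Inr a = 0) \<longleftrightarrow> x \<in> V" for x
    proof
      assume x: "\<forall>a\<in>A. x $ Inl a = 0 \<and> x $ Inr a = 0"
      show "x \<in> V" unfolding V_def
      proof (intro CollectI allI impI)
        fix i assume "i \<notin> D"
        then show "x $ i = 0" using x by (cases i) (auto simp: D_def)
      qed
    qed (auto simp: V_def D_def)
    then show ?thesis by (auto simp: csphere_def)
  qed
  have ne: "ball 0 1 \<inter> V \<noteq> {}" using V0 centre_in_ball[of 0 1] zero_less_one by blast
  have "rel_frontier (cball 0 1 \<inter> V) = frontier (cball 0 1) \<inter> V"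
    using ne by (intro convex_affine_rel_frontier_Int) (simp_all add: V subspace_imp_affine)
  then have "csphere A = rel_frontier (cball 0 1 \<inter> V)" by (simp add: cs)
  moreover have "aff_dim (cball 0 1 \<inter> V) = aff_dim V"
    using aff_dim_convex_Int_nonempty_interior[of V "cball 0 1"] ne subspace_imp_convex[OF V] by (simp add: Int_commute)
  ultimately show ?thesis
    using dim by (auto intro!: simply_connected_sphere_gen convex_Int bounded_Int simp: subspace_imp_convex V aff_dim_subspace)
qed

text \<open>Homotopy lifting for the orbit map \<open>U \<mapsto> U x\<close>: along a homotopy step short enough to avoid antipodal
  points, multiply by the unitary map \<open>umove\<close> from the old to the new position.\<close>

lemma unitary_path_lift:
  fixes u :: "real \<Rightarrow> 'n::finite smat"
  assumes u: "continuous_on {0..1} u" "\<And>t. t \<in> {0..1} \<Longrightarrow> u t \<in> Ufix A" "u 0 = mat 1"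
    and hom: "homotopic_paths (csphere A) (\<lambda>t. u t *v x) w"
  obtains u' where "continuous_on {0..1} u'" "\<forall>t\<in>{0..1}. u' t \<in> Ufix A" "u' 0 = mat 1"
    "\<forall>t\<in>{0..1}. u' t *v x = w t" "homotopic_paths Sp u u'"
proof -
  obtain h where h: "continuous_on ({0..1} \<times> {0..1}) h" "h \<in> ({0..1} \<times> {0..1}) \<rightarrow> csphere A"
    "\<And>t. t \<in> {0..1} \<Longrightarrow> h (0, t) = u t *v x" "\<And>t. t \<in> {0..1} \<Longrightarrow> h (1, t) = w t"
    and he: "\<forall>t\<in>{0..1::real}. pathstart (h \<circ> Pair t) = pathstart (\<lambda>t. u t *v x) \<and> pathfinish (h \<circ> Pair t) = pathfinish (\<lambda>t. u t *v x)"
    using hom unfolding homotopic_paths by blast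
  have h0: "h (s, 0) = u 0 *v x" and h1: "h (s, 1) = u 1 *v x" if "s \<in> {0..1}" for s :: real
    using he that by (auto simp: pathstart_def pathfinish_def)
  have hc: "h (s, t) \<in> csphere A" if "s \<in> {0..1}" "t \<in> {0..1}" for s t using h(2) that by auto
  have hn: "norm (h (s, t)) = 1" if "s \<in> {0..1}" "t \<in> {0..1}" for s t using hc[OF that] by (simp add: csphere_def)
  \<comment> \<open>Antipodal unit vectors have distance 2, so uniform continuity with tolerance 2
    gives a step length for which \<open>umove\<close> is defined.\<close>
  have "uniformly_continuous_on ({0..1} \<times> {0..1}) h"
    by (intro compact_uniformly_continuous h(1) compact_Times) auto
  then obtain d where d: "d > 0" "\<And>x y. x \<in> {0..1} \<times> {0..1} \<Longrightarrow> y \<in> {0..1} \<times> {0..1} \<Longrightarrow> dist y x < d \<Longrightarrow> dist (h y) (h x) < 2"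
    unfolding uniformly_continuous_on_def by (metis zero_less_numeral)
  obtain N :: nat where N: "N > 0" "1 / real N < d" using d(1) by (metis nat_approx_posE of_nat_Suc zero_less_Suc)
  have na: "h (s', t) \<noteq> - h (s, t)" if "s \<in> {0..1}" "s' \<in> {0..1}" "t \<in> {0..1}" "\<bar>s' - s\<bar> \<le> 1 / real N" for s s' t
  proof
    assume eq: "h (s', t) = - h (s, t)"
    have "dist (s', t) (s, t) < d" using that N by (simp add: dist_Pair_Pair dist_real_def)
    then have "dist (h (s', t)) (h (s, t)) < 2" using that by (intro d(2)) auto
    moreover have "dist (h (s', t)) (h (s, t)) = norm (2 *\<^sub>R h (s, t))"
      unfolding eq by (simp add: dist_norm scaleR_2 norm_minus_commute[of _ "h (s, t)"])
    ultimately show False using hn[of s t] that by simp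
  qed
  have "\<exists>v. continuous_on {0..1} v \<and> (\<forall>t\<in>{0..1}. v t \<in> Ufix A) \<and> v 0 = mat 1 \<and>
      (\<forall>t\<in>{0..1}. v t *v x = h (real i / real N, t)) \<and> homotopic_paths Sp u v" if "i \<le> N" for i
    using that
  proof (induction i)
    case 0
    have "homotopic_paths Sp u u"
      using u(1) Ufix_Sp[OF u(2)] by (intro homotopic_Sp_eq) (auto simp: Sp_path_def)
    then show ?case using u h(3) by (intro exI[of _ u]) auto
  next
    case (Suc i)
    then obtain v where v: "continuous_on {0..1} v" "\<And>t. t \<in> {0..1} \<Longrightarrow> v t \<in> Ufix A" "v 0 = mat 1"
      "\<And>t. t \<in> {0..1} \<Longrightarrow> v t *v x = h (real i / real N, t)" "homotopic_paths Sp u v" by auto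
    define \<sigma> where "\<sigma> s = (real i + s) / real N" for s
    have \<sigma>: "\<sigma> s \<in> {0..1}" "\<bar>\<sigma> s - \<sigma> 0\<bar> \<le> 1 / real N" if "s \<in> {0..1}" for s
    proof -
      have "real i + s \<le> real N" using Suc.prems that by (simp flip: of_nat_Suc)
      then show "\<sigma> s \<in> {0..1}" using that N by (simp add: \<sigma>_def)
      show "\<bar>\<sigma> s - \<sigma> 0\<bar> \<le> 1 / real N" using that N by (simp add: \<sigma>_def diff_divide_distrib[symmetric] divide_right_mono)
    qed
    define H where "H s t = umove (h (\<sigma> 0, t)) (h (\<sigma> s, t)) ** v t" for s t
    have HU: "H s t \<in> Ufix A" if "s \<in> {0..1}" "t \<in> {0..1}" for s t
      unfolding H_def using that \<sigma>[of s] \<sigma>[of 0] na[of "\<sigma> 0" "\<sigma> s" t]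
      by (intro Ufix_mult umove_Ufix hc v) auto
    have Hx: "H s t *v x = h (\<sigma> s, t)" if "s \<in> {0..1}" "t \<in> {0..1}" for s t
    proof -
      have "v t *v x = h (\<sigma> 0, t)" using v(4)[OF that(2)] by (simp add: \<sigma>_def)
      then have "H s t *v x = umove (h (\<sigma> 0, t)) (h (\<sigma> s, t)) *v h (\<sigma> 0, t)"
        by (simp add: H_def matrix_mult_vector)
      also have "\<dots> = h (\<sigma> s, t)"
        using that \<sigma>[of s] \<sigma>[of 0] na[of "\<sigma> 0" "\<sigma> s" t] by (intro umove_vector hn) auto
      finally show ?thesis .
    qed
    have c\<sigma>: "continuous_on T \<sigma>" for T unfolding \<sigma>_def by (intro continuous_intros) (use N in auto)
    have ch: "continuous_on ({0..1} \<times> {0..1}) (\<lambda>y::real\<times>real. h (\<sigma> (f (fst y)), snd y))"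
      if "continuous_on {0..1} f" "f ` {0..1} \<subseteq> {0..1}" for f
      by (rule continuous_on_compose2[OF h(1)])
        (use that \<sigma> in \<open>auto intro!: continuous_intros continuous_on_compose2[OF c\<sigma>] continuous_on_compose2[OF that(1)]\<close>)
    have cH: "continuous_on ({0..1} \<times> {0..1}) (\<lambda>y. H (fst y) (snd y))"
      unfolding H_def
    proof (intro continuous_on_matrix_mult continuous_on_umove)
      show "continuous_on ({0..1} \<times> {0..1}) (\<lambda>y::real\<times>real. h (\<sigma> 0, snd y))"
        using ch[of "\<lambda>_. 0"] by (simp add: image_subset_iff)
      show "continuous_on ({0..1} \<times> {0..1}) (\<lambda>y::real\<times>real. h (\<sigma> (fst y), snd y))"
        using ch[of "\<lambda>s. s"] by simp
      show "continuous_on ({0..1} \<times> {0..1}) (\<lambda>y::real\<times>real. v (snd y))"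
        by (rule continuous_on_compose2[OF v(1)]) (auto intro!: continuous_intros)
      fix y :: "real \<times> real" assume y: "y \<in> {0..1} \<times> {0..1}"
      then have f: "fst y \<in> {0..1}" "snd y \<in> {0..1}" by auto
      show "norm (h (\<sigma> 0, snd y)) = 1" "norm (h (\<sigma> (fst y), snd y)) = 1"
        using f \<sigma>[of 0] \<sigma>[of "fst y"] by (auto intro!: hn)
      show "h (\<sigma> (fst y), snd y) \<noteq> - h (\<sigma> 0, snd y)"
        using f \<sigma>[of 0] \<sigma>[of "fst y"] na[of "\<sigma> 0" "\<sigma> (fst y)" "snd y"] by auto
    qed
    have H0: "H 0 t = v t" if "t \<in> {0..1}" for t
      using that \<sigma>[of 0] by (simp add: H_def umove_same hn)
    \<comment> \<open>At the ends of the paths \<open>h\<close> does not depend on \<open>s\<close>,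
      so \<open>umove\<close> is the identity there and the end points stay fixed.\<close>
    have He: "H s t = v t" if "s \<in> {0..1}" "t = 0 \<or> t = 1" for s t
      using that \<sigma>[of s] \<sigma>[of 0] h0 h1 hn[of "\<sigma> 0" t] by (auto simp: H_def umove_same)
    have "homotopic_paths Sp v (H 1)"
      by (rule homotopic_Sp_I[where h = H]) (use cH H0 He Ufix_Sp[OF HU] in auto)
    then have "homotopic_paths Sp u (H 1)" using v(5) homotopic_paths_trans by blast
    moreover have "continuous_on {0..1} (H 1)"
      using continuous_on_square_row[OF cH, of 1] by simp
    moreover have "\<sigma> 1 = real (Suc i) / real N" by (simp add: \<sigma>_def)
    ultimately show ?case
      using HU[of 1] Hx[of 1] He[of 1 0] v(3) by (intro exI[of _ "H 1"]) auto
  qed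
  from this[of N] obtain v where "continuous_on {0..1} v" "\<forall>t\<in>{0..1}. v t \<in> Ufix A" "v 0 = mat 1"
      "\<forall>t\<in>{0..1}. v t *v x = h (real N / real N, t)" "homotopic_paths Sp u v" by auto
  then show thesis using N h(4) by (intro that[of v]) auto
qed

lemma Jcomm_eqI:
  fixes U V :: "'n::finite smat"
  assumes "Jcomm U" "Jcomm V" "\<And>a. U *v axis (Inl a) 1 = V *v axis (Inl a) 1"
  shows "U = V"
proof -
  have "U *v axis (Inr a) 1 = V *v axis (Inr a) 1" for a
    unfolding Jmat_axis[symmetric] using assms by (simp add: Jcomm_vector)
  then have "U *v axis k 1 = V *v axis k 1" for k using assms(3) by (cases k) auto
  then have "column k U = column k V" for k by (simp add: matrix_vector_mult_basis)
  then show ?thesis by (simp add: column_def vec_eq_iff)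
qed

text \<open>With one free coordinate left, \<open>u t\<close> is multiplication by a unit complex
  number on one line. Lifting it to an angle makes the path homotopic to a uniform rotation, and the
  lower bound on the index excludes a negative total angle.\<close>

lemma unitary_path_last_coordinate:
  fixes u :: "real \<Rightarrow> 'n::finite smat"
  assumes A: "- A = {b}"
    and u: "continuous_on {0..1} u" "\<And>t. t \<in> {0..1} \<Longrightarrow> u t \<in> Ufix A" "u 0 = mat 1"
    and m: "maslov u > real CARD('n) * pi"
  shows "\<exists>q. pos_path q \<and> homotopic_paths Sp u q"
proof -
  define e where "e = (axis (Inl b) 1 :: real^('n+'n))"
  have eS: "e \<in> csphere A" unfolding e_def using A by (intro axis_csphere) auto
  then have ne: "norm e = 1" by (simp add: csphere_def)
  have ee: "e \<bullet> e = 1" using ne by (simp add: norm_eq_1)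
  define z where "z t = Complex ((u t *v e) $ Inl b) ((u t *v e) $ Inr b)" for t
  have ue: "u t *v e = Re (z t) *\<^sub>R e + Im (z t) *\<^sub>R (Jmat *v e)" and nz: "norm (z t) = 1" if t: "t \<in> {0..1}" for t
  proof -
    have S: "u t *v e \<in> csphere A" using u(2)[OF t] eS by (rule Ufix_csphere)
    show eq: "u t *v e = Re (z t) *\<^sub>R e + Im (z t) *\<^sub>R (Jmat *v e)"
      unfolding vec_eq_Plus_iff
    proof (intro conjI allI)
      fix a
      show "(u t *v e) $ Inl a = (Re (z t) *\<^sub>R e + Im (z t) *\<^sub>R (Jmat *v e)) $ Inl a"
        "(u t *v e) $ Inr a = (Re (z t) *\<^sub>R e + Im (z t) *\<^sub>R (Jmat *v e)) $ Inr a"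
        using S A by (cases "a = b"; force simp: csphere_def z_def e_def axis_def)+
    qed
    have "norm (u t *v e) = 1" using S by (simp add: csphere_def)
    then have "(u t *v e) \<bullet> (u t *v e) = 1" by (simp add: norm_eq_1)
    then have "(Re (z t))\<^sup>2 + (Im (z t))\<^sup>2 = 1"
      unfolding eq by (simp add: inner_add_left inner_add_right ee inner_commute[of "Jmat *v e" e] power2_eq_square)
    then show "norm (z t) = 1" by (simp add: cmod_def)
  qed
  have "continuous_on {0..1} z" unfolding z_def by (intro continuous_on_Complex continuous_intros u)
  then obtain L where L: "continuous_on {0..1} L" "\<forall>t\<in>{0..1}. exp (L t) = z t"
    using continuous_log_interval[of z] nz by (metis norm_zero zero_neq_one)
  define \<phi> where "\<phi> t = Im (L t - L 0)" for t
  have z0: "z 0 = 1" using u(3) by (simp add: z_def e_def axis_def complex_eq_iff)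
  have cis: "cis (\<phi> t) = z t" if t: "t \<in> {0..1}" for t
  proof -
    have "exp (Re (L t)) = 1" "exp (Re (L 0)) = 1"
      using L(2) nz t norm_exp_eq_Re by (metis, metis atLeastAtMost_iff order_refl zero_le_one)
    then have "L t - L 0 = \<i> * of_real (\<phi> t)" by (simp add: complex_eq_iff \<phi>_def)
    then have "cis (\<phi> t) = exp (L t - L 0)" by (simp add: cis_conv_exp)
    also have "\<dots> = z t" using L(2) t z0 by (simp add: exp_diff)
    finally show ?thesis .
  qed
  have hp: "hproj (cline e)" using ne by (rule hproj_cline)
  have u_eq: "u t = crot (cline e) (\<phi> t)" if t: "t \<in> {0..1}" for t
  proof (rule Jcomm_eqI)
    show "Jcomm (u t)" using u(2)[OF t] by (simp add: Ufix_def Usp_def)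
    show "Jcomm (crot (cline e) (\<phi> t))" using crot_Usp[OF hp] by (simp add: Usp_def)
    fix a
    show "u t *v axis (Inl a) 1 = crot (cline e) (\<phi> t) *v axis (Inl a) 1"
    proof (cases "a = b")
      case True
      have "cline e *v e = e" by (simp add: cline_vector ee inner_commute[of "Jmat *v e" e])
      then have "crot (cline e) (\<phi> t) *v e = u t *v e"
        by (simp add: crot_vector cis[OF t] ue[OF t] Cscal_vector)
      then show ?thesis using True by (simp add: e_def)
    next
      case False
      then have "a \<in> A" using A by auto
      then show ?thesis using u(2)[OF t] csphere_orthogonal[OF eS] by (simp add: Ufix_def crot_fixes)
    qed
  qed
  have "continuous_on {0..1} \<phi>" unfolding \<phi>_def by (intro continuous_intros L)
  then have "homotopic_paths Sp (\<lambda>t. crot (cline e) (\<phi> t)) (\<lambda>t. crot (cline e) (\<phi> 1 * t))"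
    by (rule homotopic_crot[OF hp]) (simp add: \<phi>_def)
  moreover have "homotopic_paths Sp u (\<lambda>t. crot (cline e) (\<phi> t))"
    using u(1) Ufix_Sp[OF u(2)] by (intro homotopic_Sp_eq u_eq) (auto simp: Sp_path_def)
  ultimately have hom: "homotopic_paths Sp u (\<lambda>t. crot (cline e) (\<phi> 1 * t))"
    using homotopic_paths_trans by blast
  have "\<phi> 1 \<ge> 0"
    using m maslov_homotopic[OF hom] maslov_crot_nonpos[OF hp, of "\<phi> 1"] by linarith
  then show ?thesis using hom pos_path_crot[OF hp] by blast
qed

text \<open>Induction on the number of coordinates that are not fixed yet: since the sphere is simply connected,
  a unitary path can be deformed so that it moves the next basis vector like a complex rotation does,
  and the remaining factor fixes that vector as well.\<close>

lemma unitary_path_cone: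
  fixes u :: "real \<Rightarrow> 'n::finite smat"
  assumes "card (- A) = Suc m"
    and u: "continuous_on {0..1} u" "\<And>t. t \<in> {0..1} \<Longrightarrow> u t \<in> Ufix A" "u 0 = mat 1"
    and "maslov u \<ge> 4 * real CARD('n) * pi * real (Suc m)"
  shows "\<exists>q. pos_path q \<and> homotopic_paths Sp u q"
  using assms
proof (induction m arbitrary: A u)
  case 0
  then obtain b where "- A = {b}" by (metis One_nat_def card_1_singletonE)
  moreover have "real CARD('n) * pi > 0" by simp
  moreover have "4 * (real CARD('n) * pi) \<le> maslov u" using 0(5) by (simp add: mult.assoc)
  ultimately have "real CARD('n) * pi < maslov u" by linarith
  then show ?case using \<open>- A = {b}\<close> 0(2-4) unitary_path_last_coordinate by blast
next
  case (Suc m)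
  then obtain b where b: "b \<notin> A" by (metis Compl_iff card.empty ex_in_conv nat.distinct(1))
  define e where "e = (axis (Inl b) 1 :: real^('n+'n))"
  have e: "e \<in> csphere A" unfolding e_def using b by (rule axis_csphere)
  have u1: "u 1 *v e \<in> csphere A" using Suc.prems(3)[of 1] e by (intro Ufix_csphere) auto
  obtain v \<alpha> where v: "norm v = 1" "0 \<le> \<alpha>" "\<alpha> \<le> 2 * pi" "crot (cline v) \<alpha> *v e = u 1 *v e"
    and orth: "\<And>z. e \<bullet> z = 0 \<Longrightarrow> (u 1 *v e) \<bullet> z = 0 \<Longrightarrow> (Jmat *v e) \<bullet> z = 0 \<Longrightarrow> (Jmat *v (u 1 *v e)) \<bullet> z = 0 \<Longrightarrow>
       v \<bullet> z = 0 \<and> (Jmat *v v) \<bullet> z = 0"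
    using crot_moves[of e "u 1 *v e"] e u1 unfolding csphere_def by blast
  have hp: "hproj (cline v)" using v(1) by (rule hproj_cline)
  define q where "q t = crot (cline v) (\<alpha> * t)" for t
  have qU: "q t \<in> Ufix A" for t
    unfolding Ufix_def q_def using orth csphere_orthogonal[OF e] csphere_orthogonal[OF u1]
    by (auto intro!: crot_Usp hp crot_fixes)
  have q0: "q 0 = mat 1" by (simp add: q_def)
  have qc: "continuous_on {0..1} q" unfolding q_def by (intro continuous_intros)
  have path1: "path (\<lambda>t. u t *v e)" "path_image (\<lambda>t. u t *v e) \<subseteq> csphere A"
    unfolding path_def path_image_def using Suc.prems(2) Ufix_csphere[OF Suc.prems(3) e] by (auto intro!: continuous_intros)
  have path2: "path (\<lambda>t. q t *v e)" "path_image (\<lambda>t. q t *v e) \<subseteq> csphere A"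
    unfolding path_def path_image_def using qc Ufix_csphere[OF qU e] by (auto intro!: continuous_intros)
  have "homotopic_paths (csphere A) (\<lambda>t. u t *v e) (\<lambda>t. q t *v e)"
  proof -
    have "simply_connected (csphere A)" using Suc.prems(1) by (intro simply_connected_csphere) simp
    moreover have "pathstart (\<lambda>t. q t *v e) = pathstart (\<lambda>t. u t *v e)"
      by (simp add: pathstart_def q0 Suc.prems(4))
    moreover have "pathfinish (\<lambda>t. q t *v e) = pathfinish (\<lambda>t. u t *v e)"
      using v(4) by (simp add: pathfinish_def q_def)
    ultimately show ?thesis using path1 path2 unfolding simply_connected_eq_homotopic_paths by metis
  qed
  from unitary_path_lift[OF Suc.prems(2,3,4) this] obtain u' where u': "continuous_on {0..1} u'"
    "\<forall>t\<in>{0..1}. u' t \<in> Ufix A" "u' 0 = mat 1"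
    "\<forall>t\<in>{0..1}. u' t *v e = q t *v e" "homotopic_paths Sp u u'" .
  define w where "w t = transpose (q t) ** u' t" for t
  have qUsp: "q t \<in> Usp" for t using qU by (simp add: Ufix_def)
  have w: "continuous_on {0..1} w" "w 0 = mat 1"
    unfolding w_def using qc u' q0 by (auto intro!: continuous_intros)
  have wU: "w t \<in> Ufix (insert b A)" if t: "t \<in> {0..1}" for t
  proof -
    have "w t \<in> Ufix A" unfolding w_def using qU bspec[OF u'(2) t] by (intro Ufix_mult Ufix_transpose)
    moreover have "w t *v e = e"
      unfolding w_def matrix_mult_vector bspec[OF u'(4) t] by (rule Usp_transpose_vector[OF qUsp refl])
    ultimately show ?thesis by (auto simp: Ufix_def e_def)
  qed
  have qw: "pmult q w = u'"
    by (simp add: pmult_def w_def fun_eq_iff matrix_mul_assoc Usp_inverse qUsp)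
  have Sp_q: "Sp_path q" and Sp_w: "Sp_path w"
    using qc Ufix_Sp[OF qU] w Ufix_Sp[OF wU] by (auto simp: Sp_path_def)
  \<comment> \<open>The rotation has index at most \<open>3 n pi\<close> and splitting it off costs
    one defect: this is the \<open>4 n pi\<close> allotted to each coordinate.\<close>
  have "maslov u' \<le> maslov q + maslov w + real CARD('n) * pi"
    using maslov_quasimorphism[OF Sp_q Sp_w] unfolding qw by linarith
  moreover have "maslov q \<le> real CARD('n) * (2 * pi + pi)"
    unfolding q_def using v(2,3) by (intro order.trans[OF maslov_crot_le[OF hp]] mult_left_mono) auto
  moreover have "maslov u' = maslov u" using maslov_homotopic[OF u'(5)] by simp
  ultimately have mw: "maslov w \<ge> 4 * real CARD('n) * pi * real (Suc m)"
    using Suc.prems(5) by (simp add: algebra_simps)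
  have "card (- insert b A) = Suc m"
  proof -
    have "- insert b A = - A - {b}" by auto
    then show ?thesis using Suc.prems(1) b by simp
  qed
  then obtain r where r: "pos_path r" "homotopic_paths Sp w r"
    using Suc.IH[OF _ w(1) wU w(2) mw] by blast
  have "pos_path q" unfolding q_def using hp v(2) by (rule pos_path_crot)
  moreover have "homotopic_paths Sp u' (pmult q r)"
    unfolding qw[symmetric] using r(2) homotopic_Sp_eq[OF Sp_q, of q] by (intro homotopic_pmult) auto
  then have "homotopic_paths Sp u (pmult q r)" using u'(5) homotopic_paths_trans by blast
  ultimately show ?case using r(1) pos_path_pmult by blast
qed

text \<open>The Cayley transform \<open>(P - 1) (P + 1)\<^sup>-\<^sup>1\<close> linearizes the positive symplectic matrices;
  scaling it by \<open>s\<close> gives \<open>cayley s P\<close>.\<close>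

definition cayley :: "real \<Rightarrow> 'n::finite smat \<Rightarrow> 'n smat" where
  "cayley s P = ((1 + s) *\<^sub>R P + (1 - s) *\<^sub>R mat 1) ** matrix_inv ((1 - s) *\<^sub>R P + (1 + s) *\<^sub>R mat 1)"

lemma cayley_denominator:
  fixes P :: "'n::finite smat"
  assumes "spd P" "s \<in> {0..1}"
  shows "spd ((1 - s) *\<^sub>R P + (1 + s) *\<^sub>R mat 1)"
  unfolding spd_def
proof (intro conjI allI impI)
  show "transpose ((1 - s) *\<^sub>R P + (1 + s) *\<^sub>R mat 1) = (1 - s) *\<^sub>R P + (1 + s) *\<^sub>R mat 1"
    using assms by (simp add: transpose_simps spd_def)
  fix v :: "real^('n+'n)" assume v: "v \<noteq> 0"
  then have "v \<bullet> (P *v v) > 0" "v \<bullet> v > 0" using assms by (auto simp: spd_def)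
  then show "0 < v \<bullet> (((1 - s) *\<^sub>R P + (1 + s) *\<^sub>R mat 1) *v v)"
    using assms(2) by (simp add: mvec inner_add_right add_nonneg_pos)
qed

text \<open>Write \<open>?A\<close>, \<open>?B\<close> for numerator and denominator;
  \<open>?B\<close> is \<open>?A\<close> with \<open>s\<close> replaced by \<open>- s\<close>. Since
  \<open>P J P = J\<close>, expanding \<open>?A J ?A\<close> leaves an expression even in
  \<open>s\<close>, so it coincides with \<open>?B J ?B\<close>.\<close>

lemma cayley_Sp:
  assumes P: "spd P" "P \<in> Sp" and s: "s \<in> {0..1}"
  shows "cayley s P \<in> Sp"
proof -
  let ?A = "(1 + s) *\<^sub>R P + (1 - s) *\<^sub>R mat 1" and ?B = "(1 - s) *\<^sub>R P + (1 + s) *\<^sub>R mat 1"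
  define R where "R = matrix_inv ?B"
  have R: "?B ** R = mat 1" "R ** ?B = mat 1"
    using spd_invertible[OF cayley_denominator[OF P(1) s]] by (simp_all add: R_def matrix_inv_right matrix_inv_left)
  have RT: "transpose R = R" using spd_matrix_inv[OF cayley_denominator[OF P(1) s]] by (simp add: R_def spd_def)
  have PT: "transpose P = P" using P(1) by (simp add: spd_def)
  then have PJ: "P ** (Jmat ** P) = Jmat" using P(2) by (simp add: Sp_iff)
  have "?A ** (Jmat ** ?A) = ?B ** (Jmat ** ?B)"
    by (simp add: matrix_mult_distribs PJ algebra_simps)
  then have "R ** (?A ** (Jmat ** ?A)) ** R = (R ** ?B) ** Jmat ** (?B ** R)"
    by (simp only: matrix_mul_assoc)
  then have "R ** (?A ** (Jmat ** ?A)) ** R = Jmat" by (simp add: R)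
  then show ?thesis
    unfolding cayley_def R_def[symmetric] Sp_iff by (simp add: transpose_simps RT PT matrix_mul_assoc)
qed

lemma cayley_0: "spd P \<Longrightarrow> cayley 0 P = mat 1"
  using spd_invertible[OF cayley_denominator[of P 0]] by (simp add: cayley_def matrix_inv_right)

lemma cayley_1: "cayley 1 P = P"
proof -
  have "matrix_inv (2 *\<^sub>R mat 1 :: 'a smat) = (1/2) *\<^sub>R mat 1"
    by (rule matrix_inv_unique) (simp add: matrix_mult_distribs)
  then show ?thesis by (simp add: cayley_def matrix_mult_distribs)
qed

lemma cayley_mat_1: "s \<in> {0..1} \<Longrightarrow> cayley s (mat 1) = mat 1"
proof -
  have "matrix_inv (2 *\<^sub>R mat 1 :: 'a smat) = (1/2) *\<^sub>R mat 1"
    by (rule matrix_inv_unique) (simp add: matrix_mult_distribs)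
  moreover have "(1 + s) *\<^sub>R mat 1 + (1 - s) *\<^sub>R mat 1 = (2 *\<^sub>R mat 1 :: 'a smat)"
    "(1 - s) *\<^sub>R mat 1 + (1 + s) *\<^sub>R mat 1 = (2 *\<^sub>R mat 1 :: 'a smat)"
    by (simp_all flip: scaleR_add_left)
  ultimately show ?thesis by (simp add: cayley_def matrix_mult_distribs)
qed

text \<open>Keep the unitary factor and deform the positive one with \<open>cayley\<close>. At
  unitary end points the positive factor is the identity, which \<open>cayley\<close> does not move,
  so the homotopy fixes the ends.\<close>

lemma homotopic_polar_U:
  fixes p :: "real \<Rightarrow> 'n::finite smat"
  assumes p: "Sp_path p" "p 0 \<in> Usp" "p 1 \<in> Usp"
  shows "homotopic_paths Sp (\<lambda>t. polar_U (p t)) p"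
proof -
  define U where "U t = polar_U (p t)" for t
  define P where "P t = transpose (U t) ** p t" for t
  have pS: "p t \<in> Sp" if "t \<in> {0..1}" for t using p that by (simp add: Sp_path_def)
  have U: "U t \<in> Usp" and spd: "spd (P t)" if "t \<in> {0..1}" for t
    using polar_U_Usp polar_U_spd pS[OF that] by (auto simp: U_def P_def)
  have PS: "P t \<in> Sp" if "t \<in> {0..1}" for t
    unfolding P_def using U[OF that] pS[OF that] Usp_subset_Sp by (intro Sp_mult Sp_transpose) auto
  have UP: "U t ** P t = p t" if "t \<in> {0..1}" for t
    using Usp_inverse[OF U[OF that]] by (simp add: P_def matrix_mul_assoc)
  have ends: "U t = p t \<and> P t = mat 1" if "t = 0 \<or> t = 1" for t
    using that p polar_U_of_Usp Usp_inverse by (auto simp: U_def P_def)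
  have cp: "continuous_on {0..1} p" using p by (simp add: Sp_path_def)
  have cU: "continuous_on {0..1} U"
    unfolding U_def using pS by (intro continuous_on_compose2[OF continuous_on_polar_U cp]) auto
  have cP: "continuous_on {0..1} P" unfolding P_def by (intro continuous_intros cU cp)
  have cUs: "continuous_on ({0..1} \<times> {0..1}) (\<lambda>x::real\<times>real. U (snd x))"
    and cPs: "continuous_on ({0..1} \<times> {0..1}) (\<lambda>x::real\<times>real. P (snd x))"
    by (rule continuous_on_compose2[OF cU] continuous_on_compose2[OF cP]; auto intro!: continuous_intros)+
  show ?thesis unfolding U_def[symmetric]
  proof (rule homotopic_Sp_I[where h = "\<lambda>s t. U t ** cayley s (P t)"])
    show "continuous_on ({0..1} \<times> {0..1}) (\<lambda>x. U (snd x) ** cayley (fst x) (P (snd x)))"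
      unfolding cayley_def
      by (intro continuous_intros cUs cPs continuous_on_matrix_inv spd_invertible cayley_denominator spd) auto
    show "U t ** cayley s (P t) \<in> Sp" if "s \<in> {0..1}" "t \<in> {0..1}" for s t
      using that U[of t] Usp_subset_Sp by (intro Sp_mult cayley_Sp spd PS) auto
  qed (use UP spd ends in \<open>auto simp: cayley_0 cayley_1 cayley_mat_1\<close>)
qed

text \<open>Both \<open>transpose Jmat ** Q ** Jmat\<close> and the inverse of \<open>Q\<close> are
  positive square roots of the inverse of \<open>Q ** Q\<close>, hence equal.\<close>

lemma spd_sqrt_Sp:
  fixes Q :: "'n::finite smat"
  assumes Q: "spd Q" and P: "Q ** Q \<in> Sp"
  shows "Q \<in> Sp"
proof -
  define N where "N = transpose Jmat ** Q ** Jmat"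
  have QT: "transpose Q = Q" using Q by (simp add: spd_def)
  have inv: "invertible Q" using Q by (rule spd_invertible)
  have "spd N" unfolding N_def
    by (intro spd_congruence Q Sp_invertible subsetD[OF Usp_subset_Sp] Usp_Jmat)
  moreover have "spd (matrix_inv Q)" using Q by (rule spd_matrix_inv)
  moreover have "N ** N = matrix_inv Q ** matrix_inv Q"
  proof -
    have "N ** N = - (Jmat ** (Q ** Q) ** Jmat)"
      by (simp add: N_def matrix_mult_distribs matrix_mul_assoc[symmetric])
    also have "\<dots> = matrix_inv (Q ** Q)" using matrix_inv_Sp[OF P] by (simp add: transpose_simps QT)
    also have "\<dots> = matrix_inv Q ** matrix_inv Q"
    proof (rule matrix_inv_unique)
      have "Q ** Q ** (matrix_inv Q ** matrix_inv Q) = Q ** (Q ** matrix_inv Q) ** matrix_inv Q"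
        by (simp only: matrix_mul_assoc)
      then show "Q ** Q ** (matrix_inv Q ** matrix_inv Q) = mat 1" by (simp add: matrix_inv_right inv)
    qed
    finally show ?thesis .
  qed
  ultimately have "N = matrix_inv Q" by (rule spd_sqrt_unique)
  then have "Q ** N = mat 1" by (simp add: matrix_inv_right inv)
  then have "- (Q ** (Jmat ** Q)) ** Jmat ** Jmat = Jmat"
    by (simp add: N_def matrix_mult_distribs matrix_mul_assoc)
  then have "Q ** (Jmat ** Q) = Jmat" by (simp add: matrix_mult_distribs matrix_mul_assoc[symmetric])
  then show ?thesis by (simp add: Sp_iff QT)
qed

text \<open>For a positive symplectic \<open>P = Q\<^sup>2\<close> the matrix \<open>J P = Q\<^sup>-\<^sup>1 J Q\<close> is a conjugate of \<open>J\<close>, so it is the end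
  point of a positive path of bounded Maslov index; dividing by that path leaves a unitary end point.\<close>

theorem in_cone_if_maslov_large:
  fixes p :: "real \<Rightarrow> 'n::finite smat"
  assumes p: "spath p" and m: "maslov p \<ge> (4 * real CARD('n) + 5) * real CARD('n) * pi"
  shows "in_cone p"
proof -
  let ?n = "real CARD('n)"
  have Sp_p: "Sp_path p" and p0: "p 0 = mat 1" using p by (auto simp: spath_iff)
  have p1: "p 1 \<in> Sp" using Sp_p by (simp add: Sp_path_def)
  define U where "U = polar_U (p 1)"
  define P where "P = transpose U ** p 1"
  have U: "U \<in> Usp" and P: "spd P" using polar_U_Usp[OF p1] polar_U_spd[OF p1] by (simp_all add: U_def P_def)
  have PS: "P \<in> Sp" unfolding P_def using U p1 Usp_subset_Sp by (intro Sp_mult Sp_transpose) auto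
  have UP: "U ** P = p 1" using Usp_inverse[OF U] by (simp add: P_def matrix_mul_assoc)
  obtain Q where Q: "spd Q" "Q ** Q = P" using spd_sqrt[OF P] .
  have QS: "Q \<in> Sp" using spd_sqrt_Sp Q PS by blast
  have QT: "transpose Q = Q" using Q by (simp add: spd_def)
  define k where "k t = matrix_inv Q ** crot (mat 1) (pi / 2 * t) ** Q" for t
  have "pos_path (\<lambda>t. crot (mat 1 :: 'n smat) (pi / 2 * t))" by (rule pos_path_crot) auto
  then have pos_k: "pos_path k" unfolding k_def using QS by (rule pos_path_conjugate)
  then have "spath k" by (simp add: pos_path_def)
  then have Sp_k: "Sp_path k" and k0: "k 0 = mat 1" by (auto simp: spath_iff)
  have inv2: "matrix_inv (matrix_inv Q) = Q"
    using matrix_inv_left[OF Sp_invertible[OF QS]] by (rule matrix_inv_unique)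
  have k1: "k 1 = Jmat ** P"
  proof -
    have "crot (mat 1) (pi / 2) = (Jmat :: 'n smat)" by (simp add: crot_mat_1 Cscal_ii)
    then have "k 1 = matrix_inv Q ** Jmat ** Q" by (simp add: k_def)
    also have "\<dots> = Jmat ** Q ** Q" using Sp_Jmat_right[OF Sp_matrix_inv[OF QS]] by (simp add: inv2 QT)
    finally show ?thesis by (simp add: Q(2)[symmetric] matrix_mul_assoc)
  qed
  \<comment> \<open>The two constant factors have index 0, so conjugation costs only two defects on
    top of the index \<open>n pi / 2\<close> of the scalar rotation.\<close>
  have mk: "maslov k \<le> ?n * pi / 2 + 2 * ?n * pi"
  proof -
    let ?r = "\<lambda>t. crot (mat 1 :: 'n smat) (pi / 2 * t)"
    have Sp_r: "Sp_path ?r" using spath_crot[of "mat 1 :: 'n smat" "pi / 2"] by (simp add: spath_iff)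
    have c1: "Sp_path (\<lambda>t. matrix_inv Q)" and c2: "Sp_path (\<lambda>t. Q)"
      using QS Sp_matrix_inv by (auto intro!: Sp_path_const)
    have "k = pmult (pmult (\<lambda>t. matrix_inv Q) ?r) (\<lambda>t. Q)" by (simp add: k_def pmult_def fun_eq_iff)
    then have "maslov k = maslov (pmult (pmult (\<lambda>t. matrix_inv Q) ?r) (\<lambda>t. Q))" by (rule arg_cong)
    moreover have "\<bar>maslov (pmult (pmult (\<lambda>t. matrix_inv Q) ?r) (\<lambda>t. Q)) - maslov (pmult (\<lambda>t. matrix_inv Q) ?r) - maslov (\<lambda>t::real. Q)\<bar> \<le> ?n * pi"
      by (intro maslov_quasimorphism Sp_path_pmult c1 c2 Sp_r)
    moreover have "\<bar>maslov (pmult (\<lambda>t. matrix_inv Q) ?r) - maslov (\<lambda>t::real. matrix_inv Q) - maslov ?r\<bar> \<le> ?n * pi"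
      by (intro maslov_quasimorphism c1 Sp_r)
    moreover have "maslov (\<lambda>t::real. Q) = 0" "maslov (\<lambda>t::real. matrix_inv Q) = 0"
      using QS Sp_matrix_inv by (auto intro!: maslov_const)
    moreover have "maslov ?r = ?n * pi / 2" by (subst maslov_rotation) simp
    ultimately show ?thesis by linarith
  qed
  define p' where "p' = pmult p (pinv k)"
  have Sp_p': "Sp_path p'" unfolding p'_def by (intro Sp_path_pmult Sp_path_pinv Sp_p Sp_k)
  have p'0: "p' 0 = mat 1" by (simp add: p'_def pmult_def pinv_def p0 k0 matrix_inv_mat_1)
  have "p' 1 = U ** transpose Jmat"
  proof -
    have "matrix_inv (Jmat ** P) = matrix_inv P ** transpose Jmat"
    proof (rule matrix_inv_unique)
      have "Jmat ** P ** (matrix_inv P ** transpose Jmat) = Jmat ** (P ** matrix_inv P) ** transpose Jmat"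
        by (simp only: matrix_mul_assoc)
      then show "Jmat ** P ** (matrix_inv P ** transpose Jmat) = mat 1"
        using spd_invertible[OF P] by (simp add: matrix_inv_right matrix_mult_distribs)
    qed
    then have "p' 1 = U ** (P ** matrix_inv P) ** transpose Jmat"
      by (simp add: p'_def pmult_def pinv_def k1 UP[symmetric] matrix_mul_assoc)
    then show ?thesis using spd_invertible[OF P] by (simp add: matrix_inv_right)
  qed
  then have p'1: "p' 1 \<in> Usp" using U by (simp only: Usp_mult Usp_transpose Usp_Jmat)
  define u where "u t = polar_U (p' t)" for t
  have hom_u: "homotopic_paths Sp u p'"
    unfolding u_def using Sp_p' p'0 p'1 by (intro homotopic_polar_U) auto
  have uU: "u t \<in> Ufix {}" if "t \<in> {0..1}" for t
    using Sp_p' that by (simp add: u_def Sp_path_def polar_U_Usp)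
  have uc: "continuous_on {0..1} u"
    using homotopic_paths_imp_path[OF hom_u] by (simp add: path_def)
  have u0: "u 0 = mat 1" by (simp add: u_def p'0 polar_U_of_Usp)
  \<comment> \<open>Dividing by \<open>k\<close> loses its index, at most \<open>5/2 n pi\<close>,
    and one defect each for the inverse and the product. The total of \<open>9/2\<close> is rounded
    up to the 5 of the hypothesis.\<close>
  have "maslov p - maslov k - 2 * (?n * pi) \<le> maslov p'"
    using maslov_quasimorphism[OF Sp_p Sp_path_pinv[OF Sp_k]] maslov_pinv[OF Sp_k] unfolding p'_def by linarith
  then have mu: "maslov u \<ge> 4 * ?n * pi * ?n"
  proof -
    assume a: "maslov p - maslov k - 2 * (?n * pi) \<le> maslov p'"
    have "?n * pi \<ge> 0" by simp
    moreover have "(4 * ?n + 5) * ?n * pi = 4 * ?n * pi * ?n + 5 * (?n * pi)" by (simp add: algebra_simps)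
    moreover have "?n * pi / 2 + 2 * ?n * pi = 5 / 2 * (?n * pi)" by simp
    ultimately have "4 * ?n * pi * ?n \<le> maslov p'" using a mk m by linarith
    then show ?thesis by (simp add: maslov_homotopic[OF hom_u])
  qed
  obtain m where m: "CARD('n) = Suc m" using zero_less_card_finite[where 'a='n] by (cases "CARD('n)") auto
  have "card (- {} :: 'n set) = Suc m" using m by simp
  then obtain q where q: "pos_path q" "homotopic_paths Sp u q"
    using unitary_path_cone[OF _ uc uU u0] mu[unfolded m] m by metis
  have "homotopic_paths Sp p' q" using hom_u q(2) homotopic_paths_sym homotopic_paths_trans by blast
  then have "homotopic_paths Sp (pmult p' k) (pmult q k)"
    using homotopic_Sp_eq[OF Sp_k, of k] by (intro homotopic_pmult) auto
  moreover have "homotopic_paths Sp p (pmult p' k)"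
  proof (rule homotopic_Sp_eq[OF Sp_p])
    fix t :: real assume "t \<in> {0..1}"
    then have "invertible (k t)" using Sp_k by (simp add: Sp_path_def Sp_invertible)
    then show "p t = pmult p' k t"
      by (simp add: p'_def pmult_def pinv_def matrix_mul_assoc[symmetric] matrix_inv_left)
  qed
  ultimately have "homotopic_paths Sp p (pmult q k)" using homotopic_paths_trans by blast
  then show ?thesis unfolding in_cone_iff using p pos_path_pmult[OF q(1) pos_k] by blast
qed



subsection \<open>Relative growth\<close>

text \<open>Comparing \<open>a m / m\<close> and \<open>a k / k\<close> through
  \<open>a (m * k) / (m * k)\<close> shows that the quotients form a Cauchy sequence. Letting
  \<open>m\<close> grow in the same estimate keeps \<open>a\<close> within the defect
  \<open>C\<close> of a linear function, uniformly in \<open>k\<close>.\<close>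

lemma quasi_additive_limit:
  fixes a :: "nat \<Rightarrow> real"
  assumes quasi: "\<And>k l. \<bar>a (k + l) - a k - a l\<bar> \<le> C"
  obtains m where "(\<lambda>k. a k / real k) \<longlonglongrightarrow> m" "\<And>k. \<bar>a k - real k * m\<bar> \<le> C"
proof -
  have C: "C \<ge> 0" using quasi[of 0 0] by linarith
  have mult: "\<bar>a (Suc m * k) - real (Suc m) * a k\<bar> \<le> real m * C" for m k
  proof (induction m)
    case (Suc m)
    have "\<bar>a (k + Suc m * k) - a k - a (Suc m * k)\<bar> \<le> C" by (rule quasi)
    with Suc have "\<bar>a (k + Suc m * k) - (real (Suc m) * a k + a k)\<bar> \<le> real m * C + C" by linarith
    then show ?case by (simp add: algebra_simps)
  qed simp
  have dist: "\<bar>a m / real m - a k / real k\<bar> \<le> C / real m + C / real k" if "m > 0" "k > 0" for m k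
  proof -
    have half: "\<bar>a (m * k) / real (m * k) - a k / real k\<bar> \<le> C / real k" if "m > 0" "k > 0" for m k
    proof -
      obtain m' where m: "m = Suc m'" using \<open>m > 0\<close> by (cases m) auto
      have "\<bar>a (m * k) - real m * a k\<bar> \<le> real m * C"
        using mult[of m' k] C unfolding m by (simp add: algebra_simps)
      then have "\<bar>a (m * k) - real m * a k\<bar> / real (m * k) \<le> real m * C / real (m * k)"
        by (rule divide_right_mono) simp
      moreover have "\<bar>a (m * k) - real m * a k\<bar> / real (m * k) = \<bar>a (m * k) / real (m * k) - a k / real k\<bar>"
      proof -
        have "a k / real k = real m * a k / real (m * k)" using that by simp
        then show ?thesis by (simp only: diff_divide_distrib[symmetric] abs_divide)
      qed
      ultimately show ?thesis using that by simp
    qed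
    define x where "x = a (m * k) / real (m * k)"
    have "\<bar>x - a k / real k\<bar> \<le> C / real k" unfolding x_def by (rule half[OF that])
    moreover have "\<bar>x - a m / real m\<bar> \<le> C / real m"
      unfolding x_def mult.commute[of m k] by (rule half[OF that(2,1)])
    ultimately show ?thesis by linarith
  qed
  have "Cauchy (\<lambda>k. a k / real k)"
  proof (rule CauchyI')
    fix e :: real assume e: "e > 0"
    obtain N :: nat where N: "real N > 2 * C / e" using reals_Archimedean2 by blast
    show "\<exists>M. \<forall>m\<ge>M. \<forall>n>m. dist (a m / real m) (a n / real n) < e"
    proof (intro exI[of _ "Suc N"] allI impI)
      fix m n :: nat assume mn: "Suc N \<le> m" "m < n"
      have small: "C / real j < e / 2" if "Suc N \<le> j" for j
      proof -
        have "2 * C / e < real j" using N that by linarith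
        then show ?thesis using e that by (simp add: field_simps)
      qed
      have "dist (a m / real m) (a n / real n) \<le> C / real m + C / real n"
        using dist[of m n] mn by (simp add: dist_real_def)
      also have "\<dots> < e / 2 + e / 2" using mn by (intro add_strict_mono small) auto
      finally show "dist (a m / real m) (a n / real n) < e" by simp
    qed
  qed
  then obtain l where l: "(\<lambda>k. a k / real k) \<longlonglongrightarrow> l"
    using Cauchy_convergent_iff convergent_def by blast
  have "\<bar>a k - real k * l\<bar> \<le> C" for k
  proof (cases "k = 0")
    case True
    then show ?thesis using quasi[of 0 0] by simp
  next
    case False
    have "(\<lambda>m. \<bar>a m / real m - a k / real k\<bar>) \<longlonglongrightarrow> \<bar>l - a k / real k\<bar>"
      by (intro tendsto_intros l)
    moreover have "(\<lambda>m. C / real m + C / real k) \<longlonglongrightarrow> 0 + C / real k"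
      by (intro tendsto_intros tendsto_divide_0 tendsto_const filterlim_at_top_imp_at_infinity filterlim_real_sequentially)
    moreover have "\<forall>\<^sub>F m in sequentially. \<bar>a m / real m - a k / real k\<bar> \<le> C / real m + C / real k"
      using eventually_gt_at_top[of 0] by eventually_elim (use dist False in auto)
    ultimately have "\<bar>l - a k / real k\<bar> \<le> 0 + C / real k"
      by (intro tendsto_le[OF sequentially_bot])
    then have "real k * \<bar>l - a k / real k\<bar> \<le> real k * (C / real k)" by (intro mult_left_mono) auto
    moreover have "real k * \<bar>l - a k / real k\<bar> = \<bar>real k * (l - a k / real k)\<bar>" by (simp add: abs_mult)
    moreover have "real k * (l - a k / real k) = real k * l - a k" using False by (simp add: algebra_simps)
    ultimately show ?thesis using False by (simp add: abs_minus_commute)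
  qed
  with l that show thesis by blast
qed

section \<open>Powers of paths and the homogenized index\<close>

lemma spath_pone: "spath pone"
  by (simp add: spath_iff pone_def Sp_path_def)

lemma spath_mpow: "spath p \<Longrightarrow> spath (mpow p k)"
  by (induction k) (simp_all add: spath_pone spath_pmult)

lemma pmult_assoc: "pmult (pmult p q) r = pmult p (pmult q r)"
  by (simp add: pmult_def matrix_mul_assoc)

lemma pmult_pone [simp]: "pmult p pone = p" "pmult pone p = p"
  by (simp_all add: pmult_def pone_def)

lemma mpow_add: "mpow p (k + l) = pmult (mpow p k) (mpow p l)"
  by (induction k) (simp_all add: pmult_assoc)

lemma mpow_Suc_right: "mpow p (Suc k) = pmult (mpow p k) p"
  using mpow_add[of p k 1] by simp

text \<open>This also settles that the limit in \<open>maslov_hom\<close> exists.\<close>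

lemma maslov_mpow_bound:
  fixes p :: "real \<Rightarrow> 'n::finite smat"
  assumes "spath p"
  shows "\<bar>maslov (mpow p k) - real k * maslov_hom p\<bar> \<le> real CARD('n) * pi"
proof -
  have "\<bar>maslov (mpow p (k + l)) - maslov (mpow p k) - maslov (mpow p l)\<bar> \<le> real CARD('n) * pi" for k l
    unfolding mpow_add using spath_mpow[OF assms] by (intro maslov_quasimorphism) (simp_all add: spath_iff)
  then obtain m where m: "(\<lambda>k. maslov (mpow p k) / real k) \<longlonglongrightarrow> m"
    "\<And>k. \<bar>maslov (mpow p k) - real k * m\<bar> \<le> real CARD('n) * pi"
    using quasi_additive_limit[of "\<lambda>k. maslov (mpow p k)"] by blast
  have "maslov_hom p = m" unfolding maslov_hom_def using m(1) by (rule limI)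
  then show ?thesis using m(2) by simp
qed

text \<open>Restricted to the unit interval because outside it \<open>p t\<close> may be singular
  and \<open>matrix_inv\<close> arbitrary. The two paths are therefore related by a homotopy, not by
  equality.\<close>

lemma mpow_pinv:
  assumes "spath p" "t \<in> {0..1}"
  shows "mpow (pinv p) k t = pinv (mpow p k) t"
proof -
  have "invertible (p t)" using assms by (auto simp: spath_iff Sp_path_def Sp_invertible)
  then have inv: "matrix_inv (p t) ** p t = mat 1" by (rule matrix_inv_left)
  have "mpow (pinv p) k t ** mpow p k t = mat 1"
  proof (induction k)
    case (Suc k)
    have "mpow (pinv p) (Suc k) t ** mpow p (Suc k) t
        = mpow (pinv p) k t ** (matrix_inv (p t) ** p t) ** mpow p k t"
      by (simp add: mpow_Suc_right[of "pinv p"] del: mpow.simps(2)) (simp add: pmult_def pinv_def matrix_mul_assoc)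
    then show ?case using Suc by (simp add: inv)
  qed (simp add: pone_def)
  then have "mpow p k t ** mpow (pinv p) k t = mat 1" by (simp add: matrix_left_right_inverse)
  then have "matrix_inv (mpow p k t) = mpow (pinv p) k t" by (rule matrix_inv_unique)
  then show ?thesis by (simp add: pinv_def)
qed

lemma spath_zpow: "spath p \<Longrightarrow> spath (zpow p k)"
  by (simp add: zpow_def spath_mpow spath_pinv)

lemma maslov_zpow_bound:
  fixes p :: "real \<Rightarrow> 'n::finite smat"
  assumes p: "spath p"
  shows "\<bar>maslov (zpow p k) - real_of_int k * maslov_hom p\<bar> \<le> 2 * (real CARD('n) * pi)"
proof (cases "k \<ge> 0")
  case True
  then show ?thesis using maslov_mpow_bound[OF p, of "nat k"] by (simp add: zpow_def)
next
  case False
  have S: "Sp_path (mpow p (nat (- k)))" using spath_mpow[OF p] by (simp add: spath_iff)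
  have "maslov (mpow (pinv p) (nat (- k))) = maslov (pinv (mpow p (nat (- k))))"
    using spath_mpow[OF spath_pinv[OF p]] mpow_pinv[OF p]
    by (intro maslov_homotopic homotopic_Sp_eq) (simp_all add: spath_iff)
  moreover have "real (nat (- k)) * maslov_hom p = - (real_of_int k * maslov_hom p)" using False by simp
  moreover have "zpow p k = mpow (pinv p) (nat (- k))" using False by (simp add: zpow_def)
  ultimately show ?thesis
    using maslov_pinv[OF S] maslov_mpow_bound[OF p, of "nat (- k)"] by (simp only:) linarith
qed

text \<open>Five defects: one each for the product, the inverse and the power of \<open>g\<close>,
  and two for a possibly negative power of \<open>f\<close>.\<close>

lemma maslov_quotient_bound:
  fixes f g :: "real \<Rightarrow> 'n::finite smat"
  assumes f: "spath f" and g: "spath g"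
  shows "\<bar>maslov (pmult (zpow f p) (pinv (mpow g n))) - (real_of_int p * maslov_hom f - real n * maslov_hom g)\<bar>
    \<le> 5 * (real CARD('n) * pi)"
proof -
  have F: "Sp_path (zpow f p)" and G: "Sp_path (mpow g n)"
    using spath_zpow[OF f] spath_mpow[OF g] by (simp_all add: spath_iff)
  show ?thesis
    using maslov_quasimorphism[OF F Sp_path_pinv[OF G]] maslov_pinv[OF G] maslov_zpow_bound[OF f, of p]
      maslov_mpow_bound[OF g, of n] by linarith
qed

text \<open>The threshold \<open>4 n + 5\<close> of the cone criterion plus the five defects of a
  quotient. One constant serves both directions of the comparison.\<close>

abbreviation sge_bound :: "'n::finite itself \<Rightarrow> real" where
  "sge_bound _ \<equiv> (4 * real CARD('n) + 10) * real CARD('n) * pi"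

lemma sge_imp_maslov_hom:
  fixes f g :: "real \<Rightarrow> 'n::finite smat"
  assumes "spath f" "spath g" "sge (zpow f p) (mpow g n)"
  shows "real_of_int p * maslov_hom f \<ge> real n * maslov_hom g - sge_bound TYPE('n)"
proof -
  have "maslov (pmult (zpow f p) (pinv (mpow g n))) \<ge> 0"
    using assms(3) unfolding sge_def by (rule in_cone_maslov_nonneg)
  moreover have "5 * (real CARD('n) * pi) \<le> sge_bound TYPE('n)"
    unfolding mult.assoc[symmetric] by (intro mult_right_mono) auto
  ultimately show ?thesis using maslov_quotient_bound[OF assms(1,2), of p n] by linarith
qed

lemma sge_if_maslov_hom:
  fixes f g :: "real \<Rightarrow> 'n::finite smat"
  assumes f: "spath f" and g: "spath g"
    and le: "real_of_int p * maslov_hom f \<ge> real n * maslov_hom g + sge_bound TYPE('n)"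
  shows "sge (zpow f p) (mpow g n)"
  unfolding sge_def
proof (rule in_cone_if_maslov_large)
  show "spath (pmult (zpow f p) (pinv (mpow g n)))"
    using f g by (intro spath_pmult spath_zpow spath_pinv spath_mpow)
  have "sge_bound TYPE('n) = (4 * real CARD('n) + 5) * real CARD('n) * pi + 5 * (real CARD('n) * pi)"
    by (simp add: algebra_simps)
  then show "(4 * real CARD('n) + 5) * real CARD('n) * pi \<le> maslov (pmult (zpow f p) (pinv (mpow g n)))"
    using maslov_quotient_bound[OF f g, of p n] le by linarith
qed

text \<open>Scalar rotations have an exactly known \<open>maslov_hom\<close>. They serve as test
  elements for dominance and realize every positive value.\<close>

definition rotation :: "real \<Rightarrow> real \<Rightarrow> 'n::finite smat" where
  "rotation \<alpha> = (\<lambda>t. crot (mat 1) (\<alpha> * t))"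

lemma spath_rotation: "spath (rotation \<alpha>)"
  unfolding rotation_def by (rule spath_crot) simp

lemma mpow_rotation: "mpow (rotation \<alpha>) k = rotation (real k * \<alpha>)"
  by (induction k) (auto simp: rotation_def pone_def pmult_def crot_add algebra_simps)

lemma maslov_hom_rotation: "maslov_hom (rotation \<alpha> :: real \<Rightarrow> 'n::finite smat) = real CARD('n) * \<alpha>"
  unfolding maslov_hom_def
proof (rule limI)
  have "maslov (mpow (rotation \<alpha> :: real \<Rightarrow> 'n smat) k) / real k = real CARD('n) * \<alpha>" if "k > 0" for k
    unfolding mpow_rotation unfolding rotation_def maslov_rotation using that by simp
  then have "\<forall>\<^sub>F k in sequentially. real CARD('n) * \<alpha> = maslov (mpow (rotation \<alpha> :: real \<Rightarrow> 'n smat) k) / real k"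
    by (intro eventually_mono[OF eventually_gt_at_top[of 0]]) (rule sym)
  then show "(\<lambda>k. maslov (mpow (rotation \<alpha> :: real \<Rightarrow> 'n smat) k) / real k) \<longlonglongrightarrow> real CARD('n) * \<alpha>"
    by (rule Lim_transform_eventually[OF tendsto_const])
qed

lemma sge_mpow_iff: "sge (mpow f n) g \<longleftrightarrow> sge (zpow f (int n)) (mpow g 1)"
  by (simp add: zpow_def)

lemma dominant_spath: "dominant f \<Longrightarrow> spath f"
  by (simp add: dominant_def in_cone_def)

text \<open>Some power of \<open>f\<close> dominates a rotation whose index exceeds the comparison
  error by 1; the angle \<open>\<alpha>\<close> is chosen for this.\<close>

lemma dominant_maslov_hom_pos:
  fixes f :: "real \<Rightarrow> 'n::finite smat"
  assumes "dominant f" shows "maslov_hom f > 0"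
proof -
  define \<alpha> where "\<alpha> = (sge_bound TYPE('n) + 1) / real CARD('n)"
  obtain N where "sge (mpow f N) (rotation \<alpha>)"
    using assms spath_rotation unfolding dominant_def by blast
  then have "real_of_int (int N) * maslov_hom f \<ge> real 1 * maslov_hom (rotation \<alpha> :: real \<Rightarrow> 'n smat) - sge_bound TYPE('n)"
    unfolding sge_mpow_iff by (intro sge_imp_maslov_hom dominant_spath assms spath_rotation)
  moreover have "maslov_hom (rotation \<alpha> :: real \<Rightarrow> 'n smat) = sge_bound TYPE('n) + 1"
    unfolding maslov_hom_rotation by (simp add: \<alpha>_def)
  ultimately have "real N * maslov_hom f > 0" by simp
  then show ?thesis by (metis mult_nonneg_nonpos not_le of_nat_0_le_iff)
qed

lemma dominant_rotation:
  assumes "\<alpha> > 0" shows "dominant (rotation \<alpha> :: real \<Rightarrow> 'n::finite smat)"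
  unfolding dominant_def
proof (intro conjI allI impI)
  let ?r = "rotation \<alpha> :: real \<Rightarrow> 'n smat"
  have "pos_path ?r" unfolding rotation_def using assms by (intro pos_path_crot) auto
  moreover have "homotopic_paths Sp ?r ?r"
    using spath_rotation by (intro homotopic_Sp_eq) (auto simp: spath_iff)
  ultimately show "in_cone ?r" unfolding in_cone_iff using spath_rotation by blast
  show "\<not> same_elem ?r pone"
  proof
    assume "same_elem ?r pone"
    then have "maslov ?r = maslov (pone :: real \<Rightarrow> 'n smat)" unfolding same_elem_def by (rule maslov_homotopic)
    moreover have "maslov ?r = real CARD('n) * \<alpha>" unfolding rotation_def by (rule maslov_rotation)
    moreover have "maslov (pone :: real \<Rightarrow> 'n smat) = 0" unfolding pone_def by (rule maslov_const) simp
    ultimately show False using assms by simp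
  qed
  fix g :: "real \<Rightarrow> 'n smat" assume g: "spath g"
  have "real CARD('n) * \<alpha> > 0" using assms by simp
  then obtain N :: nat where "real N * (real CARD('n) * \<alpha>) > maslov_hom g + sge_bound TYPE('n)"
    using reals_Archimedean3 by blast
  then have "sge (zpow ?r (int N)) (mpow g 1)"
    using g by (intro sge_if_maslov_hom spath_rotation) (simp_all add: maslov_hom_rotation)
  then show "\<exists>n. sge (mpow ?r n) g" unfolding sge_mpow_iff by blast
qed

text \<open>The infimum is squeezed: no admissible exponent lies below
  \<open>(n \<nu> - ?B) / \<mu>\<close>, and rounding \<open>(n \<nu> + ?B) / \<mu>\<close> up gives
  an admissible one, whence the additional 1. Division by \<open>n\<close> removes these
  errors.\<close>

lemma rel_growth_eq:
  fixes f g :: "real \<Rightarrow> 'n::finite smat"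
  assumes "dominant f" "spath g"
  shows "rel_growth f g = maslov_hom g / maslov_hom f"
proof -
  let ?B = "sge_bound TYPE('n)"
  define \<mu> \<nu> where "\<mu> = maslov_hom f" and "\<nu> = maslov_hom g"
  have \<mu>: "\<mu> > 0" using dominant_maslov_hom_pos[OF assms(1)] by (simp add: \<mu>_def)
  have f: "spath f" using assms(1) by (rule dominant_spath)
  have bounds: "(real n * \<nu> - ?B) / \<mu> \<le> gamma_n f g n" "gamma_n f g n \<le> (real n * \<nu> + ?B) / \<mu> + 1" for n
  proof -
    let ?S = "{real_of_int p | p. sge (zpow f p) (mpow g n)}"
    have lower: "(real n * \<nu> - ?B) / \<mu> \<le> x" if "x \<in> ?S" for x
      using that sge_imp_maslov_hom[OF f assms(2)] \<mu> by (auto simp: \<mu>_def \<nu>_def divide_le_eq)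
    define p where "p = \<lceil>(real n * \<nu> + ?B) / \<mu>\<rceil>"
    have "(real n * \<nu> + ?B) / \<mu> \<le> real_of_int p" by (simp add: p_def)
    then have "sge (zpow f p) (mpow g n)"
      using \<mu> by (intro sge_if_maslov_hom f assms) (simp add: \<mu>_def \<nu>_def divide_le_eq)
    then have pS: "real_of_int p \<in> ?S" by blast
    then show "(real n * \<nu> - ?B) / \<mu> \<le> gamma_n f g n"
      unfolding gamma_n_def using lower by (intro cInf_greatest) auto
    have "gamma_n f g n \<le> real_of_int p"
      unfolding gamma_n_def using lower by (intro cInf_lower pS bdd_belowI) auto
    also have "\<dots> \<le> (real n * \<nu> + ?B) / \<mu> + 1" unfolding p_def by linarith
    finally show "gamma_n f g n \<le> (real n * \<nu> + ?B) / \<mu> + 1" .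
  qed
  have lim: "(\<lambda>n. \<nu> / \<mu> + c / real n) \<longlonglongrightarrow> \<nu> / \<mu> + 0" for c
    by (intro tendsto_intros tendsto_divide_0 filterlim_at_top_imp_at_infinity filterlim_real_sequentially)
  have "(\<lambda>n. gamma_n f g n / real n) \<longlonglongrightarrow> \<nu> / \<mu> + 0"
  proof (rule tendsto_sandwich[OF _ _ lim[of "- ?B / \<mu>"] lim[of "?B / \<mu> + 1"]])
    show "\<forall>\<^sub>F n in sequentially. \<nu> / \<mu> + (- ?B / \<mu>) / real n \<le> gamma_n f g n / real n"
      using eventually_gt_at_top[of 0]
    proof eventually_elim
      case (elim n)
      have "\<nu> / \<mu> + (- ?B / \<mu>) / real n = (real n * \<nu> - ?B) / \<mu> / real n"
        using elim \<mu> by (simp add: divide_simps)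
      then show ?case using bounds(1)[of n] by (simp only:) (rule divide_right_mono, auto)
    qed
    show "\<forall>\<^sub>F n in sequentially. gamma_n f g n / real n \<le> \<nu> / \<mu> + (?B / \<mu> + 1) / real n"
      using eventually_gt_at_top[of 0]
    proof eventually_elim
      case (elim n)
      have "\<nu> / \<mu> + (?B / \<mu> + 1) / real n = ((real n * \<nu> + ?B) / \<mu> + 1) / real n"
        using elim \<mu> by (simp add: divide_simps)
      then show ?case using bounds(2)[of n] by (simp only:) (rule divide_right_mono, auto)
    qed
  qed
  then show ?thesis unfolding rel_growth_def \<mu>_def \<nu>_def by (intro limI) simp
qed

text \<open>The two growth rates are reciprocal, so the larger of their logarithms is an absolute
  value.\<close>

lemma Kdist_eq:
  assumes "dominant f" "dominant g"
  shows "Kdist f g = \<bar>ln (maslov_hom f) - ln (maslov_hom g)\<bar>"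
proof -
  have pos: "maslov_hom f > 0" "maslov_hom g > 0" using assms dominant_maslov_hom_pos by auto
  show ?thesis
    using assms unfolding Kdist_def by (simp add: rel_growth_eq dominant_spath ln_div pos[THEN less_imp_neq, symmetric] max_def)
qed

text \<open>Classes are level sets of \<open>maslov_hom\<close>, which makes the choice of
  representatives in \<open>Zdist\<close> harmless.\<close>

lemma Zrel_class:
  assumes "dominant X"
  shows "Zrel `` {X} = {g. dominant g \<and> maslov_hom g = maslov_hom X}"
proof -
  have "Kdist X g = 0 \<longleftrightarrow> maslov_hom g = maslov_hom X" if "dominant g" for g
    using Kdist_eq[OF assms that] dominant_maslov_hom_pos[OF assms] dominant_maslov_hom_pos[OF that]
    by (auto simp: ln_inj_iff)
  then show ?thesis using assms by (auto simp: Zrel_def)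
qed

theorem theorem1p2:
  shows "(\<forall>X::real \<Rightarrow> 'n::finite smat. dominant X \<longrightarrow> maslov_hom X > 0) \<and>
         (\<exists>\<Phi>. bij_betw \<Phi> (Zspace :: (real \<Rightarrow> 'n smat) set set) (UNIV :: real set) \<and>
               (\<forall>A\<in>Zspace. \<forall>B\<in>Zspace. Zdist A B = \<bar>\<Phi> A - \<Phi> B\<bar>) \<and>
               (\<forall>X. dominant X \<longrightarrow> \<Phi> (Zrel `` {X}) = ln (maslov_hom X)))"
proof (intro conjI allI impI)
  show "maslov_hom X > 0" if "dominant X" for X :: "real \<Rightarrow> 'n smat"
    using that by (rule dominant_maslov_hom_pos)
  \<comment> \<open>The same choice of representative as in \<open>Zdist\<close>, so that the
    distance formula follows from \<open>Kdist_eq\<close> directly.\<close>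
  define \<Phi> where "\<Phi> A = ln (maslov_hom (SOME f. f \<in> A))" for A :: "(real \<Rightarrow> 'n smat) set"
  have some: "dominant (SOME f. f \<in> Zrel `` {X}) \<and> maslov_hom (SOME f. f \<in> Zrel `` {X}) = maslov_hom X"
    if "dominant X" for X :: "real \<Rightarrow> 'n smat"
    using someI[of "\<lambda>f. f \<in> Zrel `` {X}" X] that by (simp add: Zrel_class)
  have val: "\<Phi> (Zrel `` {X}) = ln (maslov_hom X)" if "dominant X" for X
    using some[OF that] by (simp add: \<Phi>_def)
  show "\<exists>\<Phi>. bij_betw \<Phi> (Zspace :: (real \<Rightarrow> 'n smat) set set) (UNIV :: real set) \<and>
               (\<forall>A\<in>Zspace. \<forall>B\<in>Zspace. Zdist A B = \<bar>\<Phi> A - \<Phi> B\<bar>) \<and>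
               (\<forall>X. dominant X \<longrightarrow> \<Phi> (Zrel `` {X}) = ln (maslov_hom X))"
  proof (intro exI[of _ \<Phi>] conjI ballI allI impI)
    show "\<Phi> (Zrel `` {X}) = ln (maslov_hom X)" if "dominant X" for X using that by (rule val)
    show "Zdist A B = \<bar>\<Phi> A - \<Phi> B\<bar>" if A: "A \<in> Zspace" and B: "B \<in> Zspace" for A B
    proof -
      obtain X Y where "dominant X" "A = Zrel `` {X}" "dominant Y" "B = Zrel `` {Y}"
        using A B unfolding Zspace_def quotient_def by blast
      then have "dominant (SOME f. f \<in> A)" "dominant (SOME f. f \<in> B)" using some by simp_all
      then show ?thesis unfolding Zdist_def \<Phi>_def by (rule Kdist_eq)
    qed
    show "bij_betw \<Phi> Zspace UNIV"
      unfolding bij_betw_def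
    proof (intro conjI inj_onI)
      fix A B assume A: "A \<in> Zspace" and B: "B \<in> Zspace" and eq: "\<Phi> A = \<Phi> B"
      obtain X Y where XY: "dominant X" "A = Zrel `` {X}" "dominant Y" "B = Zrel `` {Y}"
        using A B unfolding Zspace_def quotient_def by blast
      then have "maslov_hom X = maslov_hom Y"
        using eq val dominant_maslov_hom_pos by (metis ln_inj_iff)
      then show "A = B" using XY by (simp add: Zrel_class)
    next
      have "r \<in> \<Phi> ` Zspace" for r
      proof -
        \<comment> \<open>Dividing by \<open>n\<close> compensates the factor in
          \<open>maslov_hom_rotation\<close> and yields the value \<open>exp r\<close>.\<close>
        define X where "X = (rotation (exp r / real CARD('n)) :: real \<Rightarrow> 'n smat)"
        have X: "dominant X" unfolding X_def by (intro dominant_rotation) simp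
        have "maslov_hom X = exp r" unfolding X_def maslov_hom_rotation by simp
        then have "\<Phi> (Zrel `` {X}) = r" using val[OF X] by simp
        moreover have "Zrel `` {X} \<in> Zspace" unfolding Zspace_def using X by (intro quotientI) simp
        ultimately show ?thesis by (metis imageI)
      qed
      then show "\<Phi> ` Zspace = UNIV" by auto
    qed
  qed
qed

end
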